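(* Let $q$ be large, and suppose $\log x\le \frac{(\log\log q)^2}{(\log\log\log q)^2}$. For every $|\theta|\le\pi$ there are at least $q^{1-\frac{2}{\log x}}$ characters $\chi \pmod q$ for which $$\sum_{n\le x}\chi(n)=e^{i\theta}\,\Psi(x,\log q;\chi_0)+O\left(\Psi(x,\log q)\left(\frac{1}{\log x}+\frac{\log x\,(\log\log\log q)^2}{(\log\log q)^2}\right)\right).$$ If $q$ has no prime factors below $\log q$, then this may be written as $$\sum_{n\le x}\chi(n)=x\,e^{i\theta}\,\rho\left(\frac{\log x}{\log\log q}\right)\left(1+O\left(\frac{1}{\log x}+\frac{\log x\,(\log\log\log q)^2}{(\log\log q)^2}\right)\right).$$
   Context: $\chi_0$ is the principal character modulo $q$. For an arithmetic function $f$, $\Psi(x,y;f)=\sum_{n\le x,\ p\mid n\Rightarrow p\le y} f(n)$, and $\Psi(x,y)=\Psi(x,y;1)$. $\rho$ is the Dickman function: $\rho(u)=1$ for $0\le u\le 1$, and $\rho$ is the continuous function satisfying $\rho'(u)=-\rho(u-1)/u$ for $u>1$. Implied constants are absolute. *)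

theory Defs
  imports "HOL-Analysis.Analysis" "HOL-Number_Theory.Number_Theory"
begin

definition dirichlet_character :: "nat \<Rightarrow> (nat \<Rightarrow> complex) \<Rightarrow> bool" where
  "dirichlet_character q X \<longleftrightarrow>
     X 1 = 1 \<and>
     (\<forall>a b. X (a * b) = X a * X b) \<and>
     (\<forall>a. X (a + q) = X a) \<and>
     (\<forall>a. X a = 0 \<longleftrightarrow> \<not> coprime a q)"

definition principal_character :: "nat \<Rightarrow> nat \<Rightarrow> complex" where
  "principal_character q n = (if coprime n q then 1 else 0)"

definition smooth_sum :: "real \<Rightarrow> real \<Rightarrow> (nat \<Rightarrow> 'a::comm_monoid_add) \<Rightarrow> 'a" where
  "smooth_sum x y f = sum f {n \<in> {1..nat \<lfloor>x\<rfloor>}. \<forall>p. prime p \<and> p dvd n \<longrightarrow> real p \<le> y}"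

text \<open>
  Only the values of the Dickman function on the nonnegative reals matter; setting it to zero
  on the negative reals makes the definite description below unique.
\<close>

definition is_dickman :: "(real \<Rightarrow> real) \<Rightarrow> bool" where
  "is_dickman \<rho> \<longleftrightarrow>
     (\<forall>u<0. \<rho> u = 0) \<and>
     (\<forall>u\<in>{0..1}. \<rho> u = 1) \<and>
     continuous_on {0..} \<rho> \<and>
     (\<forall>u>1. (\<rho> has_real_derivative - \<rho> (u - 1) / u) (at u))"

definition dickman :: "real \<Rightarrow> real" where
  "dickman = (THE \<rho>. is_dickman \<rho>)"

lemma is_dickman_unique:
  assumes f: "is_dickman f" and g: "is_dickman g"
  shows "f = g"
proof -
  have *: "\<forall>u\<le>real (Suc n). f u = g u" for n
  proof (induction n)
    case 0
    show ?case
    proof (intro allI impI)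
      fix u :: real assume "u \<le> real (Suc 0)"
      then show "f u = g u"
        using f g by (cases "u < 0") (auto simp: is_dickman_def)
    qed
  next
    case (Suc n)
    show ?case
    proof (intro allI impI)
      fix u assume u: "u \<le> real (Suc (Suc n))"
      show "f u = g u"
      proof (cases "u \<le> real (Suc n)")
        case True
        then show ?thesis using Suc by auto
      next
        case False
        have "(\<lambda>v. f v - g v) u = (\<lambda>v. f v - g v) (real (Suc n))"
        proof (rule DERIV_isconst2[where f = "\<lambda>v. f v - g v" and b = "real (Suc (Suc n))"])
          show "real (Suc n) < real (Suc (Suc n))" by simp
          have "continuous_on {0..} (\<lambda>v. f v - g v)"
            using f g by (intro continuous_on_diff) (auto simp: is_dickman_def)
          then show "continuous_on {real (Suc n)..real (Suc (Suc n))} (\<lambda>v. f v - g v)"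
            by (rule continuous_on_subset) auto
        next
          fix v assume v: "real (Suc n) < v" "v < real (Suc (Suc n))"
          then have v1: "v > 1" by simp
          have "((\<lambda>v. f v - g v) has_real_derivative
                  (- f (v - 1) / v) - (- g (v - 1) / v)) (at v)"
            using f g v1 by (intro DERIV_diff) (auto simp: is_dickman_def)
          moreover have "f (v - 1) = g (v - 1)"
            using Suc v by auto
          ultimately show "((\<lambda>v. f v - g v) has_real_derivative 0) (at v)"
            by simp
        qed (use u False in auto)
        then show ?thesis using Suc by simp
      qed
    qed
  qed
  show ?thesis
  proof
    fix u
    obtain n where "u \<le> real n" using real_arch_simple by blast
    then show "f u = g u" using *[of n] by simp
  qed
qed

lemma is_dickman_exists: "\<exists>\<rho>. is_dickman \<rho>"
proof -
  define T :: "(real \<Rightarrow> real) \<Rightarrow> real \<Rightarrow> real"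
    where "T f u = (if u \<le> 1 then 1 else 1 - integral {1..u} (\<lambda>t. f (t - 1) / t))" for f u
  define F where "F n = (T ^^ n) (\<lambda>_. 1)" for n
  have F_Suc: "F (Suc n) = T (F n)" for n by (simp add: F_def)
  have F_le1: "F n u = 1" if "u \<le> 1" for n u
    using that by (cases n) (simp_all add: F_def T_def)
  have cont_integrand: "continuous_on {1..b} (\<lambda>t. f (t - 1) / t)"
    if "continuous_on UNIV f" for f :: "real \<Rightarrow> real" and b
    by (intro continuous_intros continuous_on_compose2[OF that]) auto
  have T_deriv: "(T f has_real_derivative - f (u - 1) / u) (at u)"
    if f: "continuous_on UNIV f" and u: "u > 1" for f u
  proof -
    let ?g = "\<lambda>v. 1 - integral {1..v} (\<lambda>t. f (t - 1) / t)"
    have "((\<lambda>v. integral {1..v} (\<lambda>t. f (t - 1) / t)) has_real_derivative f (u - 1) / u)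
            (at u within {1..u + 1})"
      using integral_has_real_derivative[OF cont_integrand[OF f, of "u + 1"], of u] u by auto
    then have "((\<lambda>v. integral {1..v} (\<lambda>t. f (t - 1) / t)) has_real_derivative f (u - 1) / u) (at u)"
      using u at_within_Icc_at[of 1 u "u + 1"] by simp
    then have g: "(?g has_real_derivative - (f (u - 1) / u)) (at u)"
      by (auto intro!: derivative_eq_intros)
    have "\<forall>\<^sub>F v in nhds u. v \<in> {1<..}"
      using u by (intro eventually_nhds_in_open) auto
    then have "\<forall>\<^sub>F v in nhds u. T f v = ?g v"
      by eventually_elim (simp add: T_def)
    then show ?thesis
      using DERIV_cong_ev[of u u "T f" ?g] g by auto
  qed
  have T_cont: "continuous_on UNIV (T f)" if f: "continuous_on UNIV f" for f
  proof -
    have c1: "continuous_on {1..b} (\<lambda>v. 1 - integral {1..v} (\<lambda>t. f (t - 1) / t))" for b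
      by (intro continuous_intros indefinite_integral_continuous_1
            integrable_continuous_real cont_integrand f)
    have c2: "continuous_on {..b} (T f)" if "b \<ge> 1" for b
    proof -
      have "continuous_on ({..1} \<union> {1..b})
              (\<lambda>u. if u \<le> 1 then 1 else 1 - integral {1..u} (\<lambda>t. f (t - 1) / t))"
        by (rule continuous_on_If) (use c1 in \<open>auto intro: continuous_on_const\<close>)
      moreover have "{..1} \<union> {1..b} = {..b}" using that by auto
      ultimately show ?thesis by (simp add: T_def[abs_def])
    qed
    have "isCont (T f) u" for u
    proof -
      have "continuous_on {..<max 1 u + 1} (T f)"
        by (rule continuous_on_subset[OF c2[of "max 1 u + 1"]]) auto
      then show ?thesis
        by (rule continuous_on_interior) (simp add: interior_open)
    qed
    then show ?thesis by (simp add: continuous_at_imp_continuous_on)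
  qed
  have F_cont: "continuous_on UNIV (F n)" for n
    by (induction n) (simp add: F_def, simp add: F_Suc T_cont)
  have F_step: "\<forall>u\<le>real (Suc n). F (Suc n) u = F n u" for n
  proof (induction n)
    case 0
    then show ?case by (simp add: F_le1)
  next
    case (Suc n)
    show ?case
    proof (intro allI impI)
      fix u assume u: "u \<le> real (Suc (Suc n))"
      have "integral {1..u} (\<lambda>t. F (Suc n) (t - 1) / t) = integral {1..u} (\<lambda>t. F n (t - 1) / t)"
        using Suc u by (intro integral_cong) auto
      then show "F (Suc (Suc n)) u = F (Suc n) u"
        by (simp add: F_Suc[of "Suc n"] F_Suc[of n] T_def)
    qed
  qed
  have F_eq: "F m u = F n u" if "n \<le> m" "u \<le> real (Suc n)" for m n u
    using that(1)
  proof (induction m rule: dec_induct)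
    case base
    then show ?case by simp
  next
    case (step m)
    have "u \<le> real (Suc m)" using step.hyps that(2) by simp
    then have "F (Suc m) u = F m u" using F_step[of m] by blast
    then show ?case using step by simp
  qed
  define R where "R u = (if u < 0 then 0 else F (nat \<lceil>u\<rceil>) u)" for u :: real
  have R_eq: "R u = F n u" if "0 \<le> u" "u \<le> real n" for u n
  proof -
    have "nat \<lceil>u\<rceil> \<le> n" using that by (simp add: nat_le_iff ceiling_le_iff)
    moreover have "u \<le> real (Suc (nat \<lceil>u\<rceil>))" by linarith
    ultimately show ?thesis using F_eq[of "nat \<lceil>u\<rceil>" n u] that by (simp add: R_def)
  qed
  have R_cont: "continuous_on {0..} R"
  proof (rule continuous_on_eq_continuous_within[THEN iffD2], rule ballI)
    fix u :: real assume u: "u \<in> {0..}"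
    obtain n where n: "u < real n" using reals_Archimedean2 by blast
    have "continuous_on {0..} (F n)"
      by (rule continuous_on_subset[OF F_cont]) simp
    then have "(F n \<longlongrightarrow> F n u) (at u within {0..})"
      using u by (simp add: continuous_on_def)
    moreover have "\<forall>\<^sub>F v in at u within {0..}. R v = F n v"
      unfolding eventually_at_topological
      by (rule exI[of _ "{..<real n}"]) (use n in \<open>simp add: R_eq\<close>)
    moreover have "R u = F n u" using R_eq u n by simp
    ultimately show "continuous (at u within {0..}) R"
      unfolding continuous_within by (simp add: tendsto_cong)
  qed
  have R_deriv: "(R has_real_derivative - R (u - 1) / u) (at u)" if u: "u > 1" for u
  proof -
    obtain n where n: "u < real n" using reals_Archimedean2 by blast
    have "\<forall>\<^sub>F v in nhds u. v \<in> {0<..<real (Suc n)}"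
      using u n by (intro eventually_nhds_in_open) auto
    then have ev: "\<forall>\<^sub>F v in nhds u. R v = F (Suc n) v"
      by eventually_elim (simp add: R_eq)
    have "(F (Suc n) has_real_derivative - F n (u - 1) / u) (at u)"
      unfolding F_Suc by (rule T_deriv[OF F_cont u])
    moreover have "F n (u - 1) = R (u - 1)"
      using u n by (intro R_eq[symmetric]) auto
    ultimately show ?thesis
      using DERIV_cong_ev[OF refl ev refl] by simp
  qed
  have "is_dickman R"
    unfolding is_dickman_def using R_cont R_deriv R_eq[of _ 1] F_le1[of _ 1]
    by (auto simp: R_def F_le1)
  then show ?thesis by blast
qed

lemma is_dickman_dickman: "is_dickman dickman"
proof -
  have "\<exists>!\<rho>. is_dickman \<rho>"
    using is_dickman_exists is_dickman_unique by auto
  then show ?thesis unfolding dickman_def by (rule theI')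
qed

definition error_term :: "nat \<Rightarrow> real \<Rightarrow> real" where
  "error_term q x = 1 / ln x + ln x * (ln (ln (ln q)))\<^sup>2 / (ln (ln q))\<^sup>2"

end

theory Submission
  imports Defs "HOL-Real_Asymp.Real_Asymp"
begin

text \<open>
  Write $y = \log q$, $L = \log y$, $\lambda = \log L$, $z = y / L^{12}$ and $t = \theta / \log x$.
  The characters are found by a weighted second moment. The weight of $\chi$ is $|R(\chi)|^2$ with
  the resonator $R(\chi) = \prod_{p \le z,\, p \nmid q} \sum_{j \le D} (\chi(p) p^{-it})^j$, $D \approx L^8$.
  It expands into a Dirichlet polynomial with $M = (D+1)^{\pi}$ unimodular coefficients, $\pi$ the
  number of primes used, of length far below $q$, so orthogonality gives total weight $\phi(q) M$, while no single weight exceeds $M^2$.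
  Since $(\chi(p) p^{-it} - 1) R(\chi)$ telescopes to a bounded multiple of the resonator without $p$,
  the weighted mean of $|\chi(p) p^{-it} - 1|^2$ is at most $4/(D+1)$; and the weighted second moment
  of the sum of $\chi$ over the integers with a prime factor exceeding $z$ is at most $x^2/z$.
  Hence for at least $\phi(q)/(2M) \ge q^{1 - 2/\log x}$ characters the sum is close to
  $\sum n^{it}$ over the $z$-smooth $n \le x$ coprime to $q$, and there $n^{it} \approx x^{it} = e^{i\theta}$ for most $n$.

  The comparison of $\Psi(x,z)$ with $\Psi(x,y)$ and of $\Psi(x,y)$ with $x \rho(u)$, $u = \log x / L$,
  uses the identity
  $\Psi(x,y) \log x = \sum_n \log(x/n) + \sum_d \Lambda(d) \Psi(x/d,y)$ ($n$ and $d$ running over the $y$-smooth integers up to $x$),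
  Mertens' theorem and $u \rho(u) = \int_{u-1}^{u} \rho$, by induction over half-unit steps in $u$:
  the primes above $\sqrt{y}$ carry at least half of the sum and refer to values of $u$ smaller by
  at least $1/2$. The input on $\rho$ is the bound $\rho(u-1) \ll u \log(u+2)\, \rho(u)$.
\<close>

section \<open>Orthogonality of Dirichlet characters\<close>

text \<open>The parameters answer competing demands. Every product of a term \<open>m\<close> of the
  expanded resonator with an integer up to x must stay below q, so that congruent numbers are equal.
  The logarithm of the length is about D z L, that is y / L^3 for the choices made, and it has to be
  small against y; hence the power of L lost in z. The deviation at a prime is about 1 / sqrt D in
  mean square and an integer up to x has at most 2 log x prime factors, so a relative error 1 / log
  x asks for sqrt D of order (log x)^2, at most L^4. The number of terms satisfies log M \<le> D z,
  about y / L^4, well below y / log x, so crude bounds for M and for the totient suffice. The price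
  of z < y is paid at the primes in (z, y]: their reciprocals sum to O(\<lambda> / L), and dividing
  x by such a prime costs O(u \<lambda>) beyond the factor 1 / p. The product u \<lambda> \<lambda>
  / L is exactly the second error term of the statement.\<close>

definition partial_character :: "nat \<Rightarrow> nat set \<Rightarrow> (nat \<Rightarrow> complex) \<Rightarrow> bool" where
  "partial_character q H X \<longleftrightarrow>
     1 \<in> H \<and> X 1 = 1 \<and> (\<forall>a\<in>H. coprime a q) \<and>
     (\<forall>a\<in>H. \<forall>b\<in>H. a * b \<in> H \<and> X (a * b) = X a * X b) \<and>
     (\<forall>a b. a \<in> H \<longrightarrow> [a = b] (mod q) \<longrightarrow> b \<in> H \<and> X b = X a)"

lemma partial_character_power:
  assumes "partial_character q H X" "a \<in> H"
  shows "a ^ k \<in> H \<and> X (a ^ k) = X a ^ k"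
proof -
  have "1 \<in> H" "X 1 = 1" "\<And>b. b \<in> H \<Longrightarrow> a * b \<in> H \<and> X (a * b) = X a * X b"
    using assms unfolding partial_character_def by blast+
  then show ?thesis by (induction k) auto
qed

text \<open>A subgroup of the reduced residues is modelled as a set of naturals closed under
  congruence, so no quotient group has to be built. The axioms speak of products only; inverses come
  from Euler's theorem, since \<open>a ^ (totient q - 1)\<close> inverts \<open>a\<close> and thus
  \<open>b\<close> is congruent to a product of elements of \<open>H\<close>.\<close>

lemma partial_character_cancel:
  assumes pc: "partial_character q H X" and q: "q > 0" and a: "a \<in> H" and ab: "a * b \<in> H"
  shows "b \<in> H"
proof -
  have "coprime a q" using pc a by (auto simp: partial_character_def)
  then have "[a ^ totient q = 1] (mod q)" by (rule euler_theorem)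
  moreover have "a ^ totient q = a ^ (totient q - 1) * a"
    using q by (metis power_minus_mult totient_gt_0_iff)
  ultimately have "[a ^ (totient q - 1) * a * b = 1 * b] (mod q)"
    by (metis cong_scalar_right)
  moreover have "a ^ (totient q - 1) * (a * b) \<in> H"
    using partial_character_power[OF pc a] ab pc by (auto simp: partial_character_def)
  ultimately show ?thesis using pc unfolding partial_character_def
    by (metis mult.assoc mult_1)
qed

text \<open>On the subgroup generated by \<open>H\<close> and \<open>g\<close> the value at
  \<open>h * g ^ i\<close> has to be \<open>X h * \<zeta> ^ i\<close>. Two representations of one
  residue differ by a power of \<open>g\<close> lying in \<open>H\<close>; by minimality of
  \<open>n\<close> this is a power of \<open>g ^ n\<close>, where \<open>\<zeta>\<close> was chosen
  to agree with \<open>X\<close>.\<close>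

lemma partial_character_extend:
  assumes pc: "partial_character q H X" and q: "q > 0" and g: "coprime g q"
    and n: "n > 0" "g ^ n \<in> H" and min: "\<And>i. 0 < i \<Longrightarrow> i < n \<Longrightarrow> g ^ i \<notin> H"
    and z: "\<zeta> ^ n = X (g ^ n)"
  obtains H' X' where "partial_character q H' X'" "H \<subseteq> H'" "g \<in> H'" "X' g = \<zeta>"
    "\<And>h. h \<in> H \<Longrightarrow> X' h = X h"
proof -
  have H1: "1 \<in> H" "X 1 = 1" and Hco: "\<And>a. a \<in> H \<Longrightarrow> coprime a q"
    and Hm: "\<And>a b. a \<in> H \<Longrightarrow> b \<in> H \<Longrightarrow> a * b \<in> H \<and> X (a * b) = X a * X b"
    and Hc: "\<And>a b. a \<in> H \<Longrightarrow> [a = b] (mod q) \<Longrightarrow> b \<in> H \<and> X b = X a"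
    using pc unfolding partial_character_def by blast+
  \<comment> \<open>A relation, because a residue has many representations; \<open>uniq\<close>
    below makes it a function.\<close>
  define rel where "rel m v \<longleftrightarrow> (\<exists>h\<in>H. \<exists>i. [m = h * g ^ i] (mod q) \<and> v = X h * \<zeta> ^ i)" for m v
  have gi: "X (g ^ i) = \<zeta> ^ i" if "g ^ i \<in> H" for i
  proof -
    have e: "g ^ i = (g ^ n) ^ (i div n) * g ^ (i mod n)"
      by (metis mult_div_mod_eq power_add power_mult)
    \<comment> \<open>Cancelling the power of \<open>g ^ n\<close> leaves the remainder of the
      exponent, which minimality of \<open>n\<close> forces to be 0.\<close>
    have "g ^ (i mod n) \<in> H"
      using partial_character_cancel[OF pc q, of "(g ^ n) ^ (i div n)" "g ^ (i mod n)"]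
        partial_character_power[OF pc n(2), of "i div n"] e that by simp
    then have r: "i mod n = 0" using min[of "i mod n"] n(1) by (metis mod_less_divisor not_gr_zero)
    then have "X (g ^ i) = X ((g ^ n) ^ (i div n))" using e by simp
    also have "\<dots> = (\<zeta> ^ n) ^ (i div n)"
      using partial_character_power[OF pc n(2)] z by simp
    also have "\<dots> = \<zeta> ^ i" using r by (metis add.right_neutral mult_div_mod_eq power_mult)
    finally show ?thesis .
  qed
  have uniq0: "X h * \<zeta> ^ i = X h' * \<zeta> ^ j"
    if "h \<in> H" "h' \<in> H" "[h * g ^ i = h' * g ^ j] (mod q)" "i \<le> j" for h h' i j
  proof -
    have cg: "coprime (g ^ i) q" using g by simp
    have "g ^ j = g ^ (j - i) * g ^ i" using that(4) by (simp flip: power_add)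
    then have "[h * g ^ i = (h' * g ^ (j - i)) * g ^ i] (mod q)" using that(3) by (simp add: mult.assoc)
    then have c: "[h = h' * g ^ (j - i)] (mod q)"
      using cg by (simp add: cong_mult_rcancel_nat)
    then have "h' * g ^ (j - i) \<in> H" "X (h' * g ^ (j - i)) = X h" using Hc that(1) by blast+
    moreover from this have k: "g ^ (j - i) \<in> H"
      using partial_character_cancel[OF pc q that(2)] by blast
    ultimately have "X h = X h' * \<zeta> ^ (j - i)" using Hm[OF that(2) k] gi[OF k] by simp
    then show ?thesis using that(4) by (simp add: mult.assoc flip: power_add)
  qed
  have uniq: "v = w" if "rel m v" "rel m w" for m v w
  proof -
    obtain h i where *: "h \<in> H" "[m = h * g ^ i] (mod q)" "v = X h * \<zeta> ^ i"
      using \<open>rel m v\<close> unfolding rel_def by blast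
    obtain h' j where *: "h \<in> H" "h' \<in> H" "[m = h * g ^ i] (mod q)" "v = X h * \<zeta> ^ i"
       "[m = h' * g ^ j] (mod q)" "w = X h' * \<zeta> ^ j"
      using * \<open>rel m w\<close> unfolding rel_def by blast
    have c: "[h * g ^ i = h' * g ^ j] (mod q)" using * by (metis cong_sym cong_trans)
    show ?thesis
      using uniq0[OF *(1,2) c] uniq0[OF *(2,1) cong_sym[OF c]] * by (metis nle_le)
  qed
  define X' where "X' m = (THE v. rel m v)" for m
  define H' where "H' = {m. \<exists>v. rel m v}"
  have X'eq: "X' m = v" if "rel m v" for m v
    unfolding X'_def using that uniq by blast
  have relH: "rel h (X h)" if "h \<in> H" for h
    unfolding rel_def using that by (intro bexI[of _ h] exI[of _ 0]) auto
  have relg: "rel g \<zeta>"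
    unfolding rel_def using H1 by (intro bexI[of _ 1] exI[of _ 1]) auto
  have relm: "rel (a * b) (v * w)" if "rel a v" "rel b w" for a b v w
  proof -
    obtain h i where *: "h \<in> H" "[a = h * g ^ i] (mod q)" "v = X h * \<zeta> ^ i"
      using \<open>rel a v\<close> unfolding rel_def by blast
    obtain h' j where *: "h \<in> H" "h' \<in> H" "[a = h * g ^ i] (mod q)" "v = X h * \<zeta> ^ i"
       "[b = h' * g ^ j] (mod q)" "w = X h' * \<zeta> ^ j"
      using * \<open>rel b w\<close> unfolding rel_def by blast
    have "[a * b = (h * h') * g ^ (i + j)] (mod q)"
      using cong_mult[OF *(3,5)] by (simp add: power_add mult_ac)
    moreover have "v * w = X (h * h') * \<zeta> ^ (i + j)"
      using Hm[OF *(1,2)] * by (simp add: power_add mult_ac)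
    ultimately show ?thesis unfolding rel_def using Hm[OF *(1,2)] by blast
  qed
  have relc: "rel b v" if "rel a v" "[a = b] (mod q)" for a b v
    using that unfolding rel_def by (meson cong_sym cong_trans)
  have relco: "coprime a q" if "rel a v" for a v
  proof -
    obtain h i where "h \<in> H" "[a = h * g ^ i] (mod q)" using \<open>rel a v\<close> unfolding rel_def by blast
    then show ?thesis using Hco g
      by (metis cong_imp_coprime cong_sym coprime_mult_left_iff coprime_power_left_iff)
  qed
  have "partial_character q H' X'"
    unfolding partial_character_def H'_def mem_Collect_eq
  proof (intro conjI allI impI ballI)
    show "\<exists>v. rel 1 v" "X' 1 = 1" using relH[OF H1(1)] X'eq H1(2) by auto
  next
    fix a assume "a \<in> {m. \<exists>v. rel m v}" then show "coprime a q" using relco by blast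
  next
    fix a b assume "a \<in> {m. \<exists>v. rel m v}" "b \<in> {m. \<exists>v. rel m v}"
    then obtain v w where "rel a v" "rel b w" by blast
    then show "\<exists>v. rel (a * b) v" "X' (a * b) = X' a * X' b" using relm X'eq by metis+
  next
    fix a b assume "\<exists>v. rel a v" "[a = b] (mod q)"
    then show "\<exists>v. rel b v" "X' b = X' a" using relc X'eq by metis+
  qed
  moreover have "H \<subseteq> H'" "g \<in> H'" using relH relg by (auto simp: H'_def)
  moreover have "X' g = \<zeta>" using X'eq relg by blast
  moreover have "\<And>h. h \<in> H \<Longrightarrow> X' h = X h" using X'eq[OF relH] .
  ultimately show ?thesis using that by blast
qed

lemma complex_nth_root_exists: "n > 0 \<Longrightarrow> \<exists>z::complex. z ^ n = w"
proof -
  assume n: "n > 0"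
  have "rcis (root n (norm w)) (Arg w / n) ^ n = w"
    using n by (simp add: DeMoivre2 rcis_cmod_Arg)
  then show ?thesis by blast
qed

text \<open>Induction on the number of reduced residues outside \<open>H\<close>: a missing
  \<open>g\<close> is adjoined with any n-th root of \<open>X (g ^ n)\<close>, where
  \<open>n\<close> is the least positive exponent that leads into \<open>H\<close>. Once nothing is
  missing, extension by 0 gives a Dirichlet character.\<close>

lemma dirichlet_character_extends:
  assumes "partial_character q H X" and q: "q > 0"
  shows "\<exists>Y. dirichlet_character q Y \<and> (\<forall>h\<in>H. Y h = X h)"
  using assms(1)
proof (induction "card ({a\<in>{..<q}. coprime a q} - H)" arbitrary: H X rule: less_induct)
  case less
  note pc = less.prems
  show ?case
  proof (cases "\<exists>g. coprime g q \<and> g \<notin> H")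
    case True
    then obtain g0 where g0: "coprime g0 q" "g0 \<notin> H" by blast
    define g where "g = g0 mod q"
    have cg: "[g = g0] (mod q)" by (simp add: g_def cong_def)
    have g: "coprime g q" "g \<notin> H" "g < q"
      using g0 cg q pc unfolding partial_character_def
      by (metis cong_imp_coprime cong_sym, metis, simp add: g_def)
    have "[g ^ totient q = 1] (mod q)" using euler_theorem g by blast
    then have ex: "g ^ totient q \<in> H \<and> totient q > 0" using pc q unfolding partial_character_def
      by (metis cong_sym totient_gt_0_iff)
    define n where "n = (LEAST n. g ^ n \<in> H \<and> n > 0)"
    have n: "g ^ n \<in> H" "n > 0" using LeastI[of "\<lambda>n. g ^ n \<in> H \<and> n > 0", OF ex] by (auto simp: n_def)
    have min: "\<And>i. 0 < i \<Longrightarrow> i < n \<Longrightarrow> g ^ i \<notin> H" unfolding n_def using not_less_Least by blast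
    obtain \<zeta> where "\<zeta> ^ n = X (g ^ n)" using complex_nth_root_exists n(2) by blast
    then obtain H' X' where H': "partial_character q H' X'" "H \<subseteq> H'" "g \<in> H'"
       "\<And>h. h \<in> H \<Longrightarrow> X' h = X h"
      using partial_character_extend[OF pc q g(1) n(2,1) min] by metis
    have "{a\<in>{..<q}. coprime a q} - H' \<subset> {a\<in>{..<q}. coprime a q} - H"
      using H'(2,3) g by auto
    then have "card ({a\<in>{..<q}. coprime a q} - H') < card ({a\<in>{..<q}. coprime a q} - H)"
      by (intro psubset_card_mono) auto
    from less.hyps[OF this H'(1)] show ?thesis using H'(2,4) by (metis subsetD)
  next
    case False
    then have all: "\<And>g. coprime g q \<Longrightarrow> g \<in> H" by blast
    define Y where "Y a = (if coprime a q then X a else 0)" for a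
    have X1: "X 1 = 1" and Xm: "\<And>a b. a \<in> H \<Longrightarrow> b \<in> H \<Longrightarrow> X (a * b) = X a * X b"
      and Xc: "\<And>a b. a \<in> H \<Longrightarrow> [a = b] (mod q) \<Longrightarrow> X b = X a"
      using pc unfolding partial_character_def by blast+
    have nz: "X a \<noteq> 0" if "coprime a q" for a
    proof -
      have "[a ^ totient q = 1] (mod q)" using euler_theorem that by blast
      then have "X (a ^ totient q) = 1" using pc unfolding partial_character_def by (metis cong_sym)
      then have "X a ^ totient q = 1" using partial_character_power[OF pc all[OF that]] by metis
      then show ?thesis using q by (metis power_0_left totient_0_iff not_gr_zero zero_neq_one)
    qed
    have "dirichlet_character q Y"
      unfolding dirichlet_character_def
    proof (intro conjI allI)
      show "Y 1 = 1" using X1 by (simp add: Y_def)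
      show "Y (a * b) = Y a * Y b" for a b
        using Xm[of a b] all by (auto simp: Y_def)
      show "Y (a + q) = Y a" for a
      proof -
        have "[a = a + q] (mod q)" by (simp add: cong_def)
        then show ?thesis using Xc all[of a] unfolding Y_def
          by (metis cong_imp_coprime cong_sym)
      qed
      show "Y a = 0 \<longleftrightarrow> \<not> coprime a q" for a using nz by (simp add: Y_def)
    qed
    moreover have "\<forall>h\<in>H. Y h = X h" using pc unfolding Y_def partial_character_def by metis
    ultimately show ?thesis by blast
  qed
qed

text \<open>Start from the trivial character on the class of 1 and adjoin \<open>a\<close> with a
  primitive n-th root of unity, \<open>n\<close> being the order of \<open>a\<close>. As
  \<open>a\<close> is not congruent to 1, \<open>n\<close> is at least 2 and the root differs from
  1.\<close>

lemma dirichlet_character_separates: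
  assumes q: "q > 0" and a: "coprime a q" and ne: "\<not> [a = 1] (mod q)"
  shows "\<exists>Y. dirichlet_character q Y \<and> Y a \<noteq> 1"
proof -
  define H where "H = {m. [m = 1] (mod q)}"
  have pc: "partial_character q H (\<lambda>_. 1)"
    unfolding partial_character_def H_def
  proof (intro conjI allI impI ballI)
    show "coprime a q" if "a \<in> {m. [m = 1] (mod q)}" for a
      using that by (metis cong_imp_coprime cong_sym coprime_1_left mem_Collect_eq)
    show "a * b \<in> {m. [m = 1] (mod q)}" if "a \<in> {m. [m = 1] (mod q)}" "b \<in> {m. [m = 1] (mod q)}" for a b
      using cong_mult[of a 1 q b 1] that by simp
    show "b \<in> {m. [m = 1] (mod q)}" if "a \<in> {m. [m = 1] (mod q)}" "[a = b] (mod q)" for a b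
      using that by (metis cong_sym cong_trans mem_Collect_eq)
  qed (simp_all (no_asm))
  define n where "n = (LEAST n. a ^ n \<in> H \<and> n > 0)"
  have "[a ^ totient q = 1] (mod q)" using euler_theorem a by blast
  then have ex: "a ^ totient q \<in> H \<and> totient q > 0" using q by (simp add: H_def)
  have n: "a ^ n \<in> H" "n > 0" using LeastI[of "\<lambda>n. a ^ n \<in> H \<and> n > 0", OF ex] by (auto simp: n_def)
  have min: "\<And>i. 0 < i \<Longrightarrow> i < n \<Longrightarrow> a ^ i \<notin> H" unfolding n_def using not_less_Least by blast
  have n2: "n \<ge> 2" using n ne by (cases "n = 1") (auto simp: H_def)
  define \<zeta> where "\<zeta> = cis (2 * pi / n)"
  have "\<zeta> ^ n = 1" using n by (simp add: \<zeta>_def Complex.DeMoivre)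
  moreover have "\<zeta> \<noteq> 1"
  proof
    assume "\<zeta> = 1"
    then have "cos (2 * pi / n) = 1" by (simp add: \<zeta>_def complex_eq_iff)
    then obtain k :: int where "2 * pi / n = real_of_int k * 2 * pi" unfolding cos_one_2pi_int by blast
    then have "1 = real_of_int k * n" using n by (simp add: divide_simps)
    then have "real_of_int 1 = real_of_int (k * int n)" by simp
    then have "1 = k * int n" unfolding of_int_eq_iff .
    then have "int n dvd 1" by (metis dvd_triv_right)
    then show False using n2 by simp
  qed
  ultimately obtain H' X' where H': "partial_character q H' X'" "a \<in> H'" "X' a = \<zeta>" "\<zeta> \<noteq> 1"
    using partial_character_extend[OF pc q a n(2,1) min, of \<zeta>] by metis
  then show ?thesis using dirichlet_character_extends[OF H'(1) q] by metis
qed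

section \<open>Elementary properties of Dirichlet characters\<close>

lemma dirichlet_character_mod:
  assumes "dirichlet_character q X" "[a = b] (mod q)"
  shows "X a = X b"
proof -
  have *: "X (a + k * q) = X a" for a k
  proof (induction k)
    case (Suc k)
    have "X (a + Suc k * q) = X (a + k * q + q)" by (simp add: algebra_simps)
    then show ?case using assms(1) Suc by (simp only: dirichlet_character_def)
  qed simp
  have **: "X a = X (a mod q)" for a using *[of "a mod q" "a div q"] by simp
  show ?thesis using **[of a] **[of b] assms(2) by (simp add: cong_def)
qed

lemma dirichlet_character_mult: "dirichlet_character q X \<Longrightarrow> X (a * b) = X a * X b"
  unfolding dirichlet_character_def by blast

lemma dirichlet_character_1: "dirichlet_character q X \<Longrightarrow> X (Suc 0) = 1"
  unfolding dirichlet_character_def by simp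

lemma dirichlet_character_eq_0: "dirichlet_character q X \<Longrightarrow> X a = 0 \<longleftrightarrow> \<not> coprime a q"
  unfolding dirichlet_character_def by blast

lemma dirichlet_character_power: "dirichlet_character q X \<Longrightarrow> X (a ^ k) = X a ^ k"
  by (induction k) (simp_all add: dirichlet_character_1 dirichlet_character_mult)

lemma dirichlet_character_power_totient:
  assumes "dirichlet_character q X" "coprime a q"
  shows "X a ^ totient q = 1"
  using dirichlet_character_mod[OF assms(1) euler_theorem[OF assms(2)]] assms
  by (simp add: dirichlet_character_power dirichlet_character_1)

lemma norm_dirichlet_character:
  assumes "dirichlet_character q X" "coprime a q" "q > 0"
  shows "norm (X a) = 1"
proof -
  have "norm (X a) ^ totient q = 1"
    using dirichlet_character_power_totient[OF assms(1,2)] by (metis norm_one norm_power)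
  then show ?thesis using assms(3) power_eq_imp_eq_base[of "norm (X a)" "totient q" 1] by simp
qed

text \<open>A character is determined by its values on 0, ..., q - 1, and each of these is 0 or a
  root of unity of order dividing the totient.\<close>

lemma finite_dirichlet_characters:
  assumes "q > 0" shows "finite {X. dirichlet_character q X}"
proof -
  let ?V = "insert 0 {z::complex. z ^ totient q = 1}"
  let ?r = "\<lambda>X::nat \<Rightarrow> complex. restrict X {..<q}"
  have "finite ?V" using finite_nth_roots[of "totient q" 1] assms by simp
  then have "finite (PiE {..<q} (\<lambda>_. ?V))" by (intro finite_PiE) auto
  moreover have "?r ` {X. dirichlet_character q X} \<subseteq> PiE {..<q} (\<lambda>_. ?V)"
  proof (intro image_subsetI)
    fix X assume "X \<in> {X. dirichlet_character q X}"
    then have "X a \<in> ?V" for a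
      using dirichlet_character_power_totient[of q X a] dirichlet_character_eq_0[of q X a] by auto
    then show "?r X \<in> PiE {..<q} (\<lambda>_. ?V)" by (simp add: PiE_iff)
  qed
  ultimately have "finite (?r ` {X. dirichlet_character q X})" by (rule finite_subset[rotated])
  moreover have "inj_on ?r {X. dirichlet_character q X}"
  proof (rule inj_onI, clarsimp)
    fix X Y assume X: "dirichlet_character q X" and Y: "dirichlet_character q Y" and e: "?r X = ?r Y"
    show "X = Y"
    proof
      fix a
      have "a mod q < q" using assms by simp
      then have "X (a mod q) = Y (a mod q)" using fun_cong[OF e, of "a mod q"] by simp
      moreover have "[a = a mod q] (mod q)" by (simp add: cong_def)
      ultimately show "X a = Y a" using dirichlet_character_mod X Y by metis
    qed
  qed
  ultimately show ?thesis by (rule finite_imageD)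
qed

section \<open>Character sums and orthogonality\<close>

lemma dirichlet_character_times:
  assumes "dirichlet_character q X" "dirichlet_character q Y"
  shows "dirichlet_character q (\<lambda>a. X a * Y a)"
  using assms unfolding dirichlet_character_def by (auto simp: mult_ac)

lemma dirichlet_character_cnj:
  assumes "dirichlet_character q X"
  shows "dirichlet_character q (\<lambda>a. cnj (X a))"
  using assms unfolding dirichlet_character_def by auto

lemma dirichlet_character_mult_cnj:
  assumes "dirichlet_character q X" "coprime a q" "q > 0"
  shows "X a * cnj (X a) = 1"
  using norm_dirichlet_character[OF assms] by (simp add: complex_norm_square[symmetric])

text \<open>Multiplication by a character \<open>Y\<close> with \<open>Y a \<noteq> 1\<close>
  permutes the characters, so the sum equals \<open>Y a\<close> times itself.\<close>

lemma sum_dirichlet_characters_eq_0: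
  assumes q: "q > 0" and a: "coprime a q" and ne: "\<not> [a = 1] (mod q)"
  shows "(\<Sum>X | dirichlet_character q X. X a) = 0"
proof -
  obtain Y where Y: "dirichlet_character q Y" "Y a \<noteq> 1"
    using dirichlet_character_separates[OF assms] by blast
  \<comment> \<open>\<open>Y n * cnj (Y n)\<close> is 1 only for \<open>n\<close> coprime to
    \<open>q\<close>; at all other \<open>n\<close> the identity survives because \<open>X n\<close>
    vanishes there.\<close>
  have canc: "Y n * (cnj (Y n) * X n) = X n" "cnj (Y n) * (Y n * X n) = X n"
    if "dirichlet_character q X" for X n
  proof -
    have "(Y n * cnj (Y n)) * X n = X n"
    proof (cases "coprime n q")
      case True then show ?thesis by (simp only: dirichlet_character_mult_cnj[OF Y(1) True q] mult_1)
    next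
      case False then have "X n = 0" using dirichlet_character_eq_0[OF that, of n] by simp
      then show ?thesis by (simp only: mult_zero_right)
    qed
    then show "Y n * (cnj (Y n) * X n) = X n" "cnj (Y n) * (Y n * X n) = X n"
      by (simp_all only: mult_ac)
  qed
  have "(\<Sum>X | dirichlet_character q X. X a) = (\<Sum>X | dirichlet_character q X. Y a * X a)"
    by (rule sum.reindex_bij_witness[of _ "\<lambda>X n. Y n * X n" "\<lambda>X n. cnj (Y n) * X n"])
      (use canc Y(1) in \<open>auto simp only: mem_Collect_eq
         intro!: dirichlet_character_times dirichlet_character_cnj\<close>)
  also have "\<dots> = Y a * (\<Sum>X | dirichlet_character q X. X a)" by (simp add: sum_distrib_left)
  finally have "(1 - Y a) * (\<Sum>X | dirichlet_character q X. X a) = 0" by (simp add: algebra_simps)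
  then show ?thesis using Y(2) by simp
qed

lemma dirichlet_character_principal:
  assumes "q > 0" shows "dirichlet_character q (principal_character q)"
proof -
  have "coprime (a + q) q \<longleftrightarrow> coprime a q" for a :: nat
    by (simp only: coprime_iff_gcd_eq_1 gcd_add1)
  then show ?thesis unfolding dirichlet_character_def principal_character_def by simp
qed

lemma sum_dirichlet_character_eq_0:
  assumes q: "q > 0" and X: "dirichlet_character q X" and ne: "X \<noteq> principal_character q"
  shows "(\<Sum>a\<in>totatives q. X a) = 0"
proof -
  have "\<exists>b. coprime b q \<and> X b \<noteq> 1"
  proof (rule ccontr)
    assume "\<not> ?thesis"
    then have "X = principal_character q"
      using dirichlet_character_eq_0[OF X] by (intro ext) (auto simp: principal_character_def)
    then show False using ne by contradiction
  qed
  then obtain b where b: "coprime b q" "X b \<noteq> 1" by blast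
  \<comment> \<open>The representatives 0, ..., q - 1 are stable under reduction modulo
    \<open>q\<close>, unlike \<open>totatives q\<close>, which lies in 1, ..., q. The two sets
    differ only for \<open>q = 1\<close>, where 0 and \<open>q\<close> are exchanged.\<close>
  define T where "T = {a\<in>{..<q}. coprime a q}"
  have sumT: "(\<Sum>a\<in>totatives q. X a) = (\<Sum>a\<in>T. X a)"
  proof (rule sum.reindex_bij_witness[of _ "\<lambda>a. if a = 0 then q else a" "\<lambda>a. a mod q"])
    fix a assume a: "a \<in> totatives q"
    show "(if a mod q = 0 then q else a mod q) = a"
      using a q by (auto simp: totatives_def le_less)
    show "a mod q \<in> T" using a q by (auto simp: T_def totatives_def)
    show "X (a mod q) = X a" using dirichlet_character_mod[OF X, of "a mod q" a] by (simp add: cong_def)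
  next
    fix a assume "a \<in> T"
    then show "(if a = 0 then q else a) mod q = a" "(if a = 0 then q else a) \<in> totatives q"
      by (auto simp: T_def totatives_def)
  qed
  have inj: "inj_on (\<lambda>a. (b * a) mod q) T"
  proof (rule inj_onI)
    fix x y assume xy: "x \<in> T" "y \<in> T" "b * x mod q = b * y mod q"
    then have "[b * x = b * y] (mod q)" by (simp add: cong_def)
    then have "[x = y] (mod q)" using b(1) by (simp add: cong_mult_lcancel_nat)
    then show "x = y" using xy by (simp add: T_def cong_def)
  qed
  have "(\<lambda>a. (b * a) mod q) ` T \<subseteq> T" using b(1) q by (auto simp: T_def)
  then have im: "(\<lambda>a. (b * a) mod q) ` T = T"
    using inj by (intro endo_inj_surj) (auto simp: T_def)
  have "(\<Sum>a\<in>T. X a) = (\<Sum>a\<in>T. X ((b * a) mod q))"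
    using sum.reindex[OF inj, of X] im by simp
  also have "\<dots> = (\<Sum>a\<in>T. X (b * a))"
    by (intro sum.cong refl dirichlet_character_mod[OF X]) (simp add: cong_def)
  also have "\<dots> = X b * (\<Sum>a\<in>T. X a)"
    by (simp add: dirichlet_character_mult[OF X] sum_distrib_left)
  finally have "(1 - X b) * (\<Sum>a\<in>T. X a) = 0" by (simp add: algebra_simps)
  then show ?thesis using b sumT by simp
qed

text \<open>The sum of \<open>X a\<close> over all characters and all totatives is evaluated twice:
  by characters only the principal one contributes, by residues only \<open>a = 1\<close>.\<close>

lemma card_dirichlet_characters:
  assumes q: "q > 0"
  shows "card {X. dirichlet_character q X} = totient q"
proof -
  let ?C = "{X. dirichlet_character q X}"
  have fin: "finite ?C" using finite_dirichlet_characters[OF q] .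
  have 1: "Suc 0 \<in> totatives q" using q by (auto simp: totatives_def)
  have "(\<Sum>X\<in>?C. \<Sum>a\<in>totatives q. X a) =
     (\<Sum>X\<in>?C. if X = principal_character q then of_nat (totient q) else 0)"
    using sum_dirichlet_character_eq_0[OF q]
    by (intro sum.cong) (auto simp: principal_character_def totient_def totatives_def)
  also have "\<dots> = of_nat (totient q)"
    using fin dirichlet_character_principal[OF q] by (simp add: sum.delta)
  finally have A: "(\<Sum>X\<in>?C. \<Sum>a\<in>totatives q. X a) = complex_of_nat (totient q)" .
  have "(\<Sum>a\<in>totatives q. \<Sum>X\<in>?C. X a) =
     (\<Sum>a\<in>totatives q. if a = Suc 0 then of_nat (card ?C) else 0)"
  proof (intro sum.cong refl)
    fix a assume a: "a \<in> totatives q"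
    show "(\<Sum>X\<in>?C. X a) = (if a = Suc 0 then of_nat (card ?C) else 0)"
    proof (cases "a = Suc 0")
      case True
      have "(\<Sum>X\<in>?C. X a) = (\<Sum>X\<in>?C. 1)"
        using True dirichlet_character_1 by (intro sum.cong) auto
      then show ?thesis using True by simp
    next
      case False
      then have "\<not> [a = 1] (mod q)" using a q
        by (cases "a = q") (auto simp: totatives_def cong_def)
      then show ?thesis using sum_dirichlet_characters_eq_0[OF q] a False
        by (auto simp: totatives_def)
    qed
  qed
  also have "\<dots> = of_nat (card ?C)" using 1 by (simp add: sum.delta)
  finally show ?thesis using A sum.swap[of "\<lambda>X a. X a" "totatives q" ?C]
    by (metis of_nat_eq_iff)
qed

lemma sum_dirichlet_characters_mult_cnj:
  assumes q: "q > 0" and a: "coprime a q" and b: "coprime b q"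
  shows "(\<Sum>X | dirichlet_character q X. X a * cnj (X b)) =
    (if [a = b] (mod q) then of_nat (totient q) else 0)"
proof (cases "[a = b] (mod q)")
  case True
  have "(\<Sum>X | dirichlet_character q X. X a * cnj (X b)) = (\<Sum>X | dirichlet_character q X. 1)"
  proof (intro sum.cong refl)
    fix X assume "X \<in> {X. dirichlet_character q X}"
    then have X: "dirichlet_character q X" by simp
    show "X a * cnj (X b) = 1"
      using dirichlet_character_mult_cnj[OF X b q] dirichlet_character_mod[OF X True] by simp
  qed
  then show ?thesis using True card_dirichlet_characters[OF q] by simp
next
  case False
  \<comment> \<open>\<open>c\<close> inverts \<open>b\<close> modulo \<open>q\<close>, so the value
    of a character at \<open>c\<close> is the conjugate of its value at \<open>b\<close>, and the
    sum becomes one at the single argument \<open>a * c\<close>.\<close>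
  define c where "c = b ^ (totient q - 1)"
  have bc: "[b * c = 1] (mod q)"
    using euler_theorem[OF b] q by (simp add: c_def power_eq_if[of b "totient q"])
  have "X a * cnj (X b) = X (a * c)" if X: "dirichlet_character q X" for X
  proof -
    have "X b * X c = 1"
      using dirichlet_character_mod[OF X bc] by (simp add: dirichlet_character_mult[OF X] dirichlet_character_1[OF X])
    then have "X c = cnj (X b)"
      using dirichlet_character_mult_cnj[OF X b q]
      by (metis mult.commute mult.left_commute mult_1)
    then show ?thesis by (simp add: dirichlet_character_mult[OF X])
  qed
  moreover have "\<not> [a * c = 1] (mod q)"
  proof
    assume "[a * c = 1] (mod q)"
    then have "[a * c = b * c] (mod q)" using bc by (metis cong_sym cong_trans)
    moreover have "coprime c q" using b by (simp add: c_def)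
    ultimately show False using False by (simp add: cong_mult_rcancel_nat)
  qed
  ultimately show ?thesis
    using sum_dirichlet_characters_eq_0[OF q, of "a * c"] a b False by (simp add: c_def)
qed

lemma norm_dirichlet_character_le_1:
  assumes "dirichlet_character q X" "q > 0" shows "norm (X a) \<le> 1"
  using norm_dirichlet_character[OF assms(1) _ assms(2), of a] dirichlet_character_eq_0[OF assms(1), of a]
  by (cases "coprime a q") auto

text \<open>All frequencies lie below \<open>q\<close>, so congruence modulo \<open>q\<close> is
  equality and only the diagonal survives. This is why the resonator has to be shorter than
  \<open>q\<close>.\<close>

lemma dirichlet_second_moment:
  assumes q: "q > 0" and M: "\<And>m. m \<in> M \<Longrightarrow> m < q \<and> coprime m q" and fin: "finite M"
  shows "(\<Sum>X | dirichlet_character q X. (norm (\<Sum>m\<in>M. c m * X m))\<^sup>2) =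
    totient q * (\<Sum>m\<in>M. (norm (c m))\<^sup>2)"
proof -
  let ?C = "{X. dirichlet_character q X}"
  have "complex_of_real (\<Sum>X\<in>?C. (norm (\<Sum>m\<in>M. c m * X m))\<^sup>2) =
      (\<Sum>X\<in>?C. \<Sum>m\<in>M. \<Sum>n\<in>M. (c m * cnj (c n)) * (X m * cnj (X n)))"
    by (simp add: complex_norm_square sum_product mult_ac del: of_real_power)
  also have "\<dots> = (\<Sum>m\<in>M. \<Sum>n\<in>M. (c m * cnj (c n)) * (\<Sum>X\<in>?C. X m * cnj (X n)))"
    by (simp add: sum.swap[of _ _ ?C] sum_distrib_left)
  also have "\<dots> = (\<Sum>m\<in>M. \<Sum>n\<in>M. if n = m then of_nat (totient q) * (c m * cnj (c m)) else 0)"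
  proof (intro sum.cong refl)
    fix m n assume mn: "m \<in> M" "n \<in> M"
    then have "[m = n] (mod q) \<longleftrightarrow> n = m" using M by (auto simp: cong_def)
    then show "(c m * cnj (c n)) * (\<Sum>X\<in>?C. X m * cnj (X n)) =
       (if n = m then of_nat (totient q) * (c m * cnj (c m)) else 0)"
      using sum_dirichlet_characters_mult_cnj[OF q, of m n] M mn by (simp add: mult_ac)
  qed
  also have "\<dots> = (\<Sum>m\<in>M. of_nat (totient q) * (c m * cnj (c m)))"
    using fin by (simp add: sum.delta)
  also have "\<dots> = complex_of_real (totient q * (\<Sum>m\<in>M. (norm (c m))\<^sup>2))"
    by (simp add: complex_norm_square sum_distrib_left del: of_real_power)
  finally show ?thesis unfolding of_real_eq_iff .
qed

section \<open>The Dickman function\<close>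

lemma dickman_01: "0 \<le> u \<Longrightarrow> u \<le> 1 \<Longrightarrow> dickman u = 1"
  and dickman_neg: "u < 0 \<Longrightarrow> dickman u = 0"
  and continuous_on_dickman: "continuous_on {0..} dickman"
  and dickman_deriv: "u > 1 \<Longrightarrow> (dickman has_real_derivative - dickman (u - 1) / u) (at u)"
  using is_dickman_dickman by (auto simp: is_dickman_def)

lemma continuous_on_dickman': "0 \<le> a \<Longrightarrow> continuous_on {a..b} dickman"
  by (rule continuous_on_subset[OF continuous_on_dickman]) auto

definition dickman_int :: "real \<Rightarrow> real" where
  "dickman_int u = integral {0..u} dickman"

lemma dickman_int_deriv:
  assumes "u > 0" shows "(dickman_int has_real_derivative dickman u) (at u)"
proof -
  have "(dickman_int has_real_derivative dickman u) (at u within {0..u + 1})"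
    unfolding dickman_int_def[abs_def]
    using assms by (intro integral_has_real_derivative continuous_on_dickman') auto
  then show ?thesis using assms at_within_Icc_at[of 0 u "u + 1"] by simp
qed

lemma continuous_on_dickman_int: "continuous_on {0..b} dickman_int"
  unfolding dickman_int_def[abs_def]
  by (intro indefinite_integral_continuous_1 integrable_continuous_real continuous_on_dickman') auto

lemma dickman_int_01:
  assumes "0 \<le> u" "u \<le> 1" shows "dickman_int u = u"
proof -
  have "dickman_int u = integral {0..u} (\<lambda>_. 1)"
    unfolding dickman_int_def using assms by (intro integral_cong) (auto simp: dickman_01)
  then show ?thesis using assms by simp
qed

text \<open>Both sides have the derivative rho(u) - rho(u - 1) and agree at u = 1. This integral
  form carries all later information on rho.\<close>

lemma dickman_eq_int:
  assumes "u \<ge> 1" shows "u * dickman u = dickman_int u - dickman_int (u - 1)"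
proof -
  define f where "f v = v * dickman v - (dickman_int v - dickman_int (v - 1))" for v
  have "f u = f 1"
  proof (cases "u = 1")
    case False
    then have u: "1 < u" using assms by simp
    show ?thesis
    proof (rule DERIV_isconst2[OF u])
      have "continuous_on {1..u} (\<lambda>v. dickman_int (v - 1))"
        by (rule continuous_on_compose2[OF continuous_on_dickman_int[of u]])
          (auto intro!: continuous_intros)
      moreover have "continuous_on {1..u} dickman_int"
        by (rule continuous_on_subset[OF continuous_on_dickman_int[of u]]) auto
      ultimately show "continuous_on {1..u} f"
        unfolding f_def[abs_def] by (intro continuous_intros continuous_on_dickman') auto
    next
      fix v assume v: "1 < v" "v < u"
      have "((\<lambda>v. dickman_int (v - 1)) has_real_derivative dickman (v - 1) * 1) (at v)"
        by (rule DERIV_chain2[where g = "\<lambda>v. v - 1", OF dickman_int_deriv])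
          (use v in \<open>auto intro!: derivative_eq_intros\<close>)
      then have "(f has_real_derivative
          (1 * dickman v + (- dickman (v - 1) / v) * v) - (dickman v - dickman (v - 1) * 1)) (at v)"
        unfolding f_def[abs_def] using v
        by (intro DERIV_diff DERIV_mult DERIV_ident dickman_deriv dickman_int_deriv) auto
      then show "(f has_real_derivative 0) (at v)" using v by simp
    qed (use assms in auto)
  qed simp
  also have "f 1 = 0" by (simp add: f_def dickman_01 dickman_int_01)
  finally show ?thesis by (simp add: f_def)
qed

lemma dickman_int_mvt:
  assumes "0 \<le> a" "a < b"
  shows "\<exists>c. a < c \<and> c < b \<and> dickman_int b - dickman_int a = (b - a) * dickman c"
proof -
  have "continuous_on {a..b} dickman_int"
    by (rule continuous_on_subset[OF continuous_on_dickman_int[of b]]) (use assms in auto)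
  moreover have "(dickman_int has_derivative (\<lambda>h. dickman x * h)) (at x)" if "a < x" for x
    using dickman_int_deriv[of x] that assms by (simp add: has_field_derivative_def)
  ultimately obtain c where "a < c" "c < b" "dickman_int b - dickman_int a = dickman c * (b - a)"
    using mvt[OF assms(2), of dickman_int "\<lambda>x h. dickman x * h"] by blast
  then show ?thesis by (auto simp: mult.commute)
qed

text \<open>At the least \<open>v\<close> with rho(v) \<le> 0, the product v rho(v) is the mean of
  rho over the preceding unit interval, hence the value of rho at an earlier and therefore positive
  point.\<close>

lemma dickman_pos:
  assumes "u \<ge> 0" shows "dickman u > 0"
proof (rule ccontr)
  assume neg: "\<not> dickman u > 0"
  define A where "A = {v\<in>{0..u}. dickman v \<le> 0}"
  have "closed A"
    unfolding A_def by (intro continuous_on_closed_Collect_le continuous_on_dickman' continuous_intros) auto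
  moreover have "bounded A" unfolding A_def by (rule bounded_subset[of "{0..u}"]) auto
  ultimately have "compact A" by (simp add: compact_eq_bounded_closed)
  moreover have "A \<noteq> {}" using neg assms by (auto simp: A_def)
  ultimately obtain v where v: "v \<in> A" and min: "\<And>w. w \<in> A \<Longrightarrow> v \<le> w"
    using compact_attains_inf by metis
  have v1: "v > 1" using v dickman_01[of v] by (fastforce simp: A_def)
  obtain c where c: "v - 1 < c" "c < v" "v * dickman v = dickman c"
    using dickman_int_mvt[of "v - 1" v] dickman_eq_int[of v] v1 by auto
  have "c \<notin> A" using min c by fastforce
  then have "dickman c > 0" using c v v1 by (auto simp: A_def)
  moreover have "v * dickman v \<le> 0" using v v1 by (simp add: A_def mult_nonneg_nonpos)
  ultimately show False using c by simp
qed

lemma dickman_nonneg: "dickman u \<ge> 0"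
  using dickman_pos[of u] dickman_neg[of u] by (cases "u < 0") auto

lemma dickman_antimono:
  assumes "0 \<le> a" "a \<le> b" shows "dickman b \<le> dickman a"
proof -
  have 1: "dickman b \<le> dickman a" if "1 \<le> a" "a \<le> b" for a b
  proof (rule DERIV_nonpos_imp_decreasing_open[OF that(2)])
    fix x assume x: "a < x" "x < b"
    then have "- dickman (x - 1) / x \<le> 0" using that dickman_nonneg[of "x - 1"] by simp
    then show "\<exists>y. (dickman has_real_derivative y) (at x) \<and> y \<le> 0"
      using dickman_deriv[of x] x that by auto
  qed (use that in \<open>auto intro!: continuous_on_dickman'\<close>)
  show ?thesis
  proof (cases "b \<le> 1")
    case True then show ?thesis using assms by (simp add: dickman_01)
  next
    case False
    have "dickman b \<le> dickman (max a 1)" using 1[of "max a 1" b] assms False by simp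
    also have "\<dots> = dickman a" using assms by (cases "a \<le> 1") (auto simp: dickman_01 max_def)
    finally show ?thesis .
  qed
qed

lemma dickman_le_1: "dickman u \<le> 1"
  using dickman_antimono[of 0 u] dickman_neg[of u] by (cases "u < 0") (auto simp: dickman_01)

text \<open>The hypothesis bounds the logarithmic derivative: it says -rho' \<le> g rho, so rho(u)
  exp(g u) is nondecreasing.\<close>

lemma dickman_decay:
  assumes r: "\<And>w. 1 \<le> w \<Longrightarrow> w \<le> V \<Longrightarrow> dickman (w - 1) \<le> g * (w * dickman w)"
    and g: "g \<ge> 0" and ab: "0 \<le> a" "a \<le> b" "b \<le> V"
  shows "dickman a \<le> dickman b * exp (g * (b - a))"
proof -
  have 1: "dickman a * exp (g * a) \<le> dickman b * exp (g * b)" if "1 \<le> a" "a \<le> b" "b \<le> V" for a b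
  proof (rule DERIV_nonneg_imp_increasing_open[OF that(2)])
    show "continuous_on {a..b} (\<lambda>x. dickman x * exp (g * x))"
      using that by (intro continuous_intros continuous_on_dickman') auto
    fix x assume x: "a < x" "x < b"
    have "((\<lambda>x. dickman x * exp (g * x)) has_real_derivative
        (- dickman (x - 1) / x) * exp (g * x) + (exp (g * x) * (g * 1)) * dickman x) (at x)"
      using x that by (intro DERIV_mult dickman_deriv DERIV_fun_exp DERIV_cmult DERIV_ident) auto
    moreover have "dickman (x - 1) / x \<le> g * dickman x"
      using r[of x] x that by (simp add: divide_simps mult_ac)
    then have "0 \<le> exp (g * x) * (g * dickman x - dickman (x - 1) / x)" by simp
    then have "0 \<le> (- dickman (x - 1) / x) * exp (g * x) + (exp (g * x) * (g * 1)) * dickman x"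
      by (simp add: algebra_simps)
    ultimately show "\<exists>y. ((\<lambda>x. dickman x * exp (g * x)) has_real_derivative y) (at x) \<and> 0 \<le> y" by blast
  qed
  show ?thesis
  proof (cases "b \<le> 1")
    case True then show ?thesis using ab g by (simp add: dickman_01)
  next
    case False
    \<comment> \<open>The differential equation holds only beyond 1; on [0, 1] rho is constant and
      the start may be moved to 1.\<close>
    have "dickman a = dickman (max a 1)" using ab by (cases "a \<le> 1") (auto simp: dickman_01 max_def)
    also have "\<dots> \<le> dickman b * exp (g * (b - max a 1))"
      using 1[of "max a 1" b] ab False by (simp add: right_diff_distrib exp_diff field_simps)
    also have "\<dots> \<le> dickman b * exp (g * (b - a))"
      using g by (intro mult_left_mono dickman_nonneg) (auto intro: mult_left_mono)
    finally show ?thesis .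
  qed
qed

text \<open>A bootstrap: the ratio bound up to \<open>V\<close> limits the decay of rho on [0, V],
  so w rho(w), the integral of rho over [w - 1, w], is at least the integral of rho(w - 1) exp(-g (v
  - w + 1)) over its first half. Only the half interval is used, since it ends at w - 1/2 \<le> V;
  this gains half a unit in the range.\<close>

lemma dickman_ratio_step:
  assumes r: "\<And>w. 1 \<le> w \<Longrightarrow> w \<le> V \<Longrightarrow> dickman (w - 1) \<le> g * (w * dickman w)"
    and g: "g > 0" and V: "V \<ge> 1" and w: "1 \<le> w" "w \<le> V + 1/2"
  shows "dickman (w - 1) \<le> g / (1 - exp (- g / 2)) * (w * dickman w)"
proof -
  \<comment> \<open>\<open>?H\<close> adds to the antiderivative of rho that of minus the
    exponential minorant, so its monotonicity compares the two integrals.\<close>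
  let ?H = "\<lambda>v. dickman_int v + dickman (w - 1) * exp (- g * (v - (w - 1))) / g"
  have "?H (w - 1) \<le> ?H (w - 1/2)"
  proof (rule DERIV_nonneg_imp_increasing_open[where f = ?H])
    show "continuous_on {w - 1..w - 1/2} ?H"
      using w g by (intro continuous_intros continuous_on_subset[OF continuous_on_dickman_int[of w]]) auto
    fix v assume v: "w - 1 < v" "v < w - 1/2"
    have "(?H has_real_derivative
        dickman v + dickman (w - 1) * (exp (- g * (v - (w - 1))) * (- g * (1 - 0))) / g) (at v)"
      using v w by (intro DERIV_add dickman_int_deriv DERIV_cdivide DERIV_cmult DERIV_fun_exp DERIV_diff
        DERIV_ident DERIV_const) auto
    moreover have "dickman (w - 1) \<le> dickman v * exp (g * (v - (w - 1)))"
      using v w g by (intro dickman_decay[OF r]) auto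
    then have "dickman (w - 1) * exp (- g * (v - (w - 1))) \<le> dickman v"
      by (simp only: exp_minus mult_minus_left pos_divide_le_eq[OF exp_gt_zero] flip: divide_inverse)
    then have "0 \<le> dickman v + dickman (w - 1) * (exp (- g * (v - (w - 1))) * (- g * (1 - 0))) / g"
      using g by simp
    ultimately show "\<exists>y. (?H has_real_derivative y) (at v) \<and> 0 \<le> y" by blast
  qed simp
  moreover have "- g * (w - 1/2 - (w - 1)) = - g / 2" by (simp add: algebra_simps)
  ultimately have "dickman (w - 1) * (1 - exp (- g / 2)) / g \<le> dickman_int (w - 1/2) - dickman_int (w - 1)"
    by (simp add: right_diff_distrib diff_divide_distrib)
  also have "\<dots> \<le> dickman_int w - dickman_int (w - 1)"
  proof -
    obtain c where "dickman_int w - dickman_int (w - 1/2) = (w - (w - 1/2)) * dickman c"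
      using dickman_int_mvt[of "w - 1/2" w] w by auto
    then show ?thesis using dickman_nonneg[of c] by simp
  qed
  also have "\<dots> = w * dickman w" using dickman_eq_int[of w] w by simp
  finally have "dickman (w - 1) * (1 - exp (- g / 2)) / g \<le> w * dickman w" .
  moreover have "1 - exp (- g / 2) > 0" using g by simp
  ultimately show ?thesis using g by (simp add: divide_simps mult_ac)
qed

text \<open>Each half-unit step divides the bound by 1 - exp(-h / 2) with the current bound
  \<open>h\<close>. Since \<open>h\<close> only grows, the factor formed with the initial
  \<open>g\<close> is a safe replacement.\<close>

lemma dickman_ratio_aux:
  assumes "g \<ge> 1" "1 \<le> w" "w \<le> 1 + real k / 2"
  shows "dickman (w - 1) \<le> g / (1 - exp (- g / 2)) ^ k * (w * dickman w)"
  using assms(2,3)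
proof (induction k arbitrary: w)
  case 0
  then have "w = 1" by simp
  then show ?case using assms(1) by (simp add: dickman_01)
next
  case (Suc k)
  define h where "h = g / (1 - exp (- g / 2)) ^ k"
  have e: "0 < 1 - exp (- g / 2)" using assms(1) by simp
  then have "(1 - exp (- g / 2)) ^ k \<le> 1" by (intro power_le_one) auto
  then have hg: "h \<ge> g" using assms(1) e by (simp add: h_def field_simps)
  have "dickman (w - 1) \<le> h / (1 - exp (- h / 2)) * (w * dickman w)"
    by (rule dickman_ratio_step[of "1 + real k / 2"])
      (use Suc.IH Suc.prems assms(1) hg in \<open>auto simp: h_def field_simps\<close>)
  also have "\<dots> \<le> h / (1 - exp (- g / 2)) * (w * dickman w)"
    using hg assms(1) e Suc.prems by (intro mult_right_mono divide_left_mono mult_nonneg_nonneg dickman_nonneg) (auto intro!: mult_pos_pos)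
  finally show ?case by (simp add: h_def field_simps)
qed

text \<open>A bound for -rho' / rho up to \<open>U\<close>; its logarithmic growth is the true order
  of that quotient. The factor 4 is 2 from the starting value in \<open>dickman_ratio\<close> and 2
  lost in the iteration.\<close>

definition dickman_rate :: "real \<Rightarrow> real" where
  "dickman_rate U = 4 * ln (4 * U + 4)"

lemma dickman_ratio:
  assumes "1 \<le> w" "w \<le> U"
  shows "dickman (w - 1) \<le> dickman_rate U * (w * dickman w)"
proof -
  \<comment> \<open>Chosen so that exp(-g / 2) = 1 / (4 U + 4): at most 2 U steps, each losing this
    proportion, leave at least one half by Bernoulli's inequality.\<close>
  define g where "g = 2 * ln (4 * U + 4)"
  have "ln (4 * U + 4) \<ge> ln (exp 1 :: real)"
    using exp_le assms by (subst ln_le_cancel_iff) auto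
  then have g1: "g \<ge> 1" by (simp add: g_def)
  define k where "k = nat \<lceil>2 * (w - 1)\<rceil>"
  have "real k = of_int \<lceil>2 * (w - 1)\<rceil>" using assms by (simp add: k_def)
  then have k: "2 * (w - 1) \<le> real k" "real k \<le> 2 * U"
    using assms of_int_ceiling_le_add_one[of "2 * (w - 1)"] le_of_int_ceiling[of "2 * (w - 1)"] by auto
  define e where "e = exp (- g / 2)"
  have e: "e = 1 / (4 * U + 4)" using assms by (simp add: g_def e_def exp_minus inverse_eq_divide)
  have "1 - real k * e \<le> (1 - e) ^ k"
    using Bernoulli_inequality[of "- e" k] e_def g1 by simp
  moreover have "real k * e \<le> 1 / 2" unfolding e using k assms by (simp add: field_simps)
  ultimately have ek: "(1 - e) ^ k \<ge> 1 / 2" by linarith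
  have "dickman (w - 1) \<le> g / (1 - e) ^ k * (w * dickman w)"
    unfolding e_def by (rule dickman_ratio_aux) (use g1 assms k in auto)
  also have "\<dots> \<le> g / (1 / 2) * (w * dickman w)"
    using ek g1 assms by (intro mult_right_mono divide_left_mono mult_nonneg_nonneg dickman_nonneg) auto
  finally show ?thesis by (simp add: g_def dickman_rate_def)
qed

lemma dickman_rate_nonneg: "U \<ge> 0 \<Longrightarrow> dickman_rate U \<ge> 0"
  by (simp add: dickman_rate_def)

lemma dickman_exp_le:
  assumes "0 \<le> a" "a \<le> b" "b \<le> U"
  shows "dickman a \<le> dickman b * exp (dickman_rate U * (b - a))"
  using assms dickman_ratio dickman_rate_nonneg by (intro dickman_decay[of U]) auto

section \<open>Smooth numbers and Mertens' theorem\<close>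

definition smooth_set :: "real \<Rightarrow> real \<Rightarrow> nat set" where
  "smooth_set x y = {n. 1 \<le> n \<and> real n \<le> x \<and> (\<forall>p. prime p \<and> p dvd n \<longrightarrow> real p \<le> y)}"

definition smooth_count :: "real \<Rightarrow> real \<Rightarrow> real" where
  "smooth_count x y = real (card (smooth_set x y))"

lemma ln_diff_le:
  fixes x y :: real
  assumes "0 < x" "0 < y" shows "ln x - ln y \<le> (x - y) / y"
  using ln_le_minus_one[of "x / y"] assms by (simp add: ln_div field_simps)

lemma of_nat_div_bounds: "real n / real d - 1 \<le> real (n div d)" "real (n div d) \<le> real n / real d"
proof -
  have "real (n div d) = of_int \<lfloor>real n / real d\<rfloor>" by (simp add: floor_divide_of_nat_eq)
  then show "real n / real d - 1 \<le> real (n div d)" "real (n div d) \<le> real n / real d" by linarith+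
qed

lemma le_nat_floor_iff: "1 \<le> n \<Longrightarrow> n \<le> nat \<lfloor>x\<rfloor> \<longleftrightarrow> real n \<le> x"
  by linarith

lemma smooth_set_eq: "smooth_set x y = {n \<in> {1..nat \<lfloor>x\<rfloor>}. \<forall>p. prime p \<and> p dvd n \<longrightarrow> real p \<le> y}"
  unfolding smooth_set_def using le_nat_floor_iff by auto

lemma finite_smooth_set [simp]: "finite (smooth_set x y)"
  unfolding smooth_set_eq by simp

lemma smooth_count_nonneg: "smooth_count x y \<ge> 0"
  by (simp add: smooth_count_def)

lemma smooth_set_mono: "x \<le> x' \<Longrightarrow> y \<le> y' \<Longrightarrow> smooth_set x y \<subseteq> smooth_set x' y'"
  unfolding smooth_set_def by (auto intro: order_trans)

lemma smooth_set_empty: "x < 1 \<Longrightarrow> smooth_set x y = {}"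
  unfolding smooth_set_def by auto

lemma smooth_set_divisor: "n \<in> smooth_set x y \<Longrightarrow> d dvd n \<Longrightarrow> d \<in> smooth_set x y"
proof -
  assume n: "n \<in> smooth_set x y" and d: "d dvd n"
  have "n > 0" using n by (simp add: smooth_set_def)
  then have "d \<le> n" "d > 0" using d by (auto intro: dvd_imp_le Nat.gr0I)
  then have "1 \<le> d" "real d \<le> x" using n by (auto simp: smooth_set_def)
  moreover have "real p \<le> y" if "prime p" "p dvd d" for p
    using n dvd_trans[OF that(2) d] that(1) by (simp add: smooth_set_def)
  ultimately show ?thesis by (simp add: smooth_set_def)
qed

lemma card_smooth_multiples:
  assumes d: "d \<in> smooth_set x y"
  shows "card {n\<in>smooth_set x y. d dvd n} = card (smooth_set (x / d) y)"
proof -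
  have d0: "d > 0" using d by (simp add: smooth_set_def)
  have "bij_betw (\<lambda>m. d * m) (smooth_set (x / d) y) {n\<in>smooth_set x y. d dvd n}"
  proof (rule bij_betw_byWitness[where f' = "\<lambda>n. n div d"])
    show "(\<lambda>m. d * m) ` smooth_set (x / d) y \<subseteq> {n\<in>smooth_set x y. d dvd n}"
    proof safe
      fix m assume m: "m \<in> smooth_set (x / d) y"
      have "real (d * m) \<le> x" using m d0 by (simp add: smooth_set_def field_simps)
      moreover have "real p \<le> y" if "prime p" "p dvd d * m" for p
        using that d m by (auto simp: prime_dvd_mult_iff smooth_set_def)
      ultimately show "d * m \<in> smooth_set x y" using m d0 by (auto simp: smooth_set_def Suc_le_eq)
    qed simp
    show "(\<lambda>n. n div d) ` {n\<in>smooth_set x y. d dvd n} \<subseteq> smooth_set (x / d) y"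
    proof safe
      fix n assume n: "n \<in> smooth_set x y" and "d dvd n"
      then obtain m where m: "n = d * m" by blast
      have "m \<in> smooth_set x y" using smooth_set_divisor[OF n, of m] m by simp
      moreover have "real m \<le> x / d" using n m d0 by (simp add: smooth_set_def field_simps)
      ultimately have "m \<in> smooth_set (x / d) y" by (simp add: smooth_set_def)
      then show "n div d \<in> smooth_set (x / d) y" using m d0 by simp
    qed
  qed (use d0 in auto)
  then show ?thesis by (metis bij_betw_same_card)
qed

text \<open>Write ln n as the sum of the von Mangoldt function over the divisors of n and
  interchange. Divisors of smooth integers are smooth, and the multiples of \<open>d\<close>
  correspond to the smooth integers up to x / d.\<close>

lemma sum_ln_smooth:
  "(\<Sum>n\<in>smooth_set x y. ln (real n)) =
     (\<Sum>d\<in>smooth_set x y. mangoldt d * smooth_count (x / d) y)"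
proof -
  let ?S = "smooth_set x y"
  have "(\<Sum>n\<in>?S. ln (real n)) = (\<Sum>n\<in>?S. \<Sum>d\<in>?S. if d dvd n then mangoldt d else 0)"
  proof (intro sum.cong refl)
    fix n assume n: "n \<in> ?S"
    then have "n > 0" by (simp add: smooth_set_def)
    then have "ln (real n) = (\<Sum>d | d dvd n. mangoldt d)"
      using mangoldt_sum[of n, where 'a = real] by simp
    also have "{d. d dvd n} = {d\<in>?S. d dvd n}" using smooth_set_divisor[OF n] by auto
    also have "(\<Sum>d\<in>{d\<in>?S. d dvd n}. mangoldt d) = (\<Sum>d\<in>?S. if d dvd n then mangoldt d else (0::real))"
      by (rule sum.inter_filter) simp
    finally show "ln (real n) = (\<Sum>d\<in>?S. if d dvd n then mangoldt d else 0)" .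
  qed
  also have "\<dots> = (\<Sum>d\<in>?S. \<Sum>n\<in>?S. if d dvd n then mangoldt d else 0)" by (rule sum.swap)
  also have "\<dots> = (\<Sum>d\<in>?S. mangoldt d * smooth_count (x / d) y)"
  proof (intro sum.cong refl)
    fix d assume d: "d \<in> ?S"
    have "(\<Sum>n\<in>?S. if d dvd n then mangoldt d else 0) = (\<Sum>n\<in>{n\<in>?S. d dvd n}. mangoldt d :: real)"
      by (rule sum.inter_filter[symmetric]) simp
    then show "(\<Sum>n\<in>?S. if d dvd n then mangoldt d else (0::real)) = mangoldt d * smooth_count (x / d) y"
      using card_smooth_multiples[OF d] by (simp add: smooth_count_def)
  qed
  finally show ?thesis .
qed

lemma smooth_set_trivial:
  assumes "x \<le> y" shows "smooth_set x y = {1..nat \<lfloor>x\<rfloor>}"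
proof -
  have "real p \<le> y" if "1 \<le> n" "real n \<le> x" "p dvd n" for n p :: nat
    using dvd_imp_le[OF that(3)] that assms by simp
  then show ?thesis unfolding smooth_set_eq using le_nat_floor_iff by auto
qed

lemma smooth_count_trivial: "x \<le> y \<Longrightarrow> smooth_count x y = real (nat \<lfloor>x\<rfloor>)"
  by (simp add: smooth_count_def smooth_set_trivial)

section \<open>Chebyshev and Mertens bounds\<close>

lemma ln_fact_mangoldt:
  assumes "m \<le> n"
  shows "ln (fact m) = (\<Sum>d=1..n. mangoldt d * real (m div d))"
proof -
  have "ln (fact m :: real) = (\<Sum>k=1..m. ln (real k))"
    unfolding fact_prod of_nat_prod by (subst ln_prod) auto
  also have "\<dots> = (\<Sum>d=1..m. mangoldt d * smooth_count (real m / d) m)"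
    using sum_ln_smooth[of m m] by (simp add: smooth_set_trivial)
  also have "\<dots> = (\<Sum>d=1..m. mangoldt d * real (m div d))"
  proof (intro sum.cong refl)
    fix d assume d: "d \<in> {1..m}"
    then have "real m / d \<le> m" by (simp add: field_simps)
    then have "smooth_count (real m / d) m = real (m div d)"
      by (simp add: smooth_count_trivial floor_divide_of_nat_eq)
    then show "mangoldt d * smooth_count (real m / d) m = mangoldt d * real (m div d)" by simp
  qed
  \<comment> \<open>The added terms vanish; a common range lets the factorials of m and 2 m be
    compared term by term.\<close>
  also have "\<dots> = (\<Sum>d=1..n. mangoldt d * real (m div d))"
    using assms by (intro sum.mono_neutral_left) auto
  finally show ?thesis .
qed

definition chebyshev_psi :: "nat \<Rightarrow> real" where
  "chebyshev_psi n = (\<Sum>d=1..n. mangoldt d)"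

lemma chebyshev_psi_mono: "m \<le> n \<Longrightarrow> chebyshev_psi m \<le> chebyshev_psi n"
  unfolding chebyshev_psi_def by (intro sum_mono2) (auto simp: mangoldt_nonneg)

text \<open>The central binomial coefficient: its logarithm weighs \<open>d\<close> by the quotient
  of 2 m minus twice that of m, which is never negative and is at least 1 for m < d \<le> 2 m, while
  the coefficient is at most 4^m.\<close>

lemma chebyshev_psi_double: "chebyshev_psi (2 * m) - chebyshev_psi m \<le> 2 * real m * ln 2"
proof -
  have "chebyshev_psi (2 * m) - chebyshev_psi m = (\<Sum>d\<in>{1..2*m}. mangoldt d * (if m < d then 1 else 0))"
  proof -
    have "chebyshev_psi (2 * m) = chebyshev_psi m + (\<Sum>d\<in>{m<..2*m}. mangoldt d)"
      unfolding chebyshev_psi_def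
      by (subst sum.union_disjoint[symmetric]) (auto intro!: sum.cong)
    moreover have "(\<Sum>d\<in>{1..2*m}. mangoldt d * (if m < d then 1 else 0)) = (\<Sum>d\<in>{m<..2*m}. mangoldt d :: real)"
      by (rule sum.mono_neutral_cong_right) auto
    ultimately show ?thesis by simp
  qed
  also have "\<dots> \<le> (\<Sum>d\<in>{1..2*m}. mangoldt d * (real ((2 * m) div d) - 2 * real (m div d)))"
  proof (intro sum_mono mult_left_mono mangoldt_nonneg)
    fix d assume d: "d \<in> {1..2*m}"
    have "2 * (m div d) \<le> (2 * m) div d"
      using d by (simp add: less_eq_div_iff_mult_less_eq mult.assoc)
    moreover have "1 \<le> (2 * m) div d" using d by (simp add: less_eq_div_iff_mult_less_eq)
    moreover have "m div d = 0" if "m < d" using that by simp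
    ultimately show "(if m < d then 1 else 0) \<le> real ((2 * m) div d) - 2 * real (m div d)"
      by (auto simp flip: of_nat_mult)
  qed
  also have "\<dots> = ln (fact (2 * m)) - 2 * ln (fact m)"
    using ln_fact_mangoldt[of "2*m" "2*m"] ln_fact_mangoldt[of m "2*m"]
    by (simp add: right_diff_distrib sum_subtractf sum_distrib_left mult_ac)
  also have "\<dots> = ln (real ((2 * m) choose m))"
  proof -
    have "fact m * fact (2 * m - m) * (2 * m choose m) = fact (2 * m)"
      by (rule binomial_fact_lemma) simp
    then have "fact m * fact m * real (2 * m choose m) = fact (2 * m)"
      by (metis diff_add_inverse2 mult_2 of_nat_fact of_nat_mult)
    moreover have "real (2 * m choose m) > 0" by (simp add: zero_less_binomial)
    ultimately have "ln (fact (2 * m)) = ln (fact m) + ln (fact m) + ln (real (2 * m choose m))"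
      by (metis fact_gt_zero ln_mult_pos mult_pos_pos)
    then show ?thesis by simp
  qed
  also have "\<dots> \<le> ln (2 ^ (2 * m))"
  proof -
    have "real ((2 * m) choose m) \<le> 2 ^ (2 * m)"
      using of_nat_mono[OF binomial_le_pow2[of "2*m" m], where 'a = real] by simp
    then show ?thesis by (simp add: zero_less_binomial)
  qed
  also have "\<dots> = 2 * real m * ln 2" by (simp add: ln_realpow)
  finally show ?thesis .
qed

text \<open>Repeated halving. The sharp constant of this method is below 4; the slack pays for
  rounding an odd \<open>n\<close> up to 2 (m + 1).\<close>

lemma chebyshev_psi_le: "chebyshev_psi n \<le> 4 * real n"
proof (induction n rule: less_induct)
  case (less n)
  have l2: "ln 2 \<le> (7/10::real)" using ln_2_less_1 ln2_le_25_over_36 by simp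
  have dbl: "chebyshev_psi (2 * m) \<le> chebyshev_psi m + 2 * real m * (7/10)" for m
    using chebyshev_psi_double[of m] mult_left_mono[OF l2, of "2 * real m"] by simp
  consider "n \<le> 1" | m where "n = 2 * m" "m \<ge> 1" | m where "n = 2 * m + 1" "m \<ge> 1"
    by (cases "n \<le> 1"; cases "even n") (auto elim!: evenE oddE)
  then show ?case
  proof cases
    case 1
    then have "n = 0 \<or> n = 1" by auto
    then show ?thesis by (auto simp: chebyshev_psi_def)
  next
    case 2
    then show ?thesis using less[of m] dbl[of m] by simp
  next
    case 3
    have "chebyshev_psi n \<le> chebyshev_psi (2 * (m + 1))" using 3 by (intro chebyshev_psi_mono) simp
    also have "\<dots> \<le> chebyshev_psi (m + 1) + 2 * real (m + 1) * (7/10)" by (rule dbl)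
    also have "chebyshev_psi (m + 1) \<le> 4 * real (m + 1)" using 3 by (intro less) simp
    finally have "chebyshev_psi n \<le> 4 * real (m + 1) + 2 * real (m + 1) * (7/10)" by simp
    moreover have "real (m + 1) = real m + 1" "real n = 2 * real m + 1" "real m \<ge> 1"
      using 3 by simp_all
    moreover have "2 * real (m + 1) * (7 / 10) = 7 / 5 * real m + 7 / 5" by (simp add: field_simps)
    ultimately show ?thesis by argo
  qed
qed

definition mertens_sum :: "nat \<Rightarrow> real" where
  "mertens_sum n = (\<Sum>d=1..n. mangoldt d / real d)"

lemma ln_fact_bounds:
  assumes "n \<ge> 1"
  shows "real n * ln n - n \<le> ln (fact n)" "ln (fact n) \<le> real n * ln n"
proof -
  have "real n * ln n - n \<le> ln (fact n) \<and> ln (fact n) \<le> real n * ln n"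
    using assms
  proof (induction n rule: dec_induct)
    case (step n)
    have f: "ln (fact (Suc n)) = ln (Suc n) + ln (fact n :: real)"
      by (simp add: ln_mult del: of_nat_Suc)
    have "ln (real (Suc n)) - ln (real n) \<le> 1 / real n"
      using ln_diff_le[of "real (Suc n)" "real n"] step by simp
    then have "real n * (ln (real (Suc n)) - ln (real n)) \<le> 1" using step by (simp add: field_simps)
    moreover have "real n * ln (real n) \<le> real n * ln (real (Suc n))" using step by (intro mult_left_mono) auto
    ultimately show ?case unfolding f using step.IH
      by (simp add: algebra_simps)
  qed simp
  then show "real n * ln n - n \<le> ln (fact n)" "ln (fact n) \<le> real n * ln n" by auto
qed

text \<open>Dropping the integer parts in the formula for ln n! costs between 0 and psi(n), which is
  at most 4 n; division by n leaves a bounded error.\<close>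

lemma mertens_bound:
  assumes "n \<ge> 1" shows "\<bar>mertens_sum n - ln n\<bar> \<le> 4"
proof -
  have n: "real n > 0" using assms by simp
  have id: "real n * mertens_sum n = (\<Sum>d=1..n. mangoldt d * (real n / d))"
    by (simp add: mertens_sum_def sum_distrib_left mult_ac)
  have "ln (fact n) \<le> real n * mertens_sum n"
    unfolding id ln_fact_mangoldt[OF order_refl]
    by (intro sum_mono mult_left_mono mangoldt_nonneg) (rule of_nat_div_bounds)
  then have "real n * ln n - n \<le> real n * mertens_sum n" using ln_fact_bounds(1)[OF assms] by simp
  then have "real n * (ln n - 1) \<le> real n * mertens_sum n" by (simp add: algebra_simps)
  then have 1: "ln n - 1 \<le> mertens_sum n" using n by simp
  have "real n * mertens_sum n - chebyshev_psi n = (\<Sum>d=1..n. mangoldt d * (real n / d - 1))"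
    unfolding id chebyshev_psi_def by (simp add: right_diff_distrib sum_subtractf)
  also have "\<dots> \<le> ln (fact n)"
    unfolding ln_fact_mangoldt[OF order_refl]
  proof (intro sum_mono mult_left_mono mangoldt_nonneg)
    fix d show "real n / real d - 1 \<le> real (n div d)"
      by (rule of_nat_div_bounds)
  qed
  finally have "real n * mertens_sum n \<le> real n * ln n + 4 * real n"
    using ln_fact_bounds(2)[OF assms] chebyshev_psi_le[of n] by simp
  then have "real n * mertens_sum n \<le> real n * (ln n + 4)" by (simp add: algebra_simps)
  then have "mertens_sum n \<le> ln n + 4" using n by simp
  then show ?thesis using 1 by linarith
qed

text \<open>
  The hypothesis on \<open>P\<close> says that it is an antiderivative of \<open>g s / s\<close>, in the only form needed.
\<close>

lemma mertens_partial_summation: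
  fixes g P :: "real \<Rightarrow> real"
  assumes z: "z \<ge> 1"
    and mono: "\<And>s t. 1 \<le> s \<Longrightarrow> s \<le> t \<Longrightarrow> t \<le> z \<Longrightarrow> g s \<le> g t"
    and g1: "g 1 \<ge> 0"
    and P: "\<And>s t. 1 \<le> s \<Longrightarrow> s \<le> t \<Longrightarrow> t \<le> z \<Longrightarrow>
       (ln t - ln s) * g s \<le> P t - P s \<and> P t - P s \<le> (ln t - ln s) * g t"
  shows "\<bar>(\<Sum>d=1..nat \<lfloor>z\<rfloor>. mangoldt d / d * g d) - (P z - P 1)\<bar> \<le> 10 * g z"
proof -
  define E where "E n = (\<Sum>d=1..n. mangoldt d / d * g d) - (P n - P 1)" for n
  \<comment> \<open>Partial summation in inductive form: after removal of the boundary term, passing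
    from n to n + 1 costs at most 5 times the increment of \<open>g\<close>, namely 4 by Mertens and
    1 for the integral, as ln(n + 1) - ln n \<le> 1.\<close>
  have ind: "\<bar>E n - (mertens_sum n - ln n) * g n\<bar> \<le> 5 * (g n - g 1)" if "1 \<le> n" "real n \<le> z" for n
    using that
  proof (induction n rule: dec_induct)
    case base
    then show ?case by (simp add: E_def mertens_sum_def)
  next
    case (step n)
    define r where "r = ln (Suc n) - ln n"
    define a where "a = mangoldt (Suc n) / real (Suc n)"
    have n1: "1 \<le> real n" "real (Suc n) \<le> z" using step by auto
    have gm: "g n \<le> g (Suc n)" using mono[of n "Suc n"] n1 by simp
    have PP: "r * g n \<le> P (Suc n) - P n \<and> P (Suc n) - P n \<le> r * g (Suc n)"
      using P[of n "Suc n"] n1 by (simp add: r_def)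
    have "r \<le> 1 / real n" using n1 ln_diff_le[of "real (Suc n)" "real n"] by (simp add: r_def)
    also have "\<dots> \<le> 1" using n1 by simp
    finally have r: "r \<le> 1" .
    have IH: "\<bar>E n - (mertens_sum n - ln n) * g n\<bar> \<le> 5 * (g n - g 1)" using step by simp
    have ES: "E (Suc n) = E n + a * g (Suc n) - (P (Suc n) - P n)"
      using step by (simp add: E_def a_def)
    have MS: "mertens_sum (Suc n) = mertens_sum n + a" by (simp add: mertens_sum_def a_def)
    define D where "D = mertens_sum n - ln n"
    have eq: "E (Suc n) - (mertens_sum (Suc n) - ln (Suc n)) * g (Suc n) =
       (E n - D * g n) + (r * g (Suc n) - (P (Suc n) - P n)) - D * (g (Suc n) - g n)"
      unfolding ES MS D_def r_def by (simp add: algebra_simps)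
    have "\<bar>D\<bar> \<le> 4" using mertens_bound[of n] step by (simp add: D_def)
    then have "\<bar>D * (g (Suc n) - g n)\<bar> \<le> 4 * (g (Suc n) - g n)"
      using gm mult_right_mono[of "\<bar>D\<bar>" 4 "g (Suc n) - g n"] by (simp add: abs_mult)
    moreover have "r * g (Suc n) - (P (Suc n) - P n) \<le> 1 * (g (Suc n) - g n)"
    proof -
      have "r * g (Suc n) - (P (Suc n) - P n) \<le> r * (g (Suc n) - g n)" using PP by (simp add: algebra_simps)
      also have "\<dots> \<le> 1 * (g (Suc n) - g n)" using r gm by (intro mult_right_mono) auto
      finally show ?thesis .
    qed
    moreover have "0 \<le> r * g (Suc n) - (P (Suc n) - P n)" using PP by simp
    moreover define A B C where "A = E n - D * g n" and "B = r * g (Suc n) - (P (Suc n) - P n)"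
      and "C = D * (g (Suc n) - g n)"
    ultimately have "\<bar>C\<bar> \<le> 4 * (g (Suc n) - g n)" "B \<le> g (Suc n) - g n" "0 \<le> B"
      "\<bar>A\<bar> \<le> 5 * (g n - g 1)" using IH by (simp_all add: D_def)
    then show ?case unfolding eq A_def[symmetric] B_def[symmetric] C_def[symmetric] by argo
  qed
  define N where "N = nat \<lfloor>z\<rfloor>"
  have N: "1 \<le> N" "real N \<le> z" "z < real N + 1" using z by (auto simp: N_def) linarith+
  have gN: "g N \<le> g z" "g 1 \<le> g N" using mono[of N z] mono[of 1 N] N by auto
  have "ln z - ln N \<le> (z - N) / N" using N z by (intro ln_diff_le) auto
  also have "\<dots> \<le> 1" using N by (simp add: field_simps)
  finally have "(ln z - ln N) * g z \<le> 1 * g z" using gN g1 by (intro mult_right_mono) auto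
  moreover have "0 \<le> (ln z - ln N) * g N" using N gN g1 by (intro mult_nonneg_nonneg) auto
  ultimately have PN: "0 \<le> P z - P N" "P z - P N \<le> g z" using P[of N z] N by auto
  have "\<bar>(mertens_sum N - ln N) * g N\<bar> \<le> 4 * g N"
    using mertens_bound[OF N(1)] gN g1 by (simp add: abs_mult mult_right_mono)
  \<comment> \<open>5 from the induction and 4 from the boundary term; the remaining stretch from
    \<open>N\<close> to \<open>z\<close> supplies the tenth \<open>g z\<close>.\<close>
  then have "\<bar>E N\<bar> \<le> 9 * g N" using ind[OF N(1,2)] g1 by argo
  then show ?thesis unfolding E_def N_def[symmetric] using PN gN by linarith
qed

text \<open>For a prime p > z the von Mangoldt value ln p exceeds ln z, so the sum is a difference
  of two Mertens sums divided by ln z.\<close>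

lemma sum_inverse_primes_le:
  assumes "2 \<le> z" "z \<le> y"
  shows "(\<Sum>p | prime p \<and> z < real p \<and> real p \<le> y. 1 / real p) \<le> (ln y - ln z + 10) / ln z"
proof -
  let ?Q = "{p. prime p \<and> z < real p \<and> real p \<le> y}"
  define M N where "M = nat \<lfloor>z\<rfloor>" and "N = nat \<lfloor>y\<rfloor>"
  have MN: "1 \<le> M" "M \<le> N" "real M \<le> z" "z < real M + 1" "1 \<le> N" "real N \<le> y"
    using assms unfolding M_def N_def by (auto intro!: nat_mono floor_mono) linarith+
  have sub: "?Q \<subseteq> {M<..N}"
  proof
    fix p assume p: "p \<in> ?Q"
    then have "M < p" using MN by simp
    moreover have "p \<le> N" using p assms by (simp add: N_def le_nat_floor)
    ultimately show "p \<in> {M<..N}" by simp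
  qed
  have "ln z * (\<Sum>p\<in>?Q. 1 / real p) = (\<Sum>p\<in>?Q. ln z / real p)" by (simp add: sum_distrib_left)
  also have "\<dots> \<le> (\<Sum>p\<in>?Q. mangoldt p / real p)"
    using assms by (intro sum_mono divide_right_mono) auto
  also have "\<dots> \<le> (\<Sum>p\<in>{M<..N}. mangoldt p / real p)"
    using sub by (intro sum_mono2) (auto simp: mangoldt_nonneg)
  also have "\<dots> = mertens_sum N - mertens_sum M"
  proof -
    have "{1..N} = {1..M} \<union> {M<..N}" using MN by auto
    then have "mertens_sum N = mertens_sum M + (\<Sum>p\<in>{M<..N}. mangoldt p / real p)"
      unfolding mertens_sum_def by (simp only: sum.union_disjoint[of "{1..M}" "{M<..N}"]
        finite_atLeastAtMost finite_greaterThanAtMost) (subst sum.union_disjoint, auto)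
    then show ?thesis by simp
  qed
  also have "\<dots> \<le> ln N - ln M + 8"
    using mertens_bound[OF MN(1)] mertens_bound[OF MN(5)] by linarith
  also have "\<dots> \<le> ln y - ln z + 10"
  proof -
    have "ln N \<le> ln y" using MN by simp
    moreover have "ln z - ln M \<le> (z - M) / M" using MN assms by (intro ln_diff_le) auto
    moreover have "(z - M) / M \<le> 1" using MN by (simp add: field_simps)
    ultimately show ?thesis by linarith
  qed
  finally show ?thesis using assms by (simp add: field_simps)
qed

text \<open>A dyadic staircase above the logarithm. With it the sum of ln(x / n) over smooth n
  becomes a finite sum of counts at x / 2^j, with no integral of the counting function.\<close>

lemma ln_le_card_powers_of_two:
  fixes r :: real
  assumes "1 \<le> r" "r < 2 ^ J"
  shows "ln r \<le> ln 2 * real (card {j\<in>{..<J}. 2 ^ j \<le> r})"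
  using assms
proof (induction J)
  case (Suc J)
  show ?case
  proof (cases "r < 2 ^ J")
    case True
    have "card {j\<in>{..<J}. 2 ^ j \<le> r} \<le> card {j\<in>{..<Suc J}. 2 ^ j \<le> r}"
      by (intro card_mono) auto
    then have "ln 2 * real (card {j\<in>{..<J}. 2 ^ j \<le> r}) \<le> ln 2 * real (card {j\<in>{..<Suc J}. 2 ^ j \<le> r})"
      by simp
    then show ?thesis using Suc True by linarith
  next
    case False
    have "2 ^ j \<le> r" if "j < Suc J" for j
    proof -
      have "(2::real) ^ j \<le> 2 ^ J" using that by (intro power_increasing) auto
      then show ?thesis using False by linarith
    qed
    then have "{j\<in>{..<Suc J}. 2 ^ j \<le> r} = {..<Suc J}" by auto
    moreover have "ln r \<le> ln (2 ^ Suc J)" using Suc.prems by (intro ln_mono) auto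
    moreover have "ln ((2::real) ^ Suc J) = ln 2 * real (Suc J)" by (simp only: ln_realpow mult.commute)
    ultimately show ?thesis by simp
  qed
qed simp

lemma sum_ln_ratio_smooth:
  assumes "x < 2 ^ J"
  shows "(\<Sum>n\<in>smooth_set x y. ln (x / n)) \<le> ln 2 * (\<Sum>j<J. smooth_count (x / 2 ^ j) y)"
proof -
  have "(\<Sum>n\<in>smooth_set x y. ln (x / n)) \<le>
      (\<Sum>n\<in>smooth_set x y. ln 2 * real (card {j\<in>{..<J}. 2 ^ j \<le> x / n}))"
  proof (intro sum_mono ln_le_card_powers_of_two)
    fix n assume "n \<in> smooth_set x y"
    then have n: "1 \<le> real n" "real n \<le> x" by (auto simp: smooth_set_def)
    then show "1 \<le> x / n" by simp
    have "x / n \<le> x / 1" using n by (intro divide_left_mono) auto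
    then show "x / n < 2 ^ J" using assms by simp
  qed
  also have "\<dots> = ln 2 * (\<Sum>n\<in>smooth_set x y. \<Sum>j<J. if 2 ^ j \<le> x / n then 1 else 0)"
    by (simp add: sum_distrib_left sum.If_cases Int_def)
  also have "(\<Sum>n\<in>smooth_set x y. \<Sum>j<J. if 2 ^ j \<le> x / n then 1 else 0) =
     (\<Sum>j<J. \<Sum>n\<in>smooth_set x y. if 2 ^ j \<le> x / n then 1 else (0::real))" by (rule sum.swap)
  also have "\<dots> = (\<Sum>j<J. smooth_count (x / 2 ^ j) y)"
  proof (intro sum.cong refl)
    fix j
    have "smooth_set x y \<inter> {n. 2 ^ j \<le> x / n} = smooth_set (x / 2 ^ j) y"
    proof -
      have "2 ^ j \<le> x / n \<longleftrightarrow> real n \<le> x / 2 ^ j" if "1 \<le> n" for n :: nat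
        using that by (simp add: field_simps)
      moreover have "real n \<le> x" if "1 \<le> n" "real n \<le> x / 2 ^ j" for n :: nat
      proof -
        have "real n * 1 \<le> real n * 2 ^ j" by (intro mult_left_mono) auto
        moreover have "real n * 2 ^ j \<le> x" using that by (simp add: field_simps)
        ultimately show ?thesis by linarith
      qed
      ultimately show ?thesis unfolding smooth_set_def by blast
    qed
    then show "(\<Sum>n\<in>smooth_set x y. if 2 ^ j \<le> x / n then 1 else 0) = smooth_count (x / 2 ^ j) y"
      by (simp add: smooth_count_def sum.If_cases)
  qed
  finally show ?thesis .
qed

lemma two_powr_le: "(2::real) powr (-3/4) \<le> 2/3"
proof -
  have "(2 powr (-3/4)) ^ 4 = (2::real) powr (-3)" by (simp add: powr_power)
  also have "\<dots> = 1/8" by (simp add: powr_minus powr_numeral)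
  also have "\<dots> \<le> (2/3)^4" by (simp add: power4_eq_xxxx)
  finally show ?thesis by (subst (asm) power_mono_iff) auto
qed

text \<open>Proper powers of p contribute about p^(-3/2) ln p, which converges. The exponent 3/4 is
  the saving available in \<open>W_div\<close>, and it suffices because proper powers start at the
  square.\<close>

lemma sum_mangoldt_proper_powers:
  "\<exists>K>0. \<forall>T. finite T \<longrightarrow> (\<forall>d\<in>T. \<not> prime d) \<longrightarrow> (\<Sum>d\<in>T. mangoldt d * real d powr (-3/4)) \<le> K"
proof -
  have summ: "summable (\<lambda>n. 12 * real n powr (-5/4))"
    by (intro summable_mult) (simp add: summable_real_powr_iff)
  define K where "K = (\<Sum>n. 12 * real n powr (-5/4)) + 1"
  have "K > 0" unfolding K_def using suminf_nonneg[OF summ] by auto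
  moreover have "(\<Sum>d\<in>T. mangoldt d * real d powr (-3/4)) \<le> K" if T: "finite T" "\<forall>d\<in>T. \<not> prime d" for T
  proof -
    define N where "N = Max (insert 0 T)"
    define I where "I = {p. prime p \<and> p \<le> N} \<times> {2..<N+2}"
    let ?f = "\<lambda>d. mangoldt d * real d powr (-3/4)"
    have fin: "finite I" by (simp add: I_def)
    have sub: "{d\<in>T. primepow d} \<subseteq> (\<lambda>(p, m). p ^ m) ` I"
    proof
      fix d assume "d \<in> {d\<in>T. primepow d}"
      then have d: "d \<in> T" "primepow d" by auto
      then obtain p m where pm: "prime p" "m > 0" "d = p ^ m" unfolding primepow_def by blast
      have "m \<noteq> 1" using pm T(2) d(1) by auto
      then have m2: "m \<ge> 2" using pm by simp
      have dN: "d \<le> N" using d(1) T by (simp add: N_def)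
      have "p \<le> d" unfolding pm(3) using pm(2) prime_gt_0_nat[OF pm(1)] by (intro self_le_power) auto
      moreover have "m < 2 ^ m" by (rule less_exp)
      moreover have "2 ^ m \<le> p ^ m" using prime_ge_2_nat[OF pm(1)] by (intro power_mono) auto
      ultimately have "p \<le> N" "m < N + 2" using dN pm(3) by linarith+
      then have "(p, m) \<in> I" using m2 pm by (auto simp: I_def)
      then show "d \<in> (\<lambda>(p, m). p ^ m) ` I" using pm(3) by force
    qed
    have "(\<Sum>d\<in>T. ?f d) = (\<Sum>d\<in>{d\<in>T. primepow d}. ?f d)"
      using T by (intro sum.mono_neutral_right) (auto simp: mangoldt_def)
    also have "\<dots> \<le> (\<Sum>d\<in>(\<lambda>(p, m). p ^ m) ` I. ?f d)"
      using fin sub by (intro sum_mono2) (auto simp: mangoldt_nonneg)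
    also have "\<dots> \<le> sum (?f \<circ> (\<lambda>(p, m). p ^ m)) I"
      by (intro sum_image_le fin) (auto simp: mangoldt_nonneg)
    also have "\<dots> = (\<Sum>p | prime p \<and> p \<le> N. \<Sum>m\<in>{2..<N+2}. ?f (p ^ m))"
      unfolding I_def sum.cartesian_product by (intro sum.cong refl) (simp add: case_prod_unfold)
    also have "\<dots> \<le> (\<Sum>p | prime p \<and> p \<le> N. 12 * real p powr (-5/4))"
    proof (intro sum_mono)
      fix p assume "p \<in> {p. prime p \<and> p \<le> N}"
      then have p: "prime p" "2 \<le> real p" using prime_ge_2_nat by auto
      define r where "r = real p powr (-3/4)"
      have "r \<le> 2 powr (-3/4)" unfolding r_def using p by (intro powr_mono2') auto
      also have "(2::real) powr (-3/4) \<le> 2/3" by (rule two_powr_le)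
      finally have r: "0 \<le> r" "r \<le> 2/3" by (auto simp: r_def)
      have pow2: "r\<^sup>2 * r ^ (m - 2) = r ^ m" if "2 \<le> m" for m
        using that by (metis le_add_diff_inverse power_add)
      have "(\<Sum>m\<in>{2..<N+2}. ?f (p ^ m)) = (\<Sum>m\<in>{2..<N+2}. ln p * r ^ m)"
        using p by (intro sum.cong) (auto simp: r_def powr_power powr_realpow[symmetric] powr_powr mult.commute)
      also have "\<dots> = (\<Sum>m<N. ln p * r\<^sup>2 * r ^ m)"
        by (rule sum.reindex_bij_witness[of _ "\<lambda>m. m + 2" "\<lambda>m. m - 2"])
          (auto simp: power_add mult.assoc pow2)
      also have "\<dots> = ln p * r\<^sup>2 * (\<Sum>m<N. r ^ m)" by (simp add: sum_distrib_left)
      also have "\<dots> \<le> ln p * r\<^sup>2 * 3"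
      proof (intro mult_left_mono)
        have "(\<Sum>m<N. r ^ m) = (1 - r ^ N) / (1 - r)" using r by (subst sum_gp_strict) auto
        also have "\<dots> \<le> 1 / (1/3)" using r by (intro frac_le) auto
        finally show "(\<Sum>m<N. r ^ m) \<le> 3" by simp
      qed (use p in auto)
      \<comment> \<open>Trading ln p for 4 p^(1/4) leaves the exponent -5/4, still summable over all
        integers.\<close>
      also have "\<dots> \<le> (4 * real p powr (1/4)) * r\<^sup>2 * 3"
      proof -
        have "ln (real p) = 4 * ln (real p powr (1/4))" using p by (simp add: ln_powr)
        also have "\<dots> \<le> 4 * real p powr (1/4)" using p ln_le_minus_one[of "real p powr (1/4)"] by simp
        finally show ?thesis by (intro mult_right_mono) auto
      qed
      also have "\<dots> = 12 * real p powr (-5/4)"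
        using p by (simp add: r_def power2_eq_square powr_add[symmetric])
      finally show "(\<Sum>m\<in>{2..<N+2}. ?f (p ^ m)) \<le> 12 * real p powr (-5/4)" .
    qed
    also have "\<dots> \<le> (\<Sum>n. 12 * real n powr (-5/4))"
      by (intro sum_le_suminf summ) auto
    finally show ?thesis by (simp add: K_def)
  qed
  ultimately show ?thesis by blast
qed

section \<open>Comparison of smooth numbers with the Dickman function\<close>

lemma dickman_rate_ge_1: "U \<ge> 0 \<Longrightarrow> dickman_rate U \<ge> 1"
proof -
  assume "U \<ge> 0"
  then have "ln (4 * U + 4) \<ge> ln (exp 1)" using exp_le by (subst ln_le_cancel_iff) auto
  then show ?thesis by (simp add: dickman_rate_def)
qed

text \<open>The range of u is limited by \<open>U\<close>. The condition \<open>rate\<close> makes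
  the decay of rho over a shift ln d / ln y at most d^(1/4), which is what keeps the main term
  growing like a positive power of x.\<close>

locale smooth_range =
  fixes y U :: real
  assumes y: "y > 1" and U: "U \<ge> 1" and rate: "4 * dickman_rate U \<le> ln y"
begin

definition L :: real where "L = ln y"
definition G :: real where "G = dickman_rate U"
text \<open>The expected main term. Below 1 it vanishes together with rho, as the count does, which
  makes \<open>W_div\<close> valid for every d \<ge> 1.\<close>

definition W :: "real \<Rightarrow> real" where "W x = x * dickman (ln x / L)"

lemma L_pos: "L > 0" using y by (simp add: L_def)
lemma G_ge_1: "G \<ge> 1" using dickman_rate_ge_1 U by (simp add: G_def)
lemma G_L: "4 * G \<le> L" using rate by (simp add: G_def L_def)

lemma W_nonneg: "x \<ge> 0 \<Longrightarrow> W x \<ge> 0"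
  by (simp add: W_def dickman_nonneg)

lemma W_small: "0 < x \<Longrightarrow> x < 1 \<Longrightarrow> W x = 0"
  using L_pos by (simp add: W_def dickman_neg divide_neg_pos)

lemma W_le_y: "1 \<le> x \<Longrightarrow> x \<le> y \<Longrightarrow> W x = x"
  using L_pos by (simp add: W_def dickman_01 L_def)

lemma W_div:
  assumes x: "1 \<le> x" "ln x \<le> U * L" and d: "1 \<le> d"
  shows "W (x / d) \<le> W x * d powr (-3/4)"
proof (cases "d \<le> x")
  case False
  then show ?thesis using W_small[of "x / d"] W_nonneg[of x] assms by (simp add: field_simps)
next
  case True
  define u v where "u = ln x / L" and "v = ln d / L"
  have uv: "0 \<le> u - v" "u - v \<le> u" "u \<le> U"
    using True x d L_pos by (auto simp: u_def v_def field_simps)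
  have "G * v = (G / L) * ln d" by (simp add: v_def)
  also have "\<dots> \<le> (1/4) * ln d" using G_L L_pos d by (intro mult_right_mono) (auto simp: field_simps)
  finally have Gv: "exp (G * v) \<le> d powr (1/4)" using d by (simp add: powr_def)
  have "dickman (u - v) \<le> dickman u * exp (G * (u - (u - v)))"
    unfolding G_def using uv by (intro dickman_exp_le) auto
  also have "\<dots> \<le> dickman u * d powr (1/4)" using Gv by (intro mult_left_mono dickman_nonneg) auto
  finally have "x / d * dickman (u - v) \<le> x / d * (dickman u * d powr (1/4))"
    using x d by (intro mult_left_mono) auto
  also have "\<dots> = W x * (d powr (1/4) / d)" by (simp add: W_def u_def)
  also have "d powr (1/4) / d = d powr (-3/4)"
    using d powr_diff[of d "1/4" 1] by simp
  also have "x / d * dickman (u - v) = W (x / d)"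
    using x d by (simp add: W_def u_def v_def ln_div diff_divide_distrib)
  finally show ?thesis .
qed

text \<open>\<open>W_div\<close> with d = x, where \<open>W 1 = 1\<close>. Such lower bounds let
  additive errors be absorbed into relative ones.\<close>

lemma W_ge_powr:
  assumes "1 \<le> x" "ln x \<le> U * L" shows "x powr (3/4) \<le> W x"
proof -
  have "W (x / x) = 1" using assms W_le_y[of 1] y by simp
  then have "1 \<le> W x * x powr (-3/4)" using W_div[OF assms assms(1)] by simp
  then have "1 * x powr (3/4) \<le> W x * x powr (-3/4) * x powr (3/4)" by (intro mult_right_mono) auto
  then show ?thesis using assms by (simp add: mult.assoc powr_add[symmetric])
qed

lemma W_ge_1:
  assumes "1 \<le> x" "ln x \<le> U * L" shows "1 \<le> W x"
  using W_ge_powr[OF assms] ge_one_powr_ge_zero[of x "3/4"] assms by simp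

lemma W_ge_y:
  assumes "y \<le> x" "ln x \<le> U * L" shows "y \<le> W x"
proof -
  have xy: "1 \<le> x / y" using assms y by simp
  have "W (x / (x / y)) \<le> W x * (x / y) powr (-3/4)"
    using assms y xy by (intro W_div) auto
  also have "\<dots> \<le> W x * 1"
    using xy assms y powr_mono[of "-3/4" 0 "x / y"] by (intro mult_left_mono W_nonneg) auto
  finally show ?thesis using assms y W_le_y[of y] by simp
qed

text \<open>The error in Mertens' theorem enters as a multiple of x rho(u - 1). This bound turns it
  into G u W(x), a relative error of order G / L after division by ln x.\<close>

lemma W_shift_1:
  assumes "y \<le> x" "ln x \<le> U * L"
  shows "x * dickman (ln x / L - 1) \<le> G * (ln x / L) * W x"
proof -
  have "ln y \<le> ln x" using assms y by simp
  then have "1 \<le> ln x / L" "ln x / L \<le> U" using assms L_pos by (auto simp: L_def field_simps)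
  then have "dickman (ln x / L - 1) \<le> G * (ln x / L * dickman (ln x / L))"
    unfolding G_def by (rule dickman_ratio)
  then have "x * dickman (ln x / L - 1) \<le> x * (G * (ln x / L * dickman (ln x / L)))"
    using assms y by (intro mult_left_mono) auto
  then show ?thesis by (simp add: W_def mult_ac)
qed

text \<open>Partial summation with s going to rho(u - ln s / L), increasing in s as rho decreases.
  The substitution v = u - ln s / L turns ds / s into -L dv, so the antiderivative is -L times
  \<open>dickman_int\<close>.\<close>

lemma sum_mangoldt_W:
  assumes x: "y \<le> x" and z: "1 \<le> z" "z \<le> y"
  shows "\<bar>(\<Sum>d=1..nat \<lfloor>z\<rfloor>. mangoldt d * W (x / d)) -
     x * L * (dickman_int (ln x / L) - dickman_int (ln x / L - ln z / L))\<bar>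
       \<le> 10 * (x * dickman (ln x / L - 1))"
proof -
  define u where "u = ln x / L"
  define g P where "g s = dickman (u - ln s / L)" and "P s = - L * dickman_int (u - ln s / L)" for s
  have "ln y \<le> ln x" using x y by simp
  then have u1: "u \<ge> 1" using L_pos by (simp add: u_def L_def)
  have rng: "0 \<le> u - ln t / L" "u - 1 \<le> u - ln t / L" if "1 \<le> t" "t \<le> y" for t
  proof -
    have "ln t / L \<le> 1" using that L_pos by (simp add: L_def)
    then show "0 \<le> u - ln t / L" "u - 1 \<le> u - ln t / L" using u1 by auto
  qed
  have mono: "g s \<le> g t" if "1 \<le> s" "s \<le> t" "t \<le> z" for s t
  proof -
    have "ln s / L \<le> ln t / L" using that L_pos by (simp add: divide_right_mono)
    then show ?thesis unfolding g_def using rng[of t] that z by (intro dickman_antimono) auto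
  qed
  have PP: "(ln t - ln s) * g s \<le> P t - P s \<and> P t - P s \<le> (ln t - ln s) * g t"
    if st: "1 \<le> s" "s \<le> t" "t \<le> z" for s t
  proof (cases "s = t")
    case False
    define a b where "a = u - ln t / L" and "b = u - ln s / L"
    have "ln s < ln t" using st False by simp
    then have "ln s / L < ln t / L" using L_pos by (simp add: divide_strict_right_mono)
    then have ab: "0 \<le> a" "a < b" using rng[of t] st z by (auto simp: a_def b_def)
    obtain c where c: "a < c" "c < b" "dickman_int b - dickman_int a = (b - a) * dickman c"
      using dickman_int_mvt[OF ab] by blast
    have "P t - P s = L * (dickman_int b - dickman_int a)"
      by (simp add: P_def a_def b_def algebra_simps)
    also have "\<dots> = (L * (b - a)) * dickman c" using c by simp
    also have "L * (b - a) = ln t - ln s" using L_pos by (simp add: a_def b_def field_simps)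
    finally have e: "P t - P s = (ln t - ln s) * dickman c" .
    have "g s \<le> dickman c" "dickman c \<le> g t"
      unfolding g_def using c ab by (auto intro!: dickman_antimono simp: a_def b_def)
    then show ?thesis unfolding e using \<open>ln s < ln t\<close> by (auto intro!: mult_left_mono)
  qed simp
  have "\<bar>(\<Sum>d=1..nat \<lfloor>z\<rfloor>. mangoldt d / d * g d) - (P z - P 1)\<bar> \<le> 10 * g z"
    using z mono PP by (intro mertens_partial_summation) (auto simp: g_def dickman_nonneg)
  also have "g z \<le> dickman (u - 1)"
    unfolding g_def using rng[of z] z u1 by (intro dickman_antimono) auto
  finally have "x * \<bar>(\<Sum>d=1..nat \<lfloor>z\<rfloor>. mangoldt d / d * g d) - (P z - P 1)\<bar> \<le> x * (10 * dickman (u - 1))"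
    using x y by (intro mult_left_mono) auto
  also have "x * \<bar>(\<Sum>d=1..nat \<lfloor>z\<rfloor>. mangoldt d / d * g d) - (P z - P 1)\<bar> =
     \<bar>x * (\<Sum>d=1..nat \<lfloor>z\<rfloor>. mangoldt d / d * g d) - x * (P z - P 1)\<bar>"
    using x y by (simp add: abs_mult_pos' right_diff_distrib[symmetric])
  also have "x * (P z - P 1) = x * L * (dickman_int u - dickman_int (u - ln z / L))"
    by (simp add: P_def algebra_simps)
  also have "x * (\<Sum>d=1..nat \<lfloor>z\<rfloor>. mangoldt d / d * g d) = (\<Sum>d=1..nat \<lfloor>z\<rfloor>. mangoldt d * W (x / d))"
    unfolding sum_distrib_left
  proof (intro sum.cong refl)
    fix d assume "d \<in> {1..nat \<lfloor>z\<rfloor>}"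
    then have "ln (x / d) / L = u - ln d / L" using x y by (simp add: ln_div u_def diff_divide_distrib)
    then show "x * (mangoldt d / real d * g (real d)) = mangoldt d * W (x / real d)"
      by (simp add: W_def g_def)
  qed
  finally show ?thesis by (simp add: u_def mult_ac)
qed

lemma sum_mangoldt_W_full:
  assumes x: "y \<le> x"
  shows "\<bar>(\<Sum>d=1..nat \<lfloor>y\<rfloor>. mangoldt d * W (x / d)) - W x * ln x\<bar> \<le> 10 * (x * dickman (ln x / L - 1))"
proof -
  have "ln y \<le> ln x" using x y by simp
  then have u1: "ln x / L \<ge> 1" using L_pos by (simp add: L_def)
  have "ln y / L = 1" using L_pos by (simp add: L_def)
  moreover have "x * L * (dickman_int (ln x / L) - dickman_int (ln x / L - 1)) = W x * ln x"
    unfolding dickman_eq_int[OF u1, symmetric] using L_pos by (simp add: W_def)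
  ultimately show ?thesis using sum_mangoldt_W[OF x, of y] y by simp
qed

text \<open>The range d \<le> sqrt y corresponds to [u - 1/2, u]. As rho decreases, this half
  carries at most half of the integral u rho(u).\<close>

lemma sum_mangoldt_W_half:
  assumes x: "y \<le> x"
  shows "(\<Sum>d=1..nat \<lfloor>sqrt y\<rfloor>. mangoldt d * W (x / d)) \<le>
     W x * ln x / 2 + 10 * (x * dickman (ln x / L - 1))"
proof -
  define u where "u = ln x / L"
  have "ln y \<le> ln x" using x y by simp
  then have u1: "u \<ge> 1" using L_pos by (simp add: L_def u_def)
  have "sqrt y \<le> sqrt y * sqrt y" using y by (intro mult_le_cancel_left1[THEN iffD2]) auto
  then have sq: "1 \<le> sqrt y" "sqrt y \<le> y" using y by auto
  have h: "ln (sqrt y) / L = 1/2" using y L_pos by (simp add: ln_sqrt L_def)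
  obtain c where c: "u - 1/2 < c" "dickman_int u - dickman_int (u - 1/2) = (u - (u - 1/2)) * dickman c"
    using dickman_int_mvt[of "u - 1/2" u] u1 by auto
  obtain c' where c': "u - 1 < c'" "c' < u - 1/2"
      "dickman_int (u - 1/2) - dickman_int (u - 1) = ((u - 1/2) - (u - 1)) * dickman c'"
    using dickman_int_mvt[of "u - 1" "u - 1/2"] u1 by auto
  have "dickman c \<le> dickman c'" using c c' u1 by (intro dickman_antimono) auto
  then have "dickman_int u - dickman_int (u - 1/2) \<le> (u * dickman u) / 2"
    using c c' dickman_eq_int[OF u1] by simp
  then have "x * L * (dickman_int u - dickman_int (u - 1/2)) \<le> x * L * ((u * dickman u) / 2)"
    using x y L_pos by (intro mult_left_mono) auto
  also have "\<dots> = W x * ln x / 2" using L_pos by (simp add: W_def u_def)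
  finally have "x * L * (dickman_int u - dickman_int (u - 1/2)) \<le> W x * ln x / 2" .
  then show ?thesis using sum_mangoldt_W[OF x sq] unfolding h u_def by argo
qed

text \<open>Only the values at x / 2 and below are under control, so the term j = 0 stays as the
  count at x itself. The others form a geometric series of ratio 2^(-3/4) \<le> 2/3, whence 6 = 3
  (2/3) 3.\<close>

lemma sum_ln_ratio_le:
  assumes x: "1 \<le> x" "ln x \<le> U * L"
    and ub: "\<And>x'. 1 \<le> x' \<Longrightarrow> x' \<le> x / 2 \<Longrightarrow> smooth_count x' y \<le> 3 * W x'"
  shows "(\<Sum>n\<in>smooth_set x y. ln (x / n)) \<le> smooth_count x y + 6 * W x"
proof -
  define r where "r = (2::real) powr (-3/4)"
  have "r \<le> 2/3" unfolding r_def by (rule two_powr_le)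
  moreover have "0 \<le> r" by (simp add: r_def)
  ultimately have r: "0 \<le> r" "r \<le> 2/3" by auto
  obtain J where J: "x < 2 ^ J" using real_arch_pow[of 2 x] by auto
  have "J \<noteq> 0" using J x by (intro notI) auto
  then obtain J' where J': "J = Suc J'" by (cases J) auto
  have le_geom: "smooth_count (x / 2 ^ Suc j) y \<le> 3 * (W x * r) * r ^ j" for j
  proof (cases "1 \<le> x / 2 ^ Suc j")
    case True
    have "x / 2 ^ Suc j \<le> x / 2"
      using x one_le_power[of "2::real" j] by (simp add: field_simps)
    then have "smooth_count (x / 2 ^ Suc j) y \<le> 3 * W (x / 2 ^ Suc j)" using ub True by blast
    also have "W (x / 2 ^ Suc j) \<le> W x * (2 ^ Suc j) powr (-3/4)"
      using one_le_power[of "2::real" "Suc j"] by (intro W_div x) auto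
    also have "(2 ^ Suc j) powr (-3/4) = r ^ Suc j"
      unfolding r_def by (simp only: powr_realpow[symmetric] powr_powr powr_power mult.commute)
    finally show ?thesis by simp
  next
    case False
    then have "smooth_count (x / 2 ^ Suc j) y = 0" by (simp add: smooth_count_def smooth_set_empty)
    then show ?thesis using W_nonneg[of x] x r by simp
  qed
  have "(\<Sum>n\<in>smooth_set x y. ln (x / n)) \<le> ln 2 * (\<Sum>j<J. smooth_count (x / 2 ^ j) y)"
    using J by (rule sum_ln_ratio_smooth)
  also have "\<dots> \<le> 1 * (\<Sum>j<J. smooth_count (x / 2 ^ j) y)"
    using ln_2_less_1 by (intro mult_right_mono sum_nonneg smooth_count_nonneg) auto
  also have "\<dots> = smooth_count x y + (\<Sum>j<J'. smooth_count (x / 2 ^ Suc j) y)"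
    unfolding J' by (subst sum.lessThan_Suc_shift) simp
  also have "(\<Sum>j<J'. smooth_count (x / 2 ^ Suc j) y) \<le> (\<Sum>j<J'. 3 * (W x * r) * r ^ j)"
    by (intro sum_mono le_geom)
  also have "\<dots> = 3 * (W x * r) * (\<Sum>j<J'. r ^ j)" by (simp add: sum_distrib_left)
  also have "\<dots> \<le> 3 * (W x * (2/3)) * 3"
  proof (intro mult_mono mult_left_mono)
    have "(\<Sum>j<J'. r ^ j) = (1 - r ^ J') / (1 - r)" using r by (subst sum_gp_strict) auto
    also have "\<dots> \<le> 1 / (1/3)" using r by (intro frac_le) auto
    finally show "(\<Sum>j<J'. r ^ j) \<le> 3" by simp
  qed (use r W_nonneg[of x] x in \<open>auto intro!: sum_nonneg\<close>)
  finally show ?thesis by simp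
qed

text \<open>A y-smooth \<open>d\<close> exceeding y is not prime, so the convergent sum over proper
  powers bounds this part.\<close>

lemma sum_mangoldt_W_powers:
  assumes x: "1 \<le> x" "ln x \<le> U * L"
    and K: "\<And>T. finite T \<Longrightarrow> (\<forall>d\<in>T. \<not> prime d) \<Longrightarrow> (\<Sum>d\<in>T. mangoldt d * real d powr (-3/4)) \<le> K"
    and ub: "\<And>x'. 1 \<le> x' \<Longrightarrow> x' \<le> x / 2 \<Longrightarrow> smooth_count x' y \<le> 3 * W x'"
  shows "(\<Sum>d\<in>{d\<in>smooth_set x y. y < real d}. mangoldt d * smooth_count (x / d) y) \<le> 3 * K * W x"
proof -
  let ?T = "{d\<in>smooth_set x y. y < real d}"
  have np: "\<not> prime d" if "d \<in> ?T" for d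
    using that by (auto simp: smooth_set_def)
  have "(\<Sum>d\<in>?T. mangoldt d * smooth_count (x / d) y) \<le>
     (\<Sum>d\<in>?T. (3 * W x) * (mangoldt d * real d powr (-3/4)))"
  proof (intro sum_mono)
    fix d assume d: "d \<in> ?T"
    then have d1: "1 < real d" "real d \<le> x" using y by (auto simp: smooth_set_def)
    then have "2 \<le> real d" by simp
    then have "x / d \<le> x / 2" using x by (intro divide_left_mono) auto
    then have "smooth_count (x / d) y \<le> 3 * W (x / d)" using d1 by (intro ub) auto
    also have "W (x / d) \<le> W x * real d powr (-3/4)" using d1 by (intro W_div x) auto
    finally have "mangoldt d * smooth_count (x / d) y \<le> mangoldt d * (3 * (W x * real d powr (-3/4)))"
      by (intro mult_left_mono mangoldt_nonneg) auto
    then show "mangoldt d * smooth_count (x / d) y \<le> (3 * W x) * (mangoldt d * real d powr (-3/4))"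
      by (simp add: mult_ac)
  qed
  also have "\<dots> = (3 * W x) * (\<Sum>d\<in>?T. mangoldt d * real d powr (-3/4))"
    by (simp add: sum_distrib_left)
  also have "\<dots> \<le> (3 * W x) * K"
    using np x W_nonneg[of x] by (intro mult_left_mono K) auto
  finally show ?thesis by (simp add: mult_ac)
qed

section \<open>The induction comparing counts with the main term\<close>

lemma smooth_count_ln:
  assumes x: "y \<le> x"
  shows "smooth_count x y * ln x = (\<Sum>n\<in>smooth_set x y. ln (x / n)) +
     (\<Sum>d=1..nat \<lfloor>y\<rfloor>. mangoldt d * smooth_count (x / d) y) +
     (\<Sum>d\<in>{d\<in>smooth_set x y. y < real d}. mangoldt d * smooth_count (x / d) y)"
proof -
  let ?S = "smooth_set x y"
  have "smooth_count x y * ln x = (\<Sum>n\<in>?S. ln x)" by (simp add: smooth_count_def)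
  also have "\<dots> = (\<Sum>n\<in>?S. ln (x / n) + ln n)"
  proof (intro sum.cong refl)
    fix n assume "n \<in> ?S"
    then show "ln x = ln (x / n) + ln n" using x y by (auto simp: smooth_set_def ln_div)
  qed
  also have "\<dots> = (\<Sum>n\<in>?S. ln (x / n)) + (\<Sum>d\<in>?S. mangoldt d * smooth_count (x / d) y)"
    by (simp add: sum.distrib sum_ln_smooth)
  finally have eq: "smooth_count x y * ln x =
    (\<Sum>n\<in>?S. ln (x / n)) + (\<Sum>d\<in>?S. mangoldt d * smooth_count (x / d) y)" .
  \<comment> \<open>All integers up to y are y-smooth, which turns the first piece into a complete
    sum, accessible to Mertens' theorem.\<close>
  have S: "?S = {1..nat \<lfloor>y\<rfloor>} \<union> {d\<in>?S. y < real d}" (is "_ = ?A \<union> ?B")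
  proof -
    have "?A \<subseteq> ?S"
      using smooth_set_mono[OF x order_refl, of y] smooth_set_trivial[of y y] by simp
    moreover have "d \<in> ?A" if "d \<in> ?S" "\<not> y < real d" for d
      using that le_nat_floor_iff[of d y] by (auto simp: smooth_set_def)
    ultimately show ?thesis by blast
  qed
  have "(\<Sum>d\<in>?S. mangoldt d * smooth_count (x / d) y) =
     (\<Sum>d\<in>?A \<union> ?B. mangoldt d * smooth_count (x / d) y)"
    by (rule sum.cong[OF S refl])
  also have "(\<Sum>d\<in>?A \<union> ?B. mangoldt d * smooth_count (x / d) y) =
     (\<Sum>d\<in>?A. mangoldt d * smooth_count (x / d) y) + (\<Sum>d\<in>?B. mangoldt d * smooth_count (x / d) y)"
  proof (rule sum.union_disjoint)
    show "?A \<inter> ?B = {}" using le_nat_floor_iff[of _ y] by fastforce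
  qed auto
  finally show ?thesis using eq by simp
qed

text \<open>With relative error B for the values of u already treated and B + \<delta> allowed for
  smaller x in the new range, the primes above sqrt y contribute with error B and those below with B
  + \<delta>. The latter carry at most half of the mass, so the average is at most B + \<delta> / 2,
  and the other \<delta> / 2 absorbs the boundary, prime power and Mertens errors.\<close>

lemma smooth_count_step:
  assumes x: "y \<le> x" "ln x \<le> U * L" and xk: "ln x \<le> L * (B0 + 1/2)"
    and K: "\<And>T. finite T \<Longrightarrow> (\<forall>d\<in>T. \<not> prime d) \<Longrightarrow> (\<Sum>d\<in>T. mangoldt d * real d powr (-3/4)) \<le> K"
      "K > 0"
    and B: "0 \<le> B" "B + \<delta> \<le> 1" "\<delta> = (64 + 6 * K) * G / L"
    and IH: "\<And>x'. 1 \<le> x' \<Longrightarrow> ln x' \<le> L * B0 \<Longrightarrow> x' \<le> x \<Longrightarrow> \<bar>smooth_count x' y - W x'\<bar> \<le> B * W x' + 1"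
    and IH': "\<And>x'. 1 \<le> x' \<Longrightarrow> x' \<le> x / 2 \<Longrightarrow> \<bar>smooth_count x' y - W x'\<bar> \<le> (B + \<delta>) * W x' + 1"
  shows "\<bar>smooth_count x y - W x\<bar> \<le> (B + \<delta>) * W x"
proof -
  define u Q D where "u = ln x / L" and "Q = x * dickman (ln x / L - 1)"
    and "D = \<bar>smooth_count x y - W x\<bar>"
  have x1: "1 \<le> x" using x y by simp
  have lxy: "L \<le> ln x" unfolding L_def using x y by simp
  have u1: "u \<ge> 1" using lxy L_pos by (simp add: u_def)
  have \<delta>: "\<delta> \<ge> 0" using B(3) K(2) G_ge_1 L_pos by simp
  have lnle: "ln x' \<le> U * L" if "1 \<le> x'" "x' \<le> x" for x'
  proof -
    have "ln x' \<le> ln x" using that by simp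
    then show ?thesis using x(2) by linarith
  qed
  have Wx: "W x \<ge> 1" using W_ge_1[OF x1 x(2)] .
  have ub: "smooth_count x' y \<le> 3 * W x'" if "1 \<le> x'" "x' \<le> x / 2" for x'
  proof -
    have "W x' \<ge> 1" using that x1 by (intro W_ge_1 lnle) auto
    moreover have "(B + \<delta>) * W x' \<le> 1 * W x'" using B calculation by (intro mult_right_mono) auto
    ultimately show ?thesis using IH'[OF that] by linarith
  qed
  have T1: "(\<Sum>n\<in>smooth_set x y. ln (x / n)) \<le> smooth_count x y + 6 * W x" (is "?T1 \<le> _")
    by (rule sum_ln_ratio_le[OF x1 x(2) ub])
  have T1': "0 \<le> ?T1"
  proof (intro sum_nonneg)
    fix n assume "n \<in> smooth_set x y"
    then have "1 \<le> real n" "real n \<le> x" by (auto simp: smooth_set_def)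
    then show "0 \<le> ln (x / n)" by simp
  qed
  let ?T3 = "\<Sum>d\<in>{d\<in>smooth_set x y. y < real d}. mangoldt d * smooth_count (x / d) y"
  have T3: "?T3 \<le> 3 * K * W x" by (rule sum_mangoldt_W_powers[OF x1 x(2) K(1) ub])
  have T3': "0 \<le> ?T3" by (intro sum_nonneg mult_nonneg_nonneg mangoldt_nonneg smooth_count_nonneg)
  let ?M = "\<Sum>d=1..nat \<lfloor>y\<rfloor>. mangoldt d * smooth_count (x / d) y"
  let ?MW = "\<Sum>d=1..nat \<lfloor>y\<rfloor>. mangoldt d * W (x / d)"
  let ?A = "\<Sum>d=1..nat \<lfloor>sqrt y\<rfloor>. mangoldt d * W (x / d)"
  have sq: "sqrt y \<le> y"
  proof -
    have "sqrt y * 1 \<le> sqrt y * sqrt y" using y by (intro mult_left_mono) auto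
    then show ?thesis using y by simp
  qed
  have "\<bar>?M - ?MW\<bar> = \<bar>\<Sum>d=1..nat \<lfloor>y\<rfloor>. mangoldt d * (smooth_count (x / d) y - W (x / d))\<bar>"
    by (simp add: right_diff_distrib sum_subtractf)
  also have "\<dots> \<le> (\<Sum>d=1..nat \<lfloor>y\<rfloor>. \<bar>mangoldt d * (smooth_count (x / d) y - W (x / d))\<bar>)"
    by (rule sum_abs)
  also have "\<dots> \<le> (\<Sum>d=1..nat \<lfloor>y\<rfloor>. mangoldt d + B * (mangoldt d * W (x / d)) +
      (if real d \<le> sqrt y then \<delta> * (mangoldt d * W (x / d)) else 0))"
  proof (intro sum_mono)
    fix d assume d: "d \<in> {1..nat \<lfloor>y\<rfloor>}"
    then have dy: "1 \<le> real d" "real d \<le> y" using le_nat_floor_iff[of d y] by auto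
    then have xd: "1 \<le> x / d" "x / d \<le> x" using x by (auto simp: field_simps)
    let ?E = "\<bar>smooth_count (x / d) y - W (x / d)\<bar>"
    have "mangoldt d * ?E \<le> mangoldt d * (1 + B * W (x / d) + (if real d \<le> sqrt y then \<delta> * W (x / d) else 0))"
    \<comment> \<open>The von Mangoldt function vanishes at 1, so the estimate at x itself, which is
      being proved, does not enter.\<close>
    proof (cases "d = 1")
      case False
      show ?thesis
      proof (intro mult_left_mono mangoldt_nonneg, cases "real d \<le> sqrt y")
        case True
        have "2 \<le> real d" using False d by simp
        then have "x / d \<le> x / 2" using x1 by (intro divide_left_mono) auto
        then show "?E \<le> 1 + B * W (x / d) + (if real d \<le> sqrt y then \<delta> * W (x / d) else 0)"
          using IH'[OF xd(1)] True by (simp add: algebra_simps)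
      next
        case sqd: False
        \<comment> \<open>Dividing by d > sqrt y lowers u by at least 1/2 and so reaches the range
          of \<open>IH\<close>.\<close>
        have "ln (sqrt y) \<le> ln d" using sqd y by (intro ln_mono) auto
        then have "L / 2 \<le> ln d" using y by (simp add: ln_sqrt L_def)
        then have "ln (x / d) \<le> L * B0" using xk dy x1 by (simp add: ln_div algebra_simps)
        then show "?E \<le> 1 + B * W (x / d) + (if real d \<le> sqrt y then \<delta> * W (x / d) else 0)"
          using IH[OF xd(1) _ xd(2)] sqd by simp
      qed
    qed simp
    moreover have "\<bar>mangoldt d * (smooth_count (x / d) y - W (x / d))\<bar> = mangoldt d * ?E"
      by (simp only: abs_mult abs_mangoldt)
    moreover have "mangoldt d * (1 + B * W (x / d) + (if real d \<le> sqrt y then \<delta> * W (x / d) else 0)) =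
      mangoldt d + B * (mangoldt d * W (x / d)) +
      (if real d \<le> sqrt y then \<delta> * (mangoldt d * W (x / d)) else 0)"
      by (cases "real d \<le> sqrt y") (simp_all add: algebra_simps)
    ultimately show "\<bar>mangoldt d * (smooth_count (x / d) y - W (x / d))\<bar> \<le>
      mangoldt d + B * (mangoldt d * W (x / d)) +
      (if real d \<le> sqrt y then \<delta> * (mangoldt d * W (x / d)) else 0)"
      by simp
  qed
  also have "\<dots> = chebyshev_psi (nat \<lfloor>y\<rfloor>) + B * ?MW + \<delta> * ?A"
  proof -
    have "(\<Sum>d=1..nat \<lfloor>y\<rfloor>. if real d \<le> sqrt y then \<delta> * (mangoldt d * W (x / d)) else 0) =
      (\<Sum>d\<in>{d\<in>{1..nat \<lfloor>y\<rfloor>}. real d \<le> sqrt y}. \<delta> * (mangoldt d * W (x / d)))"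
      by (rule sum.inter_filter[symmetric]) simp
    also have "{d\<in>{1..nat \<lfloor>y\<rfloor>}. real d \<le> sqrt y} = {1..nat \<lfloor>sqrt y\<rfloor>}"
      using le_nat_floor_iff[of _ y] le_nat_floor_iff[of _ "sqrt y"] sq by auto
    finally show ?thesis by (simp add: chebyshev_psi_def sum.distrib sum_distrib_left)
  qed
  finally have MM: "\<bar>?M - ?MW\<bar> \<le> chebyshev_psi (nat \<lfloor>y\<rfloor>) + B * ?MW + \<delta> * ?A" .
  \<comment> \<open>The additive 1 of each induction hypothesis accumulates to psi(y) \<le> 4 y, and
    y \<le> W(x) because x \<ge> y.\<close>
  have psi: "chebyshev_psi (nat \<lfloor>y\<rfloor>) \<le> 4 * W x"
  proof -
    have "real (nat \<lfloor>y\<rfloor>) \<le> y" using y by simp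
    then show ?thesis using chebyshev_psi_le[of "nat \<lfloor>y\<rfloor>"] W_ge_y[OF x] by linarith
  qed
  have MW: "\<bar>?MW - W x * ln x\<bar> \<le> 10 * Q" unfolding Q_def by (rule sum_mangoldt_W_full[OF x(1)])
  have A: "?A \<le> W x * ln x / 2 + 10 * Q" unfolding Q_def by (rule sum_mangoldt_W_half[OF x(1)])
  have Q: "Q \<le> G * u * W x" unfolding Q_def u_def by (rule W_shift_1[OF x])
  have Q0: "0 \<le> Q" using x1 by (simp add: Q_def dickman_nonneg)
  have "B * ?MW \<le> B * (W x * ln x + 10 * Q)" using MW B by (intro mult_left_mono) auto
  moreover have "\<delta> * ?A \<le> \<delta> * (W x * ln x / 2 + 10 * Q)" using A \<delta> by (intro mult_left_mono) auto
  moreover have "(B + \<delta>) * (10 * Q) \<le> 1 * (10 * Q)" using B Q0 by (intro mult_right_mono) auto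
  ultimately have MM': "\<bar>?M - ?MW\<bar> \<le> 4 * W x + B * (W x * ln x) + \<delta> * (W x * ln x) / 2 + 10 * Q"
    using MM psi by (simp add: algebra_simps)
  have SD: "smooth_count x y \<le> W x + D" unfolding D_def by linarith
  \<comment> \<open>The sum of ln(x / n) was bounded by the unknown count, so \<open>D\<close>
    recurs on the right; moving it over produces the factor ln x - 1.\<close>
  have "D * ln x = \<bar>smooth_count x y * ln x - W x * ln x\<bar>"
    using lxy L_pos by (simp add: D_def abs_mult left_diff_distrib[symmetric])
  also have "\<dots> \<le> (W x + D + 6 * W x) + 3 * K * W x +
      (4 * W x + B * (W x * ln x) + \<delta> * (W x * ln x) / 2 + 10 * Q) + 10 * Q"
    using smooth_count_ln[OF x(1)] T1 T1' T3 T3' MM' MW SD by argo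
  finally have "D * (ln x - 1) \<le> (11 + 3 * K) * W x + 20 * Q + (B + \<delta> / 2) * (W x * ln x)"
    by (simp add: algebra_simps)
  \<comment> \<open>Here \<open>\<delta>\<close> is fixed: half of it times ln x is (32 + 3 K) G u,
    which pays 12 + 3 K for the bounded terms and 20 G u for the two Mertens errors.\<close>
  moreover have "(11 + 3 * K) * W x + 20 * Q + (B + \<delta>) * W x \<le> \<delta> / 2 * (W x * ln x)"
  proof -
    have Gu: "1 \<le> G * u" using G_ge_1 u1 mult_mono[of 1 G 1 u] by simp
    have "(B + \<delta>) * W x \<le> 1 * W x" using B Wx by (intro mult_right_mono) auto
    then have "(11 + 3 * K) * W x + 20 * Q + (B + \<delta>) * W x \<le> (12 + 3 * K) * W x * 1 + 20 * (G * u * W x)"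
      using Q by (simp add: algebra_simps)
    also have "\<dots> \<le> (12 + 3 * K) * W x * (G * u) + 20 * (G * u * W x)"
      using Gu Wx K(2) by (intro add_right_mono mult_left_mono) auto
    also have "\<dots> = \<delta> / 2 * (W x * ln x)" using L_pos by (simp add: B(3) u_def field_simps)
    finally show ?thesis .
  qed
  ultimately have "D * (ln x - 1) \<le> ((B + \<delta>) * W x) * (ln x - 1)"
    by (simp add: algebra_simps)
  moreover have "ln x - 1 > 0" using lxy G_L G_ge_1 by linarith
  ultimately show ?thesis unfolding D_def by (simp add: mult_le_cancel_right)
qed

text \<open>Two nested inductions: the outer one over half units of u, the inner one over n with x <
  2^n, because the step also refers to arguments up to x / 2 that may lie in the same range of
  u.\<close>

lemma smooth_count_approx:
  assumes K: "\<And>T. finite T \<Longrightarrow> (\<forall>d\<in>T. \<not> prime d) \<Longrightarrow> (\<Sum>d\<in>T. mangoldt d * real d powr (-3/4)) \<le> K"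
      "K > 0"
    and \<delta>: "\<delta> = (64 + 6 * K) * G / L" "real k * \<delta> \<le> 1"
    and x: "1 \<le> x" "ln x \<le> L * (1 + real k / 2)" "ln x \<le> U * L"
  shows "\<bar>smooth_count x y - W x\<bar> \<le> real k * \<delta> * W x + 1"
  using \<delta>(2) x
proof (induction k arbitrary: x)
  case 0
  then have "ln x \<le> ln y" by (simp add: L_def)
  then have xy: "x \<le> y" using 0 y by (subst (asm) ln_le_cancel_iff) auto
  then show ?case using 0 W_le_y[of x] by (simp add: smooth_count_trivial) linarith
next
  case (Suc k)
  note outer = Suc.IH
  have \<delta>0: "\<delta> \<ge> 0" using \<delta>(1) K(2) G_ge_1 L_pos by simp
  then have k\<delta>: "real k * \<delta> \<le> 1" using Suc.prems(1) by (simp add: algebra_simps)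
  obtain n where n: "x < 2 ^ n" using real_arch_pow[of 2 x] by auto
  note kS = Suc.prems(1)
  show ?case using Suc.prems(2-) n
  proof (induction n arbitrary: x)
    case (Suc n)
    note prems = Suc.prems and IHn = Suc.IH
    have IHk: "\<bar>smooth_count x' y - W x'\<bar> \<le> real k * \<delta> * W x' + 1"
      if "1 \<le> x'" "ln x' \<le> L * (1 + real k / 2)" "x' \<le> x" for x'
    proof -
      have "ln x' \<le> ln x" using that by simp
      then have "ln x' \<le> U * L" using prems by linarith
      then show ?thesis using that by (intro outer k\<delta>) auto
    qed
    show ?case
    proof (cases "ln x \<le> L * (1 + real k / 2)")
      case True
      have "real k * \<delta> * W x \<le> real (Suc k) * \<delta> * W x"
        using \<delta>0 W_nonneg[of x] prems(1) by (intro mult_right_mono) auto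
      then show ?thesis using IHk[OF prems(1) True] by simp
    next
      case False
      have "L * 1 \<le> L * (1 + real k / 2)" using L_pos by (intro mult_left_mono) auto
      then have "ln y \<le> ln x" using False by (simp add: L_def)
      then have xy: "y \<le> x" using y prems(1) by (subst (asm) ln_le_cancel_iff) auto
      have "\<bar>smooth_count x y - W x\<bar> \<le> (real k * \<delta> + \<delta>) * W x"
      proof (rule smooth_count_step[of x "1 + real k / 2" K "real k * \<delta>" \<delta>])
        show "ln x \<le> L * (1 + real k / 2 + 1 / 2)" using prems(2) by (simp add: field_simps)
        show "0 \<le> real k * \<delta>" using \<delta>0 by simp
        show "real k * \<delta> + \<delta> \<le> 1" using kS by (simp add: algebra_simps)
        show "\<bar>smooth_count x' y - W x'\<bar> \<le> (real k * \<delta> + \<delta>) * W x' + 1"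
          if "1 \<le> x'" "x' \<le> x / 2" for x'
        proof -
          have "ln x' \<le> ln x" using that prems(1) by simp
          then have "ln x' \<le> L * (1 + real (Suc k) / 2)" "ln x' \<le> U * L" using prems by linarith+
          then have "\<bar>smooth_count x' y - W x'\<bar> \<le> real (Suc k) * \<delta> * W x' + 1"
            using that prems by (intro IHn) auto
          then show ?thesis by (simp add: algebra_simps)
        qed
      qed (use IHk xy prems(3) K \<delta>(1) in auto)
      then show ?thesis by (simp add: algebra_simps)
    qed
  qed simp
qed

lemma smooth_count_approx_u:
  assumes K: "\<And>T. finite T \<Longrightarrow> (\<forall>d\<in>T. \<not> prime d) \<Longrightarrow> (\<Sum>d\<in>T. mangoldt d * real d powr (-3/4)) \<le> K"
      "K > 0"
    and \<delta>: "\<delta> = (64 + 6 * K) * G / L" "4 * U * \<delta> \<le> 1"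
    and x: "1 \<le> x" "ln x \<le> U * L"
  shows "\<bar>smooth_count x y - W x\<bar> \<le> 2 * (ln x / L) * \<delta> * W x + 1"
    and "\<bar>smooth_count x y - W x\<bar> \<le> W x / 2 + 1"
proof -
  define u where "u = ln x / L"
  have u: "0 \<le> u" "u \<le> U" "ln x = u * L" using x L_pos by (auto simp: u_def field_simps)
  have \<delta>0: "\<delta> \<ge> 0" using \<delta>(1) K(2) G_ge_1 L_pos by simp
  \<comment> \<open>The least number of half-unit steps beyond u = 1. It is at most 2 u, so the
    total relative error is proportional to u.\<close>
  define k where "k = nat \<lceil>2 * (u - 1)\<rceil>"
  have k: "2 * (u - 1) \<le> real k" unfolding k_def by (rule of_nat_ceiling)
  have k2: "real k \<le> 2 * u"
  proof (cases "u \<le> 1")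
    case True
    then have "k = 0" by (simp add: k_def)
    then show ?thesis using u by simp
  next
    case False
    then have "real k = of_int \<lceil>2 * (u - 1)\<rceil>" by (simp add: k_def)
    then show ?thesis using of_int_ceiling_le_add_one[of "2 * (u - 1)"] by simp
  qed
  have kd: "real k * \<delta> \<le> 2 * u * \<delta>" using k2 \<delta>0 by (intro mult_right_mono)
  have uU: "2 * u * \<delta> \<le> 2 * U * \<delta>" using u \<delta>0 by (intro mult_right_mono) auto
  have "ln x \<le> L * (1 + real k / 2)"
  proof -
    have "u \<le> 1 + real k / 2" using k by simp
    then have "L * u \<le> L * (1 + real k / 2)" using L_pos by (intro mult_left_mono) auto
    then show ?thesis using u by (simp add: mult.commute)
  qed
  moreover have "real k * \<delta> \<le> 1" using kd uU \<delta>(2) by linarith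
  ultimately have *: "\<bar>smooth_count x y - W x\<bar> \<le> real k * \<delta> * W x + 1"
    using smooth_count_approx[of K \<delta> k x] K \<delta>(1) x by blast
  have "real k * \<delta> * W x \<le> 2 * u * \<delta> * W x" using mult_right_mono[OF kd, of "W x"] x W_nonneg[of x] by simp
  then show "\<bar>smooth_count x y - W x\<bar> \<le> 2 * (ln x / L) * \<delta> * W x + 1"
    using * unfolding u_def by linarith
  have "2 * u * \<delta> \<le> 1/2" using uU \<delta>(2) by linarith
  then have "2 * u * \<delta> * W x \<le> 1/2 * W x" using x W_nonneg[of x] by (intro mult_right_mono) auto
  then show "\<bar>smooth_count x y - W x\<bar> \<le> W x / 2 + 1"
    using * \<open>real k * \<delta> * W x \<le> 2 * u * \<delta> * W x\<close> by linarith
qed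

text \<open>An integer counted for y but not for z is a multiple of a prime p in (z, y]. The
  multiples of p number at most 3 W(x / p), which is O(G u W(x) / p), and Mertens' theorem sums the
  reciprocals.\<close>

lemma smooth_count_diff_le:
  assumes ub: "\<And>x'. 1 \<le> x' \<Longrightarrow> x' \<le> x \<Longrightarrow> smooth_count x' y \<le> 3 * W x'"
    and x: "1 \<le> x" "ln x \<le> U * L" and z: "2 \<le> z" "sqrt y \<le> z" "z \<le> y"
  shows "smooth_count x y - smooth_count x z \<le> 6 * G * (ln x / L) * W x * ((ln y - ln z + 10) / ln z)"
proof -
  define u where "u = ln x / L"
  define Q where "Q = {p. prime p \<and> z < real p \<and> real p \<le> y}"
  define Q' where "Q' = {p\<in>Q. real p \<le> x}"
  have "Q \<subseteq> {..nat \<lfloor>y\<rfloor>}" unfolding Q_def by (auto simp: le_nat_floor)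
  then have finQ: "finite Q" by (rule finite_subset) simp
  then have finQ': "finite Q'" by (simp add: Q'_def)
  have u0: "0 \<le> u" using x L_pos by (simp add: u_def)
  have "smooth_set x y - smooth_set x z \<subseteq> (\<Union>p\<in>Q'. {n\<in>smooth_set x y. p dvd n})"
  proof
    fix n assume n: "n \<in> smooth_set x y - smooth_set x z"
    then obtain p where p: "prime p" "p dvd n" "z < real p" by (auto simp: smooth_set_def not_le)
    have "p \<le> n" using p(2) n by (intro dvd_imp_le) (auto simp: smooth_set_def)
    then have "real p \<le> x" using n by (simp add: smooth_set_def)
    then show "n \<in> (\<Union>p\<in>Q'. {n\<in>smooth_set x y. p dvd n})"
      using n p by (auto simp: Q_def Q'_def smooth_set_def)
  qed
  then have "card (smooth_set x y - smooth_set x z) \<le> card (\<Union>p\<in>Q'. {n\<in>smooth_set x y. p dvd n})"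
    using finQ' by (intro card_mono) auto
  also have "\<dots> \<le> (\<Sum>p\<in>Q'. card {n\<in>smooth_set x y. p dvd n})" using finQ' by (rule card_UN_le)
  finally have "real (card (smooth_set x y - smooth_set x z)) \<le>
      (\<Sum>p\<in>Q'. real (card {n\<in>smooth_set x y. p dvd n}))"
    by (simp flip: of_nat_sum)
  moreover have "smooth_count x y - smooth_count x z = real (card (smooth_set x y - smooth_set x z))"
    unfolding smooth_count_def using z
    by (subst card_Diff_subset) (auto intro!: smooth_set_mono simp: of_nat_diff card_mono smooth_set_mono)
  ultimately have "smooth_count x y - smooth_count x z \<le>
      (\<Sum>p\<in>Q'. real (card {n\<in>smooth_set x y. p dvd n}))" by simp
  also have "\<dots> \<le> (\<Sum>p\<in>Q'. 6 * G * u * W x * (1 / real p))"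
  proof (intro sum_mono)
    fix p assume p: "p \<in> Q'"
    then have pp: "prime p" "z < real p" "real p \<le> y" "real p \<le> x" by (auto simp: Q'_def Q_def)
    have p1: "real p > 0" using pp z by simp
    have "p \<in> smooth_set x y"
      using pp prime_ge_1_nat[OF pp(1)] primes_dvd_imp_eq[OF _ pp(1)] by (auto simp: smooth_set_def)
    then have "real (card {n\<in>smooth_set x y. p dvd n}) = smooth_count (x / p) y"
      by (simp add: card_smooth_multiples smooth_count_def)
    also have "\<dots> \<le> 3 * W (x / p)"
      using pp p1 x by (intro ub) (auto simp: field_simps)
    also have "W (x / p) \<le> 2 * G * u * W x * (1 / real p)"
    proof (cases "y \<le> x")
      case True
      have "ln y \<le> ln x" using True y by simp
      then have u1: "u \<ge> 1" using L_pos by (simp add: u_def L_def)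
      have "ln p / L \<le> 1" using pp p1 L_pos by (simp add: L_def)
      then have "dickman (u - ln p / L) \<le> dickman (u - 1)"
        using u1 by (intro dickman_antimono) auto
      then have "x / p * dickman (u - ln p / L) \<le> x / p * dickman (u - 1)"
        using x p1 by (intro mult_left_mono) auto
      then have "W (x / p) \<le> (x * dickman (u - 1)) * (1 / p)"
        using x p1 by (simp add: W_def u_def ln_div diff_divide_distrib)
      also have "\<dots> \<le> (G * u * W x) * (1 / p)"
        unfolding u_def using p1 by (intro mult_right_mono W_shift_1 True x) auto
      also have "\<dots> \<le> 2 * (G * u * W x) * (1 / p)"
        using p1 G_ge_1 u0 W_nonneg[of x] x by (intro mult_right_mono) auto
      finally show ?thesis by (simp add: mult_ac)
    next
      \<comment> \<open>For x < y the shift by 1 would leave the domain, but W(x) = x there, and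
        sqrt y \<le> z < p \<le> x gives u \<ge> 1/2, so that the factor 2 G u is at least
        1.\<close>
      case False
      have "sqrt y \<le> x" using pp z by simp
      then have "ln (sqrt y) \<le> ln x" using y by (intro ln_mono) auto
      then have "1/2 \<le> u" using y L_pos by (simp add: u_def L_def ln_sqrt field_simps)
      then have "1 * (1/2) \<le> G * u" using G_ge_1 by (intro mult_mono) auto
      then have "1 \<le> 2 * G * u" by simp
      have "W (x / p) \<le> x / p * 1"
        unfolding W_def using x p1 by (intro mult_left_mono dickman_le_1) auto
      also have "\<dots> = 1 * (W x * (1 / p))" using False x by (simp add: W_le_y)
      also have "\<dots> \<le> (2 * G * u) * (W x * (1 / p))"
        using \<open>1 \<le> 2 * G * u\<close> W_nonneg[of x] x p1 by (intro mult_right_mono) auto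
      finally show ?thesis by (simp add: mult_ac)
    qed
    finally show "real (card {n\<in>smooth_set x y. p dvd n}) \<le> 6 * G * u * W x * (1 / real p)" by simp
  qed
  also have "\<dots> = 6 * G * u * W x * (\<Sum>p\<in>Q'. 1 / real p)" by (simp add: sum_distrib_left)
  also have "\<dots> \<le> 6 * G * u * W x * ((ln y - ln z + 10) / ln z)"
  proof (intro mult_left_mono)
    have "(\<Sum>p\<in>Q'. 1 / real p) \<le> (\<Sum>p\<in>Q. 1 / real p)"
      using finQ by (intro sum_mono2) (auto simp: Q'_def)
    also have "\<dots> \<le> (ln y - ln z + 10) / ln z" unfolding Q_def by (rule sum_inverse_primes_le[OF z(1,3)])
    finally show "(\<Sum>p\<in>Q'. 1 / real p) \<le> (ln y - ln z + 10) / ln z" .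
    show "0 \<le> 6 * G * u * W x" using G_ge_1 u0 W_nonneg[of x] x by auto
  qed
  finally show ?thesis unfolding u_def .
qed

end

text \<open>Collects what is used outside the locale, so that one absolute constant serves all y, U
  and x: the approximation by rho, lower bounds for main term and count, the mean of ln(x / n), and
  the cost of lowering y to z.\<close>

definition smooth_estimates :: "real \<Rightarrow> real \<Rightarrow> real \<Rightarrow> real \<Rightarrow> bool" where
  "smooth_estimates C y U x \<longleftrightarrow>
    \<bar>smooth_count x y - x * dickman (ln x / ln y)\<bar> \<le>
      C * (ln x / ln y * dickman_rate U / ln y) * (x * dickman (ln x / ln y)) + 1 \<and>
    x powr (3/4) \<le> x * dickman (ln x / ln y) \<and>
    x * dickman (ln x / ln y) \<le> 4 * smooth_count x y \<and>
    (\<Sum>n\<in>smooth_set x y. ln (x / n)) \<le> 25 * smooth_count x y \<and>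
    (\<forall>z. 2 \<le> z \<longrightarrow> sqrt y \<le> z \<longrightarrow> z \<le> y \<longrightarrow>
       smooth_count x y - smooth_count x z \<le>
         C * (ln x / ln y * dickman_rate U) * ((ln y - ln z + 10) / ln z) * smooth_count x y)"

lemma smooth_count_estimates:
  "\<exists>C>0. \<forall>y U x. y > 1 \<longrightarrow> U \<ge> 1 \<longrightarrow> C * U * dickman_rate U \<le> ln y \<longrightarrow> 1 \<le> x \<longrightarrow> ln x \<le> U * ln y \<longrightarrow>
    smooth_estimates C y U x"
proof -
  obtain K where K: "K > 0"
    "\<And>T. finite T \<Longrightarrow> (\<forall>d\<in>T. \<not> prime d) \<Longrightarrow> (\<Sum>d\<in>T. mangoldt d * real d powr (-3/4)) \<le> K"
    using sum_mangoldt_proper_powers by blast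
  \<comment> \<open>Four times the numerator of \<open>\<delta>\<close>, so that the assumption on
    \<open>C\<close> is the smallness 4 U \<delta> \<le> 1; it also exceeds the 4 required by the
    locale and the 24 of the last estimate.\<close>
  define C where "C = 4 * (64 + 6 * K)"
  show ?thesis
  proof (intro exI[of _ C] conjI[of "C > 0"] allI impI)
    show "C > 0" using K(1) by (simp add: C_def)
    fix y U x :: real
    assume y: "y > 1" and U: "U \<ge> 1" and CU: "C * U * dickman_rate U \<le> ln y"
      and x1: "1 \<le> x" and xU: "ln x \<le> U * ln y"
    have r1: "dickman_rate U \<ge> 1" using U by (intro dickman_rate_ge_1) simp
    have "4 * 1 \<le> C * U" using K(1) U by (intro mult_mono) (auto simp: C_def)
    then have "4 * dickman_rate U \<le> C * U * dickman_rate U" using r1 by (intro mult_right_mono) auto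
    then interpret smooth_range y U using y U CU by unfold_locales auto
    define \<delta> where "\<delta> = (64 + 6 * K) * G / L"
    have \<delta>C: "4 * \<delta> = C * dickman_rate U / ln y" by (simp add: \<delta>_def C_def G_def L_def)
    have "4 * U * \<delta> = C * U * dickman_rate U / ln y"
      unfolding \<delta>_def C_def G_def L_def by simp
    then have U\<delta>: "4 * U * \<delta> \<le> 1" using CU y by (simp add: divide_le_eq)
    have xU': "ln x \<le> U * L" using xU by (simp add: L_def)
    have Weq: "x * dickman (ln x / ln y) = W x" by (simp add: W_def L_def)
    have ap: "\<bar>smooth_count x' y - W x'\<bar> \<le> 2 * (ln x' / L) * \<delta> * W x' + 1"
        "\<bar>smooth_count x' y - W x'\<bar> \<le> W x' / 2 + 1" if "1 \<le> x'" "ln x' \<le> U * L" for x'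
      using smooth_count_approx_u[of K \<delta> x'] K U\<delta> that by (auto simp: \<delta>_def)
    have lnx': "ln x' \<le> U * L" if "1 \<le> x'" "x' \<le> x" for x'
    proof -
      have "ln x' \<le> ln x" using that by simp
      then show ?thesis using xU' by linarith
    qed
    have ub: "smooth_count x' y \<le> 3 * W x'" if "1 \<le> x'" "x' \<le> x" for x'
      using ap(2)[OF that(1) lnx'[OF that]] W_ge_1[OF that(1) lnx'[OF that]] by linarith
    have "1 \<in> smooth_set x y" using x1 by (auto simp: smooth_set_def)
    then have "card (smooth_set x y) \<ge> 1" by (metis One_nat_def Suc_leI card_gt_0_iff empty_iff finite_smooth_set)
    then have "smooth_count x y \<ge> 1" by (simp add: smooth_count_def)
    \<comment> \<open>The count is at least 1, because 1 is smooth; this absorbs the additive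
      1.\<close>
    then have lb: "W x \<le> 4 * smooth_count x y" using ap(2)[OF x1 xU'] by linarith
    have u0: "0 \<le> ln x / ln y" using x1 y by simp
    have "2 * (ln x / L) * \<delta> * W x \<le> C * (ln x / ln y * dickman_rate U / ln y) * W x"
    proof (intro mult_right_mono W_nonneg)
      have "2 * (ln x / L) * \<delta> \<le> 4 * (ln x / L) * \<delta>"
        using u0 K(1) G_ge_1 L_pos by (intro mult_right_mono) (auto simp: \<delta>_def L_def)
      also have "\<dots> = (ln x / L) * (4 * \<delta>)" by simp
      also have "\<dots> = C * (ln x / ln y * dickman_rate U / ln y)" unfolding \<delta>C by (simp add: L_def)
      finally show "2 * (ln x / L) * \<delta> \<le> C * (ln x / ln y * dickman_rate U / ln y)" .
    qed (use x1 in auto)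
    then show "smooth_estimates C y U x"
      unfolding smooth_estimates_def
    proof (intro conjI allI impI)
      assume "2 * (ln x / L) * \<delta> * W x \<le> C * (ln x / ln y * dickman_rate U / ln y) * W x"
      then show "\<bar>smooth_count x y - x * dickman (ln x / ln y)\<bar> \<le>
        C * (ln x / ln y * dickman_rate U / ln y) * (x * dickman (ln x / ln y)) + 1"
        unfolding Weq using ap(1)[OF x1 xU'] by linarith
      show "x powr (3/4) \<le> x * dickman (ln x / ln y)" unfolding Weq by (rule W_ge_powr[OF x1 xU'])
      show "x * dickman (ln x / ln y) \<le> 4 * smooth_count x y" unfolding Weq by (rule lb)
      show "(\<Sum>n\<in>smooth_set x y. ln (x / n)) \<le> 25 * smooth_count x y"
        using sum_ln_ratio_le[OF x1 xU' ub] lb x1 by simp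
      fix z assume z: "2 \<le> z" "sqrt y \<le> z" "z \<le> y"
      define R where "R = (ln x / ln y * dickman_rate U) * ((ln y - ln z + 10) / ln z)"
      have "ln z \<le> ln y" using z by simp
      then have R0: "R \<ge> 0"
        using u0 r1 z unfolding R_def by (intro mult_nonneg_nonneg divide_nonneg_nonneg[of "_ - _ + _"]) auto
      have "smooth_count x y - smooth_count x z \<le> 6 * R * W x"
        using smooth_count_diff_le[OF ub x1 xU' z] by (simp add: R_def G_def L_def mult_ac)
      also have "\<dots> \<le> 6 * R * (4 * smooth_count x y)" using R0 lb by (intro mult_left_mono) auto
      also have "\<dots> = 24 * (R * smooth_count x y)" by simp
      also have "\<dots> \<le> C * (R * smooth_count x y)"
        using R0 K(1) smooth_count_nonneg by (intro mult_right_mono) (auto simp: C_def)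
      finally show "smooth_count x y - smooth_count x z \<le>
         C * (ln x / ln y * dickman_rate U) * ((ln y - ln z + 10) / ln z) * smooth_count x y"
        by (simp add: R_def mult_ac)
    qed
  qed
qed

section \<open>The resonator\<close>

text \<open>The integers composed of primes in \<open>P\<close> with all exponents at most
  \<open>D\<close>, that is, the frequencies in the expanded product of truncated geometric
  series.\<close>

definition power_box :: "nat set \<Rightarrow> nat \<Rightarrow> nat set" where
  "power_box P D = {m. m > 0 \<and> (\<forall>r. prime r \<longrightarrow> r dvd m \<longrightarrow> r \<in> P) \<and> (\<forall>r\<in>P. \<not> r ^ Suc D dvd m)}"

lemma power_box_empty: "power_box {} D = {1}"
proof -
  have "m = 1" if "m > 0" "\<forall>r. prime r \<longrightarrow> \<not> r dvd m" for m :: nat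
    using that prime_factor_nat[of m] by auto
  moreover have "\<not> r dvd 1" if "prime r" for r :: nat using that by auto
  ultimately show ?thesis unfolding power_box_def by auto
qed

lemma power_box_insert:
  assumes p: "prime p" "p \<notin> P" and P: "\<forall>r\<in>P. prime r"
  shows "power_box (insert p P) D = (\<lambda>(j, m). p ^ j * m) ` ({..D} \<times> power_box P D)"
    and "inj_on (\<lambda>(j, m). p ^ j * m) ({..D} \<times> power_box P D)"
proof -
  have nd: "\<not> p dvd m" if "m \<in> power_box P D" for m
    using that p by (auto simp: power_box_def)
  show "inj_on (\<lambda>(j, m). p ^ j * m) ({..D} \<times> power_box P D)"
  proof (rule inj_onI, clarify)
    fix j m j' m' assume m: "m \<in> power_box P D" "m' \<in> power_box P D" and e: "p ^ j * m = p ^ j' * m'"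
    have p0: "p \<noteq> 0" using p by auto
    have "multiplicity p (p ^ j * m) = j" by (rule multiplicity_decomposeI[OF refl nd[OF m(1)] p0])
    moreover have "multiplicity p (p ^ j' * m') = j'" by (rule multiplicity_decomposeI[OF refl nd[OF m(2)] p0])
    ultimately have "j = j'" using e by simp
    then show "j = j' \<and> m = m'" using e p0 by simp
  qed
  show "power_box (insert p P) D = (\<lambda>(j, m). p ^ j * m) ` ({..D} \<times> power_box P D)"
  proof (intro equalityI subsetI)
    fix m assume m: "m \<in> power_box (insert p P) D"
    then have m0: "m \<noteq> 0" by (simp add: power_box_def)
    obtain m' where m': "m = p ^ multiplicity p m * m'" "\<not> p dvd m'"
      using multiplicity_decompose'[of m p] m0 not_prime_unit[of p] p by blast
    define j where "j = multiplicity p m"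
    have "j \<le> D"
    proof (rule ccontr)
      assume "\<not> j \<le> D"
      then have "p ^ Suc D dvd m" unfolding j_def by (intro multiplicity_dvd') simp
      then show False using m by (simp add: power_box_def)
    qed
    moreover have "m' \<in> power_box P D"
    proof -
      have dv: "m' dvd m" using m'(1) by (metis dvd_triv_right)
      have "m' > 0" using m' m0 by (metis mult_is_0 not_gr_zero)
      moreover have "r \<in> P" if "prime r" "r dvd m'" for r
        using that dvd_trans[OF that(2) dv] m m'(2) by (auto simp: power_box_def)
      moreover have "\<not> r ^ Suc D dvd m'" if "r \<in> P" for r
        using that m dvd_trans[OF _ dv] unfolding power_box_def by blast
      ultimately show ?thesis by (simp add: power_box_def)
    qed
    ultimately show "m \<in> (\<lambda>(j, m). p ^ j * m) ` ({..D} \<times> power_box P D)"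
      using m'(1) j_def by force
  next
    fix m assume "m \<in> (\<lambda>(j, m). p ^ j * m) ` ({..D} \<times> power_box P D)"
    then obtain j m' where j: "j \<le> D" and m': "m' \<in> power_box P D" and m: "m = p ^ j * m'" by auto
    have "m > 0" using m' m p by (simp add: power_box_def prime_gt_0_nat)
    moreover have "r \<in> insert p P" if "prime r" "r dvd m" for r
      using that m' m p prime_dvd_power[of r p j] primes_dvd_imp_eq[of r p]
      by (auto simp: power_box_def prime_dvd_mult_iff)
    moreover have "\<not> r ^ Suc D dvd m" if r: "r \<in> insert p P" for r
    proof
      assume d: "r ^ Suc D dvd m"
      show False
      proof (cases "r = p")
        case True
        have "p ^ Suc D = p ^ j * p ^ (Suc D - j)" using j by (simp flip: power_add)
        then have "p ^ (Suc D - j) dvd m'" using d True m p by (metis dvd_mult_cancel_left nonzero_mult_div_cancel_left not_prime_0 power_not_zero dvd_times_left_cancel_iff)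
        moreover have "p dvd p ^ (Suc D - j)" using j by (intro dvd_power) auto
        ultimately show False using nd[OF m'] dvd_trans by blast
      next
        case False
        then have "r \<in> P" using r by simp
        then have "coprime (r ^ Suc D) (p ^ j)" using P p False by (simp add: primes_coprime)
        then have "r ^ Suc D dvd m'" using d m by (simp add: coprime_dvd_mult_right_iff)
        then show False using m' \<open>r \<in> P\<close> unfolding power_box_def by blast
      qed
    qed
    ultimately show "m \<in> power_box (insert p P) D" by (simp add: power_box_def)
  qed
qed

lemma power_box_finite_card:
  assumes "finite P" "\<forall>r\<in>P. prime r"
  shows "finite (power_box P D) \<and> card (power_box P D) = Suc D ^ card P"
  using assms
proof (induction P rule: finite_induct)
  case empty
  then show ?case by (simp add: power_box_empty)
next
  case (insert p P)
  have p: "prime p" "p \<notin> P" and P: "\<forall>r\<in>P. prime r" using insert by auto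
  have IH: "finite (power_box P D)" "card (power_box P D) = Suc D ^ card P" using insert by auto
  show ?case
    unfolding power_box_insert(1)[OF p P]
    using IH insert(1,2) by (simp add: card_image[OF power_box_insert(2)[OF p P]] card_cartesian_product del: power_Suc)
       (simp add: algebra_simps)
qed

lemma power_box_le:
  assumes "finite P" "\<forall>r\<in>P. prime r" "\<And>r. r \<in> P \<Longrightarrow> real r \<le> Y" "m \<in> power_box P D" "Y \<ge> 1"
  shows "real m \<le> Y ^ (D * card P)"
  using assms(1-4)
proof (induction P arbitrary: m rule: finite_induct)
  case empty
  then show ?case by (simp add: power_box_empty)
next
  case (insert p P)
  have p: "prime p" "p \<notin> P" and P: "\<forall>r\<in>P. prime r" using insert by auto
  obtain j m' where j: "j \<le> D" and m': "m' \<in> power_box P D" "m = p ^ j * m'"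
    using insert.prems(3) unfolding power_box_insert(1)[OF p P] by auto
  have "real m = real p ^ j * real m'" using m' by simp
  also have "\<dots> \<le> Y ^ D * Y ^ (D * card P)"
  proof (intro mult_mono)
    have "real p ^ j \<le> Y ^ j" using insert.prems by (intro power_mono) auto
    also have "\<dots> \<le> Y ^ D" using j assms(5) by (intro power_increasing) auto
    finally show "real p ^ j \<le> Y ^ D" .
    show "real m' \<le> Y ^ (D * card P)" using insert m' by auto
  qed (use assms(5) in auto)
  also have "\<dots> = Y ^ (D * card (insert p P))" using insert by (simp add: power_add algebra_simps)
  finally show ?case .
qed

text \<open>The sum over the exponents of p is a finite geometric series, and f(p) - 1 telescopes
  it.\<close>

lemma sum_power_box_insert:
  fixes f :: "nat \<Rightarrow> complex"
  assumes p: "prime p" "p \<notin> P" and P: "\<forall>r\<in>P. prime r"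
    and f: "f 1 = 1" "\<And>a b. a > 0 \<Longrightarrow> b > 0 \<Longrightarrow> f (a * b) = f a * f b"
  shows "(f p - 1) * (\<Sum>m\<in>power_box (insert p P) D. f m) = (f p ^ Suc D - 1) * (\<Sum>m\<in>power_box P D. f m)"
proof -
  have p0: "p > 0" using p by (simp add: prime_gt_0_nat)
  have fp: "f (p ^ j) = f p ^ j" for j
    by (induction j) (use f p0 in auto)
  have "(\<Sum>m\<in>power_box (insert p P) D. f m) = (\<Sum>(j, m)\<in>{..D} \<times> power_box P D. f (p ^ j * m))"
    unfolding power_box_insert(1)[OF p P]
    by (subst sum.reindex[OF power_box_insert(2)[OF p P]]) (simp add: case_prod_unfold)
  also have "\<dots> = (\<Sum>j\<le>D. \<Sum>m\<in>power_box P D. f (p ^ j * m))"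
    by (rule sum.cartesian_product[symmetric])
  also have "\<dots> = (\<Sum>j\<le>D. \<Sum>m\<in>power_box P D. f p ^ j * f m)"
    using f p0 fp by (intro sum.cong refl) (auto simp: power_box_def)
  also have "\<dots> = (\<Sum>j\<le>D. f p ^ j) * (\<Sum>m\<in>power_box P D. f m)"
    by (simp add: sum_product)
  finally have e: "(\<Sum>m\<in>power_box (insert p P) D. f m) = (\<Sum>j\<le>D. f p ^ j) * (\<Sum>m\<in>power_box P D. f m)" .
  have "(f p - 1) * (\<Sum>j\<le>D. f p ^ j) = f p ^ Suc D - 1"
    using sum_gp_basic[of "f p" D] by (simp add: algebra_simps)
  then show ?thesis unfolding e by (simp only: mult.assoc[symmetric])
qed

text \<open>Strip off one prime at a time: f(p m) - 1 = f(p) (f(m) - 1) + (f(p) - 1), where the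
  factor f(p) does not increase the norm.\<close>

lemma completely_multiplicative_near_1:
  fixes f :: "nat \<Rightarrow> complex"
  assumes P: "finite P"
    and f: "f 1 = 1" "\<And>a b. a > 0 \<Longrightarrow> b > 0 \<Longrightarrow> f (a * b) = f a * f b" "\<And>p. p \<in> P \<Longrightarrow> norm (f p) \<le> 1"
    and n: "n > 0" "\<And>p. prime p \<Longrightarrow> p dvd n \<Longrightarrow> p \<in> P"
  shows "norm (f n - 1) \<le> (\<Sum>p\<in>P. real (multiplicity p n) * norm (f p - 1))"
  using n
proof (induction n rule: less_induct)
  case (less n)
  show ?case
  proof (cases "n = 1")
    case True
    then show ?thesis using f(1) by (simp add: sum_nonneg)
  next
    case False
    then obtain p where p: "prime p" "p dvd n" using prime_factor_nat by blast
    then obtain m where m: "n = p * m" by blast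
    have pP: "p \<in> P" using less.prems p by blast
    have m0: "m > 0" using m less.prems by (cases m) auto
    have p0: "p > 0" using p by (simp add: prime_gt_0_nat)
    have "m < n" using m m0 prime_gt_1_nat[OF p(1)] by simp
    then have IH: "norm (f m - 1) \<le> (\<Sum>p\<in>P. real (multiplicity p m) * norm (f p - 1))"
      using less.prems m m0 by (intro less.IH) auto
    have "norm (f n - 1) = norm (f p * (f m - 1) + (f p - 1))"
      unfolding m using f(2)[OF p0 m0] by (simp add: algebra_simps)
    also have "\<dots> \<le> norm (f p) * norm (f m - 1) + norm (f p - 1)"
      by (metis norm_mult norm_triangle_ineq)
    also have "\<dots> \<le> 1 * norm (f m - 1) + norm (f p - 1)"
      using f(3)[OF pP] by (intro add_right_mono mult_right_mono) auto
    also have "\<dots> \<le> (\<Sum>r\<in>P. real (multiplicity r m) * norm (f r - 1)) + (\<Sum>r\<in>P. if r = p then norm (f r - 1) else 0)"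
      using IH P pP by (simp add: sum.delta)
    also have "\<dots> = (\<Sum>r\<in>P. real (multiplicity r m) * norm (f r - 1) + (if r = p then norm (f r - 1) else 0))"
      by (simp add: sum.distrib)
    also have "\<dots> \<le> (\<Sum>r\<in>P. real (multiplicity r n) * norm (f r - 1))"
    proof (intro sum_mono)
      fix r assume "r \<in> P"
      have "multiplicity p n = Suc (multiplicity p m)"
        unfolding m using m0 p by (intro multiplicity_times_same) auto
      moreover have "multiplicity r m \<le> multiplicity r n"
        unfolding m using m0 p0 by (intro dvd_imp_multiplicity_le) auto
      then have "real (multiplicity r m) * norm (f r - 1) \<le> real (multiplicity r n) * norm (f r - 1)"
        by (intro mult_right_mono) auto
      ultimately show "real (multiplicity r m) * norm (f r - 1) + (if r = p then norm (f r - 1) else 0)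
          \<le> real (multiplicity r n) * norm (f r - 1)"
        by (auto simp: algebra_simps)
    qed
    finally show ?thesis .
  qed
qed

text \<open>Each prime factor is at least 2, so 2 to the number of factors is at most n; the
  constant 2 comes from ln 2 \<ge> 1/2.\<close>

lemma sum_multiplicity_le_ln:
  fixes n :: nat
  assumes P: "finite P" "\<And>p. p \<in> P \<Longrightarrow> prime p" and n: "n > 0"
  shows "(\<Sum>p\<in>P. real (multiplicity p n)) \<le> 2 * ln n"
proof -
  have "(\<Prod>p\<in>P. p ^ multiplicity p n) = (\<Prod>p\<in>P \<inter> prime_factors n. p ^ multiplicity p n)"
  proof (intro prod.mono_neutral_right ballI)
    fix p assume p: "p \<in> P - P \<inter> prime_factors n"
    then have "\<not> p dvd n" using P n by (auto simp: in_prime_factors_iff)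
    then show "p ^ multiplicity p n = 1" by (simp add: not_dvd_imp_multiplicity_0)
  qed (use P in auto)
  also have "\<dots> dvd (\<Prod>p\<in>prime_factors n. p ^ multiplicity p n)"
    by (rule prod_dvd_prod_subset) auto
  also have "\<dots> = n" using prime_factorization_nat[OF n] by simp
  finally have "(\<Prod>p\<in>P. p ^ multiplicity p n) dvd n" .
  then have "(\<Prod>p\<in>P. p ^ multiplicity p n) \<le> n" using n by (intro dvd_imp_le) auto
  have "(2::nat) ^ (\<Sum>p\<in>P. multiplicity p n) = (\<Prod>p\<in>P. 2 ^ multiplicity p n)" by (rule power_sum)
  also have "\<dots> \<le> (\<Prod>p\<in>P. p ^ multiplicity p n)"
    using P prime_ge_2_nat by (intro prod_mono) (auto intro: power_mono)
  also have "\<dots> \<le> n" by fact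
  finally have "(2::real) ^ (\<Sum>p\<in>P. multiplicity p n) \<le> real n"
    by (metis of_nat_le_iff of_nat_numeral of_nat_power)
  then have "ln ((2::real) ^ (\<Sum>p\<in>P. multiplicity p n)) \<le> ln n" using n by (intro ln_mono) auto
  then have "real (\<Sum>p\<in>P. multiplicity p n) * ln 2 \<le> ln n" by (simp add: ln_realpow)
  moreover have "real (\<Sum>p\<in>P. multiplicity p n) * (1/2) \<le> real (\<Sum>p\<in>P. multiplicity p n) * ln 2"
    using ln2_ge_two_thirds by (intro mult_left_mono) (simp_all add: sum_nonneg del: of_nat_sum)
  ultimately show ?thesis by simp
qed

section \<open>Weighted second moments over the characters\<close>

lemma dirichlet_second_moment_inj:
  assumes q: "q > 0" and g: "inj_on g I" "finite I" "\<And>i. i \<in> I \<Longrightarrow> g i < q \<and> coprime (g i) q"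
  shows "(\<Sum>X | dirichlet_character q X. (norm (\<Sum>i\<in>I. c i * X (g i)))\<^sup>2) =
    totient q * (\<Sum>i\<in>I. (norm (c i))\<^sup>2)"
proof -
  define c' where "c' m = c (inv_into I g m)" for m
  have c': "c' (g i) = c i" if "i \<in> I" for i using that g(1) by (simp add: c'_def)
  have "(\<Sum>X | dirichlet_character q X. (norm (\<Sum>i\<in>I. c i * X (g i)))\<^sup>2) =
    (\<Sum>X | dirichlet_character q X. (norm (\<Sum>m\<in>g ` I. c' m * X m))\<^sup>2)"
    using c' by (simp add: sum.reindex[OF g(1)])
  also have "\<dots> = totient q * (\<Sum>m\<in>g ` I. (norm (c' m))\<^sup>2)"
    using g(2,3) by (intro dirichlet_second_moment[OF q]) auto
  also have "(\<Sum>m\<in>g ` I. (norm (c' m))\<^sup>2) = (\<Sum>i\<in>I. (norm (c i))\<^sup>2)"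
    using c' by (simp add: sum.reindex[OF g(1)])
  finally show ?thesis .
qed

text \<open>Given in expanded form, to which orthogonality applies directly; the product structure
  is recovered one prime at a time by \<open>sum_power_box_insert\<close>.\<close>

definition resonator :: "nat set \<Rightarrow> nat \<Rightarrow> (nat \<Rightarrow> complex) \<Rightarrow> (nat \<Rightarrow> complex) \<Rightarrow> complex" where
  "resonator P D h X = (\<Sum>m\<in>power_box P D. h m * X m)"

definition rough_set :: "nat \<Rightarrow> real \<Rightarrow> real \<Rightarrow> nat set" where
  "rough_set q x z = {n. 1 \<le> n \<and> real n \<le> x \<and> coprime n q \<and> (\<exists>p. prime p \<and> p dvd n \<and> z < real p)}"

lemma weighted_cauchy_schwarz:
  fixes a c :: "'a \<Rightarrow> real"
  assumes "\<And>i. i \<in> I \<Longrightarrow> c i \<ge> 0"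
  shows "(\<Sum>i\<in>I. c i * a i)\<^sup>2 \<le> (\<Sum>i\<in>I. c i) * (\<Sum>i\<in>I. c i * (a i)\<^sup>2)"
proof -
  have "(\<Sum>i\<in>I. c i * a i) = (\<Sum>i\<in>I. sqrt (c i) * (sqrt (c i) * a i))"
    using assms by (intro sum.cong) (auto simp flip: mult.assoc)
  then have "(\<Sum>i\<in>I. c i * a i)\<^sup>2 \<le> (\<Sum>i\<in>I. (sqrt (c i))\<^sup>2) * (\<Sum>i\<in>I. (sqrt (c i) * a i)\<^sup>2)"
    using Cauchy_Schwarz_ineq_sum[of "\<lambda>i. sqrt (c i)" "\<lambda>i. sqrt (c i) * a i" I] by simp
  also have "\<dots> = (\<Sum>i\<in>I. c i) * (\<Sum>i\<in>I. c i * (a i)\<^sup>2)"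
    using assms by (auto intro!: arg_cong2[of _ _ _ _ "(*)"] sum.cong simp: power_mult_distrib)
  finally show ?thesis .
qed

lemma norm_resonator_le:
  assumes h: "\<And>n. n > 0 \<Longrightarrow> norm (h n) = 1" and X: "dirichlet_character q X" and q: "q > 0"
    and P: "finite P" "\<forall>r\<in>P. prime r"
  shows "norm (resonator P D h X) \<le> card (power_box P D)"
proof -
  have "norm (X m) \<le> 1" for m by (rule norm_dirichlet_character_le_1[OF X q])
  then have "norm (resonator P D h X) \<le> (\<Sum>m\<in>power_box P D. 1)"
    unfolding resonator_def using h
    by (intro order_trans[OF norm_sum] sum_mono) (auto simp: norm_mult power_box_def)
  then show ?thesis by simp
qed

text \<open>\<open>h\<close> plays the role of n^(-it), through complete multiplicativity and
  modulus 1. The condition \<open>small\<close> keeps below q not only the box but also its products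
  with primes up to x.\<close>

context
  fixes q :: nat and P :: "nat set" and D :: nat and h :: "nat \<Rightarrow> complex" and x z :: real
  assumes q: "q > 1" and z: "z \<ge> 1" and x: "x \<ge> 1"
    and P_def: "P = {p. prime p \<and> real p \<le> z \<and> \<not> p dvd q}"
    and h1: "h 1 = 1" and hm: "\<And>a b. a > 0 \<Longrightarrow> b > 0 \<Longrightarrow> h (a * b) = h a * h b"
    and hn: "\<And>n. n > 0 \<Longrightarrow> norm (h n) = 1"
    and small: "\<And>m. m \<in> power_box P D \<Longrightarrow> real m * x < real q"
begin

private lemma finP: "finite P" and primeP: "\<forall>r\<in>P. prime r"
proof -
  have "P \<subseteq> {..nat \<lfloor>z\<rfloor>}" unfolding P_def by (auto simp: le_nat_floor)
  then show "finite P" by (rule finite_subset) simp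
  show "\<forall>r\<in>P. prime r" by (simp add: P_def)
qed

private lemma box:
  assumes "m \<in> power_box P D"
  shows "m > 0" "coprime m q" "m < q"
proof -
  show m0: "m > 0" using assms by (simp add: power_box_def)
  show "coprime m q"
  proof (rule ccontr)
    assume "\<not> coprime m q"
    then have "gcd m q \<noteq> 1" by (metis coprime_iff_gcd_eq_1)
    then obtain p where "prime p" "p dvd gcd m q" using prime_factor_nat by blast
    then show False using assms by (auto simp: power_box_def P_def)
  qed
  have "real m * 1 \<le> real m * x" using x by (intro mult_left_mono) auto
  then have "real m < real q" using small[OF assms] by linarith
  then show "m < q" by simp
qed

private lemma total_weight:
  "(\<Sum>X | dirichlet_character q X. (norm (resonator P D h X))\<^sup>2) = totient q * card (power_box P D)"
proof -
  have "(\<Sum>X | dirichlet_character q X. (norm (resonator P D h X))\<^sup>2) =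
     totient q * (\<Sum>m\<in>power_box P D. (norm (h m))\<^sup>2)"
    unfolding resonator_def using q box power_box_finite_card[OF finP primeP]
    by (intro dirichlet_second_moment) auto
  then show ?thesis using hn box by simp
qed

text \<open>Multiplied by f(p) - 1, the resonator becomes the resonator without p times f(p)^(D+1) -
  1, of norm at most 2. The smaller box has D + 1 times fewer elements, hence the gain.\<close>

private lemma prime_deviation:
  assumes p: "p \<in> P"
  shows "(\<Sum>X | dirichlet_character q X. (norm (resonator P D h X))\<^sup>2 * (norm (h p * X p - 1))\<^sup>2)
    \<le> 4 * totient q * card (power_box P D) / Suc D"
proof -
  let ?C = "{X. dirichlet_character q X}"
  define P' where "P' = P - {p}"
  have P': "P = insert p P'" "p \<notin> P'" "prime p" "\<forall>r\<in>P'. prime r" "finite P'" "card P = Suc (card P')"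
    using p primeP finP card_Suc_Diff1[OF finP p] by (auto simp: P'_def simp del: card_Diff_insert)
  have sub: "power_box P' D \<subseteq> power_box P D"
    unfolding P'(1) power_box_insert(1)[OF P'(3,2,4)] by force
  have "(\<Sum>X\<in>?C. (norm (resonator P D h X))\<^sup>2 * (norm (h p * X p - 1))\<^sup>2)
     \<le> (\<Sum>X\<in>?C. 4 * (norm (resonator P' D h X))\<^sup>2)"
  proof (intro sum_mono)
    fix X assume "X \<in> ?C"
    then have X: "dirichlet_character q X" by simp
    define f where "f n = h n * X n" for n
    have f1: "f 1 = 1" using h1 dirichlet_character_1[OF X] by (simp add: f_def)
    have fm: "f (a * b) = f a * f b" if "a > 0" "b > 0" for a b
      using hm[OF that] dirichlet_character_mult[OF X] by (simp add: f_def)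
    have p0: "p > 0" using P' by (simp add: prime_gt_0_nat)
    have "norm (X p) \<le> 1" using norm_dirichlet_character_le_1[OF X] q by simp
    then have nf: "norm (f p) \<le> 1" using hn[OF p0] by (simp add: f_def norm_mult)
    have "norm (f p ^ Suc D - 1) \<le> norm (f p ^ Suc D) + 1"
      by (metis norm_one norm_triangle_ineq4)
    also have "\<dots> \<le> 2" using nf by (simp only: norm_power) (simp add: power_le_one del: power_Suc)
    finally have n2: "norm (f p ^ Suc D - 1) \<le> 2" .
    have "norm (resonator P D h X) * norm (h p * X p - 1) = norm ((f p - 1) * (\<Sum>m\<in>power_box (insert p P') D. f m))"
      by (simp add: resonator_def f_def P'(1) norm_mult mult.commute)
    also have "(f p - 1) * (\<Sum>m\<in>power_box (insert p P') D. f m) =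
        (f p ^ Suc D - 1) * (\<Sum>m\<in>power_box P' D. f m)"
      by (rule sum_power_box_insert[OF P'(3,2,4), where f = f]) (use f1 fm in auto)
    also have "norm \<dots> = norm (f p ^ Suc D - 1) * norm (resonator P' D h X)"
      by (simp only: norm_mult resonator_def f_def)
    also have "\<dots> \<le> 2 * norm (resonator P' D h X)" using n2 by (intro mult_right_mono) auto
    finally have "(norm (resonator P D h X) * norm (h p * X p - 1))\<^sup>2 \<le> (2 * norm (resonator P' D h X))\<^sup>2"
      by (intro power_mono) auto
    then show "(norm (resonator P D h X))\<^sup>2 * (norm (h p * X p - 1))\<^sup>2 \<le> 4 * (norm (resonator P' D h X))\<^sup>2"
      by (simp add: power_mult_distrib)
  qed
  also have "\<dots> = 4 * (totient q * (\<Sum>m\<in>power_box P' D. (norm (h m))\<^sup>2))"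
    unfolding sum_distrib_left[symmetric] resonator_def
    using q box sub power_box_finite_card[OF P'(5,4)]
    by (subst dirichlet_second_moment) auto
  also have "(\<Sum>m\<in>power_box P' D. (norm (h m))\<^sup>2) = card (power_box P' D)"
    using hn box sub by (subst sum.cong[of _ "power_box P' D" _ "\<lambda>_. 1"]) auto
  also have "real (card (power_box P' D)) = card (power_box P D) / Suc D"
  proof -
    have "card (power_box P D) = Suc D * card (power_box P' D)"
      using power_box_finite_card[OF P'(5,4), of D] power_box_finite_card[OF finP primeP, of D] P'(6)
      by simp
    then show ?thesis by (simp only: of_nat_mult) simp
  qed
  finally show ?thesis by simp
qed

text \<open>The deviation of a product is at most the sum of the deviations of its primes.
  Cauchy-Schwarz with the multiplicities as weights then leaves only mean squares at single
  primes.\<close>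

private lemma smooth_part:
  assumes S: "S \<subseteq> {n. 1 \<le> n \<and> real n \<le> x \<and> coprime n q \<and> (\<forall>p. prime p \<and> p dvd n \<longrightarrow> real p \<le> z)}"
  shows "(\<Sum>X | dirichlet_character q X. (norm (resonator P D h X))\<^sup>2 * (\<Sum>n\<in>S. norm (h n * X n - 1))\<^sup>2)
    \<le> totient q * card (power_box P D) * (4 * ln x * card S / sqrt (Suc D))\<^sup>2"
proof -
  let ?C = "{X. dirichlet_character q X}"
  \<comment> \<open>The number of occurrences of p in all of \<open>S\<close>; these weights have
    total at most 2 ln x times the size of \<open>S\<close>.\<close>
  define c where "c p = (\<Sum>n\<in>S. real (multiplicity p n))" for p
  have c0: "c p \<ge> 0" for p by (simp add: c_def sum_nonneg)
  define T where "T = (\<Sum>p\<in>P. c p)"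
  have Tle: "T \<le> 2 * ln x * card S"
  proof -
    have "T = (\<Sum>n\<in>S. \<Sum>p\<in>P. real (multiplicity p n))" unfolding T_def c_def by (rule sum.swap)
    also have "\<dots> \<le> (\<Sum>n\<in>S. 2 * ln x)"
    proof (intro sum_mono)
      fix n assume "n \<in> S"
      then have n: "n > 0" "real n \<le> x" using S by auto
      have "(\<Sum>p\<in>P. real (multiplicity p n)) \<le> 2 * ln n"
        using finP primeP n by (intro sum_multiplicity_le_ln) auto
      also have "\<dots> \<le> 2 * ln x" using n x by simp
      finally show "(\<Sum>p\<in>P. real (multiplicity p n)) \<le> 2 * ln x" .
    qed
    finally show ?thesis by (simp add: mult_ac)
  qed
  have T0: "T \<ge> 0" unfolding T_def by (intro sum_nonneg c0)
  have "(\<Sum>X\<in>?C. (norm (resonator P D h X))\<^sup>2 * (\<Sum>n\<in>S. norm (h n * X n - 1))\<^sup>2)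
    \<le> (\<Sum>X\<in>?C. \<Sum>p\<in>P. T * c p * ((norm (resonator P D h X))\<^sup>2 * (norm (h p * X p - 1))\<^sup>2))"
  proof (intro sum_mono)
    fix X assume "X \<in> ?C"
    then have X: "dirichlet_character q X" by simp
    define f where "f n = h n * X n" for n
    have f1: "f 1 = 1" using h1 dirichlet_character_1[OF X] by (simp add: f_def)
    have fm: "f (a * b) = f a * f b" if "a > 0" "b > 0" for a b
      using hm[OF that] dirichlet_character_mult[OF X] by (simp add: f_def)
    have nf: "norm (f p) \<le> 1" if "p \<in> P" for p
    proof -
      have "norm (X p) \<le> 1" using norm_dirichlet_character_le_1[OF X] q by simp
      moreover have "p > 0" using that primeP by (auto simp: prime_gt_0_nat)
      ultimately show ?thesis using hn by (simp add: f_def norm_mult)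
    qed
    have "(\<Sum>n\<in>S. norm (f n - 1)) \<le> (\<Sum>n\<in>S. \<Sum>p\<in>P. real (multiplicity p n) * norm (f p - 1))"
    proof (intro sum_mono)
      fix n assume n: "n \<in> S"
      have "p \<in> P" if "prime p" "p dvd n" for p
      proof -
        have "coprime p q" using n that S coprime_divisors[of p n q q] by auto
        then have "\<not> p dvd q" using that(1) by (metis coprime_absorb_left not_prime_unit)
        then show ?thesis using n that S by (auto simp: P_def)
      qed
      then show "norm (f n - 1) \<le> (\<Sum>p\<in>P. real (multiplicity p n) * norm (f p - 1))"
        using n S by (intro completely_multiplicative_near_1 finP f1 fm nf) auto
    qed
    also have "\<dots> = (\<Sum>p\<in>P. c p * norm (f p - 1))"
      unfolding c_def by (subst sum.swap) (simp add: sum_distrib_right)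
    finally have "(\<Sum>n\<in>S. norm (f n - 1))\<^sup>2 \<le> (\<Sum>p\<in>P. c p * norm (f p - 1))\<^sup>2"
      by (intro power_mono sum_nonneg) auto
    also have "\<dots> \<le> T * (\<Sum>p\<in>P. c p * (norm (f p - 1))\<^sup>2)"
      unfolding T_def by (rule weighted_cauchy_schwarz[OF c0])
    finally have "(norm (resonator P D h X))\<^sup>2 * (\<Sum>n\<in>S. norm (f n - 1))\<^sup>2 \<le>
       (norm (resonator P D h X))\<^sup>2 * (T * (\<Sum>p\<in>P. c p * (norm (f p - 1))\<^sup>2))"
      by (intro mult_left_mono) auto
    then show "(norm (resonator P D h X))\<^sup>2 * (\<Sum>n\<in>S. norm (h n * X n - 1))\<^sup>2 \<le>
       (\<Sum>p\<in>P. T * c p * ((norm (resonator P D h X))\<^sup>2 * (norm (h p * X p - 1))\<^sup>2))"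
      by (simp add: f_def sum_distrib_left mult_ac)
  qed
  also have "\<dots> = (\<Sum>p\<in>P. T * c p * (\<Sum>X\<in>?C. (norm (resonator P D h X))\<^sup>2 * (norm (h p * X p - 1))\<^sup>2))"
    by (subst sum.swap) (simp add: sum_distrib_left)
  also have "\<dots> \<le> (\<Sum>p\<in>P. T * c p * (4 * totient q * card (power_box P D) / Suc D))"
    using T0 c0 by (intro sum_mono mult_left_mono prime_deviation) auto
  also have "\<dots> = T * T * (4 * totient q * card (power_box P D) / Suc D)"
  proof -
    have "(\<Sum>p\<in>P. T * c p * E) = T * (\<Sum>p\<in>P. c p) * E" for E
      by (simp add: sum_distrib_left sum_distrib_right)
    then show ?thesis unfolding T_def[symmetric] .
  qed
  also have "\<dots> \<le> (2 * ln x * card S) * (2 * ln x * card S) * (4 * totient q * card (power_box P D) / Suc D)"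
    using Tle T0 x by (intro mult_right_mono mult_mono) auto
  also have "\<dots> = totient q * card (power_box P D) * (4 * ln x * card S / sqrt (Suc D))\<^sup>2"
    by (simp add: power2_eq_square field_simps)
  finally show ?thesis .
qed

text \<open>Products of a box element with a rough integer may coincide, so n is written as b p with
  p its largest prime. For fixed b the products m p are distinct, since p > z does not divide m, and
  the second moment is exact. Cauchy-Schwarz over the at most x / z values of b gives the factor x /
  z.\<close>

private lemma rough_part:
  "(\<Sum>X | dirichlet_character q X. (norm (resonator P D h X))\<^sup>2 * (norm (\<Sum>n\<in>rough_set q x z. X n))\<^sup>2)
    \<le> totient q * card (power_box P D) * (x / sqrt z)\<^sup>2"
proof -
  let ?C = "{X. dirichlet_character q X}"
  let ?R = "rough_set q x z"
  have subR: "?R \<subseteq> {1..nat \<lfloor>x\<rfloor>}" unfolding rough_set_def using le_nat_floor_iff by auto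
  then have finR: "finite ?R" by (rule finite_subset) simp
  have cardR: "real (card ?R) \<le> x"
    using card_mono[OF _ subR] x by simp linarith
  define gp where "gp n = Max (prime_factors n)" for n :: nat
  have gp: "prime (gp n)" "gp n dvd n" "z < real (gp n)" if n: "n \<in> ?R" for n
  proof -
    obtain p where p: "prime p" "p dvd n" "z < real p" and n0: "n > 0" using n by (auto simp: rough_set_def)
    then have pf: "p \<in> prime_factors n" by (simp add: in_prime_factors_iff)
    then have "gp n \<in> prime_factors n" unfolding gp_def by (intro Max_in) auto
    then show "prime (gp n)" "gp n dvd n" by (auto simp: in_prime_factors_iff)
    have "p \<le> gp n" unfolding gp_def using pf by (intro Max_ge) auto
    then show "z < real (gp n)" using p(3) by linarith
  qed
  define B where "B = {1..nat \<lfloor>x / z\<rfloor>}"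
  \<comment> \<open>Requiring p to be the largest prime of b p makes the representation unique, so
    the sizes of the sets \<open>A b\<close> add up to at most x.\<close>
  define A where "A b = {p. prime p \<and> b * p \<in> ?R \<and> gp (b * p) = p}" for b
  have cardB: "real (card B) \<le> x / z" unfolding B_def using x z by simp
  have finA: "finite (A b)" if "b \<in> B" for b
  proof (rule finite_subset)
    show "A b \<subseteq> {..nat \<lfloor>x\<rfloor>}"
    proof
      fix p assume p: "p \<in> A b"
      then have "b * p \<le> nat \<lfloor>x\<rfloor>" using subR by (auto simp: A_def)
      moreover have "p \<le> b * p" using that by (simp add: B_def)
      ultimately show "p \<in> {..nat \<lfloor>x\<rfloor>}" by (metis atMost_iff order_trans)
    qed
  qed simp
  have Aprop: "prime p" "z < real p" "real p \<le> x" "coprime p q" if "b \<in> B" "p \<in> A b" for b p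
  proof -
    have bp: "b * p \<in> ?R" "gp (b * p) = p" "prime p" using that by (auto simp: A_def)
    have r: "real (b * p) \<le> x" "coprime (b * p) q" using bp(1) unfolding rough_set_def by blast+
    show "prime p" by fact
    show "z < real p" using gp(3)[OF bp(1)] bp(2) by simp
    have "p \<le> b * p" using that by (simp add: B_def)
    then have "real p \<le> real (b * p)" by (rule of_nat_mono)
    then show "real p \<le> x" using r(1) by linarith
    show "coprime p q" using r(2) by simp
  qed
  have img: "bij_betw (\<lambda>(b, p). b * p) (Sigma B A) ?R"
  proof (rule bij_betw_byWitness[where f' = "\<lambda>n. (n div gp n, gp n)"])
    show "\<forall>a\<in>Sigma B A. (\<lambda>n. (n div gp n, gp n)) (case a of (b, p) \<Rightarrow> b * p) = a"
      by (auto simp: A_def dest: prime_gt_0_nat)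
    show "\<forall>n\<in>?R. (case (n div gp n, gp n) of (b, p) \<Rightarrow> b * p) = n" using gp(2) by simp
    show "(\<lambda>(b, p). b * p) ` Sigma B A \<subseteq> ?R" by (auto simp: A_def)
    show "(\<lambda>n. (n div gp n, gp n)) ` ?R \<subseteq> Sigma B A"
    proof
      fix a assume "a \<in> (\<lambda>n. (n div gp n, gp n)) ` ?R"
      then obtain n where n: "n \<in> ?R" "a = (n div gp n, gp n)" by blast
      have e: "n div gp n * gp n = n" using gp(2)[OF n(1)] by simp
      have n1: "1 \<le> n" "real n \<le> x" using n(1) by (auto simp: rough_set_def)
      have b1: "1 \<le> n div gp n" using e n1 by (cases "n div gp n") auto
      have "real (n div gp n) * z \<le> real (n div gp n) * real (gp n)"
        using gp(3)[OF n(1)] by (intro mult_left_mono) auto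
      also have "\<dots> = real n" using e by (metis of_nat_mult)
      also have "\<dots> \<le> x" by (rule n1)
      finally have "real (n div gp n) \<le> x / z" using z by (simp add: field_simps)
      then have "n div gp n \<in> B" unfolding B_def using b1 le_nat_floor by simp
      moreover have "gp n \<in> A (n div gp n)" unfolding A_def using gp[OF n(1)] e n(1) by simp
      ultimately show "a \<in> Sigma B A" using n(2) by simp
    qed
  qed
  have split: "(\<Sum>n\<in>?R. X n) = (\<Sum>b\<in>B. X b * (\<Sum>p\<in>A b. X p))" if X: "dirichlet_character q X" for X
  proof -
    have "(\<Sum>n\<in>?R. X n) = (\<Sum>(b, p)\<in>Sigma B A. X (b * p))"
      using sum.reindex_bij_betw[OF img, of X] by (simp add: case_prod_unfold)
    also have "\<dots> = (\<Sum>b\<in>B. \<Sum>p\<in>A b. X (b * p))"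
      using finA by (intro sum.Sigma[symmetric]) (auto simp: B_def)
    finally show ?thesis by (simp add: dirichlet_character_mult[OF X] sum_distrib_left)
  qed
  have fixed: "(\<Sum>X\<in>?C. (norm (resonator P D h X * (\<Sum>p\<in>A b. X p)))\<^sup>2) =
      totient q * (card (power_box P D) * card (A b))" if b: "b \<in> B" for b
  proof -
    have inj: "inj_on (\<lambda>(m, p). m * p) (power_box P D \<times> A b)"
    proof (rule inj_onI, clarify)
      fix m p m' p' assume a: "m \<in> power_box P D" "m' \<in> power_box P D" "p \<in> A b" "p' \<in> A b" "m * p = m' * p'"
      have "p dvd m' * p'" using a(5) by (metis dvd_triv_right)
      moreover have "\<not> p dvd m'"
        using a(2) Aprop(1,2)[OF b a(3)] by (auto simp: power_box_def P_def)
      ultimately have "p dvd p'" using Aprop(1)[OF b a(3)] by (simp add: prime_dvd_mult_iff)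
      then have "p = p'" using Aprop(1)[OF b a(3)] Aprop(1)[OF b a(4)] primes_dvd_imp_eq by blast
      moreover have "p > 0" using Aprop(1)[OF b a(3)] by (simp add: prime_gt_0_nat)
      ultimately show "m = m' \<and> p = p'" using a(5) by simp
    qed
    have "(\<Sum>X\<in>?C. (norm (resonator P D h X * (\<Sum>p\<in>A b. X p)))\<^sup>2) =
       (\<Sum>X\<in>?C. (norm (\<Sum>i\<in>power_box P D \<times> A b. h (fst i) * X ((\<lambda>(m, p). m * p) i)))\<^sup>2)"
    proof (intro sum.cong refl)
      fix X assume "X \<in> ?C"
      then have X: "dirichlet_character q X" by simp
      have "resonator P D h X * (\<Sum>p\<in>A b. X p) =
          (\<Sum>m\<in>power_box P D. \<Sum>p\<in>A b. h m * X m * X p)"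
        by (simp add: resonator_def sum_product)
      also have "\<dots> = (\<Sum>(m, p)\<in>power_box P D \<times> A b. h m * X m * X p)"
        by (rule sum.cartesian_product)
      also have "\<dots> = (\<Sum>i\<in>power_box P D \<times> A b. h (fst i) * X ((\<lambda>(m, p). m * p) i))"
        by (intro sum.cong refl) (auto simp: dirichlet_character_mult[OF X])
      finally show "(norm (resonator P D h X * (\<Sum>p\<in>A b. X p)))\<^sup>2 =
        (norm (\<Sum>i\<in>power_box P D \<times> A b. h (fst i) * X ((\<lambda>(m, p). m * p) i)))\<^sup>2" by simp
    qed
    also have "\<dots> = totient q * (\<Sum>i\<in>power_box P D \<times> A b. (norm (h (fst i)))\<^sup>2)"
    proof (rule dirichlet_second_moment_inj[OF _ inj])
      show "finite (power_box P D \<times> A b)"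
        using power_box_finite_card[OF finP primeP] finA[OF b] by blast
      fix i assume i: "i \<in> power_box P D \<times> A b"
      obtain m p where mp: "i = (m, p)" "m \<in> power_box P D" "p \<in> A b" using i by auto
      have "real (m * p) \<le> real m * x" using Aprop(3)[OF b mp(3)] by (simp add: mult_left_mono)
      also have "\<dots> < q" using small mp by simp
      finally have "m * p < q" by (simp only: of_nat_less_iff)
      then show "(\<lambda>(m, p). m * p) i < q \<and> coprime ((\<lambda>(m, p). m * p) i) q"
        using box[OF mp(2)] Aprop(4)[OF b mp(3)] mp(1) by simp
    qed (use q in simp)
    also have "(\<Sum>i\<in>power_box P D \<times> A b. (norm (h (fst i)))\<^sup>2) = (\<Sum>i\<in>power_box P D \<times> A b. 1)"
      using hn box by (intro sum.cong) auto
    finally show ?thesis by (simp add: card_cartesian_product)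
  qed
  have "(\<Sum>X\<in>?C. (norm (resonator P D h X))\<^sup>2 * (norm (\<Sum>n\<in>?R. X n))\<^sup>2) \<le>
     (\<Sum>X\<in>?C. \<Sum>b\<in>B. (x / z) * (norm (resonator P D h X * (\<Sum>p\<in>A b. X p)))\<^sup>2)"
  proof (intro sum_mono)
    fix X assume "X \<in> ?C"
    then have X: "dirichlet_character q X" by simp
    have nX: "norm (X b) \<le> 1" for b using norm_dirichlet_character_le_1[OF X] q by simp
    have "norm (\<Sum>n\<in>?R. X n) \<le> (\<Sum>b\<in>B. norm (X b * (\<Sum>p\<in>A b. X p)))"
      unfolding split[OF X] by (rule norm_sum)
    also have "\<dots> \<le> (\<Sum>b\<in>B. 1 * norm (\<Sum>p\<in>A b. X p))"
      unfolding norm_mult using nX by (intro sum_mono mult_right_mono) auto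
    finally have "(norm (\<Sum>n\<in>?R. X n))\<^sup>2 \<le> (\<Sum>b\<in>B. 1 * norm (\<Sum>p\<in>A b. X p))\<^sup>2"
      by (intro power_mono) auto
    also have "\<dots> \<le> (\<Sum>b\<in>B. 1) * (\<Sum>b\<in>B. 1 * (norm (\<Sum>p\<in>A b. X p))\<^sup>2)"
      by (rule weighted_cauchy_schwarz) simp
    also have "\<dots> \<le> (x / z) * (\<Sum>b\<in>B. (norm (\<Sum>p\<in>A b. X p))\<^sup>2)"
      using mult_right_mono[OF cardB, of "\<Sum>b\<in>B. (norm (\<Sum>p\<in>A b. X p))\<^sup>2"]
      by (simp add: sum_nonneg)
    finally have "(norm (resonator P D h X))\<^sup>2 * (norm (\<Sum>n\<in>?R. X n))\<^sup>2 \<le>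
      (norm (resonator P D h X))\<^sup>2 * ((x / z) * (\<Sum>b\<in>B. (norm (\<Sum>p\<in>A b. X p))\<^sup>2))"
      by (intro mult_left_mono) auto
    then show "(norm (resonator P D h X))\<^sup>2 * (norm (\<Sum>n\<in>?R. X n))\<^sup>2 \<le>
      (\<Sum>b\<in>B. (x / z) * (norm (resonator P D h X * (\<Sum>p\<in>A b. X p)))\<^sup>2)"
      by (simp add: norm_mult power_mult_distrib sum_distrib_left mult_ac)
  qed
  also have "\<dots> = (\<Sum>b\<in>B. (x / z) * (\<Sum>X\<in>?C. (norm (resonator P D h X * (\<Sum>p\<in>A b. X p)))\<^sup>2))"
    by (subst sum.swap) (simp add: sum_distrib_left)
  also have "\<dots> = (\<Sum>b\<in>B. (x / z) * (totient q * (card (power_box P D) * card (A b))))"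
    using fixed by (intro sum.cong refl) simp
  also have "\<dots> = (x / z) * (totient q * card (power_box P D)) * (\<Sum>b\<in>B. real (card (A b)))"
    by (simp add: sum_distrib_left mult.assoc)
  also have "(\<Sum>b\<in>B. real (card (A b))) = real (card ?R)"
  proof -
    have "(\<Sum>b\<in>B. card (A b)) = card ?R"
      using bij_betw_same_card[OF img] finA by (simp add: card_SigmaI B_def)
    then show ?thesis by (metis of_nat_sum)
  qed
  also have "(x / z) * (totient q * card (power_box P D)) * real (card ?R) \<le>
      (x / z) * (totient q * card (power_box P D)) * x"
    using cardR x z by (intro mult_left_mono) auto
  also have "\<dots> = totient q * card (power_box P D) * (x / sqrt z)\<^sup>2"
    using z by (simp add: power2_eq_square field_simps)
  finally show ?thesis .
qed

text \<open>A weighted Chebyshev inequality. The weighted mean square of the distance is at most 2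
  V^2, so characters farther than 2 V carry at most half of the total weight totient(q) N. The
  others carry the rest with weight at most N^2 each, and so number at least totient(q) / (2
  N).\<close>

lemma many_characters_near_twist:
  defines "S \<equiv> {n\<in>smooth_set x z. coprime n q}"
  shows "real (totient q) \<le> 2 * real (Suc D) ^ card P *
    real (card {X. dirichlet_character q X \<and>
      norm ((\<Sum>n=1..nat \<lfloor>x\<rfloor>. X n) - (\<Sum>n\<in>S. cnj (h n))) \<le>
        2 * (4 * ln x * card S / sqrt (Suc D) + x / sqrt z)})"
proof -
  let ?C = "{X. dirichlet_character q X}"
  define V where "V = 4 * ln x * card S / sqrt (Suc D) + x / sqrt z"
  have V0: "V > 0"
  proof -
    have "x / sqrt z > 0" using x z by simp
    moreover have "4 * ln x * card S / sqrt (Suc D) \<ge> 0" using x by simp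
    ultimately show ?thesis by (simp add: V_def)
  qed
  let ?good = "{X. dirichlet_character q X \<and>
      norm ((\<Sum>n=1..nat \<lfloor>x\<rfloor>. X n) - (\<Sum>n\<in>S. cnj (h n))) \<le> 2 * V}"
  define N where "N = card (power_box P D)"
  have N: "N = Suc D ^ card P" "N > 0"
    using power_box_finite_card[OF finP primeP, of D] by (auto simp: N_def)
  have finC: "finite ?C" using finite_dirichlet_characters q by simp
  define w where "w X = (norm (resonator P D h X))\<^sup>2" for X
  define d1 where "d1 X = (\<Sum>n\<in>S. norm (h n * X n - 1))" for X :: "nat \<Rightarrow> complex"
  define d2 where "d2 X = norm (\<Sum>n\<in>rough_set q x z. X n)" for X :: "nat \<Rightarrow> complex"
  have dist: "norm ((\<Sum>n=1..nat \<lfloor>x\<rfloor>. X n) - (\<Sum>n\<in>S. cnj (h n))) \<le> d1 X + d2 X"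
    if X: "dirichlet_character q X" for X
  proof -
    have "{n\<in>{1..nat \<lfloor>x\<rfloor>}. coprime n q} = S \<union> rough_set q x z"
      unfolding S_def smooth_set_def rough_set_def using le_nat_floor_iff[of _ x] by (auto simp: not_le)
    moreover have "S \<inter> rough_set q x z = {}" unfolding S_def smooth_set_def rough_set_def by auto
    moreover have "finite (rough_set q x z)"
      by (rule finite_subset[of _ "{1..nat \<lfloor>x\<rfloor>}"]) (use le_nat_floor_iff in \<open>auto simp: rough_set_def\<close>)
    moreover have "(\<Sum>n=1..nat \<lfloor>x\<rfloor>. X n) = (\<Sum>n\<in>{n\<in>{1..nat \<lfloor>x\<rfloor>}. coprime n q}. X n)"
    proof (rule sum.mono_neutral_right)
      show "\<forall>n\<in>{1..nat \<lfloor>x\<rfloor>} - {n\<in>{1..nat \<lfloor>x\<rfloor>}. coprime n q}. X n = 0"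
        using dirichlet_character_eq_0[OF X] by blast
    qed auto
    ultimately have "(\<Sum>n=1..nat \<lfloor>x\<rfloor>. X n) = (\<Sum>n\<in>S. X n) + (\<Sum>n\<in>rough_set q x z. X n)"
      by (simp add: sum.union_disjoint S_def)
    then have "norm ((\<Sum>n=1..nat \<lfloor>x\<rfloor>. X n) - (\<Sum>n\<in>S. cnj (h n))) =
       norm ((\<Sum>n\<in>S. X n - cnj (h n)) + (\<Sum>n\<in>rough_set q x z. X n))"
      by (simp add: sum_subtractf algebra_simps)
    also have "\<dots> \<le> (\<Sum>n\<in>S. norm (X n - cnj (h n))) + d2 X"
      unfolding d2_def by (intro order_trans[OF norm_triangle_ineq] add_right_mono norm_sum)
    also have "(\<Sum>n\<in>S. norm (X n - cnj (h n))) = d1 X"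
      unfolding d1_def
    proof (intro sum.cong refl)
      fix n assume "n \<in> S"
      then have "norm (h n) = 1" using hn by (auto simp: S_def smooth_set_def)
      then have "cnj (h n) * h n = 1" by (metis complex_norm_square mult.commute of_real_1 power_one)
      then have "X n - cnj (h n) = cnj (h n) * (h n * X n - 1)"
        by (simp only: right_diff_distrib mult.assoc[symmetric] mult_1 mult_1_right)
      then show "norm (X n - cnj (h n)) = norm (h n * X n - 1)"
        using \<open>norm (h n) = 1\<close> by (simp add: norm_mult)
    qed
    finally show ?thesis .
  qed
  have tot: "(\<Sum>X\<in>?C. w X) = real (totient q) * real N" using total_weight by (simp add: w_def N_def)
  have m1: "(\<Sum>X\<in>?C. w X * (d1 X)\<^sup>2) \<le> real (totient q) * real N * (4 * ln x * card S / sqrt (Suc D))\<^sup>2"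
    unfolding w_def d1_def N_def of_nat_mult[symmetric] by (rule smooth_part) (auto simp: S_def smooth_set_def)
  have m2: "(\<Sum>X\<in>?C. w X * (d2 X)\<^sup>2) \<le> real (totient q) * real N * (x / sqrt z)\<^sup>2"
    unfolding w_def d2_def N_def of_nat_mult[symmetric] by (rule rough_part)
  have "(\<Sum>X\<in>?C. w X * (d1 X + d2 X)\<^sup>2) \<le> (\<Sum>X\<in>?C. 2 * (w X * (d1 X)\<^sup>2) + 2 * (w X * (d2 X)\<^sup>2))"
  proof (intro sum_mono)
    fix X
    have "(d1 X + d2 X)\<^sup>2 \<le> 2 * (d1 X)\<^sup>2 + 2 * (d2 X)\<^sup>2"
      using zero_le_power2[of "d1 X - d2 X"] by (simp add: power2_eq_square algebra_simps)
    then have "w X * (d1 X + d2 X)\<^sup>2 \<le> w X * (2 * (d1 X)\<^sup>2 + 2 * (d2 X)\<^sup>2)"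
      by (intro mult_left_mono) (auto simp: w_def)
    then show "w X * (d1 X + d2 X)\<^sup>2 \<le> 2 * (w X * (d1 X)\<^sup>2) + 2 * (w X * (d2 X)\<^sup>2)"
      by (simp add: algebra_simps)
  qed
  also have "\<dots> = 2 * (\<Sum>X\<in>?C. w X * (d1 X)\<^sup>2) + 2 * (\<Sum>X\<in>?C. w X * (d2 X)\<^sup>2)"
    by (simp add: sum.distrib sum_distrib_left)
  also have "\<dots> \<le> 2 * (real (totient q) * real N) * ((4 * ln x * card S / sqrt (Suc D))\<^sup>2 + (x / sqrt z)\<^sup>2)"
    using m1 m2 by (simp add: algebra_simps)
  also have "\<dots> \<le> 2 * (real (totient q) * real N) * V\<^sup>2"
  proof (intro mult_left_mono)
    have "0 \<le> (4 * ln x * card S / sqrt (Suc D)) * (x / sqrt z)" using x z by simp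
    then show "(4 * ln x * card S / sqrt (Suc D))\<^sup>2 + (x / sqrt z)\<^sup>2 \<le> V\<^sup>2"
      unfolding V_def power2_sum by linarith
  qed simp
  finally have M: "(\<Sum>X\<in>?C. w X * (d1 X + d2 X)\<^sup>2) \<le> 2 * (real (totient q) * real N) * V\<^sup>2" .
  \<comment> \<open>Good characters are charged their maximal weight; for the bad ones the quotient
    by 4 V^2 is at least 1.\<close>
  have "(\<Sum>X\<in>?C. w X) \<le> (\<Sum>X\<in>?C. (if X \<in> ?good then (real N)\<^sup>2 else 0) + w X * (d1 X + d2 X)\<^sup>2 / (4 * V\<^sup>2))"
  proof (intro sum_mono)
    fix X assume "X \<in> ?C"
    then have X: "dirichlet_character q X" by simp
    have w0: "w X \<ge> 0" by (simp add: w_def)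
    show "w X \<le> (if X \<in> ?good then (real N)\<^sup>2 else 0) + w X * (d1 X + d2 X)\<^sup>2 / (4 * V\<^sup>2)"
    proof (cases "X \<in> ?good")
      case True
      have "w X \<le> (real N)\<^sup>2"
        unfolding w_def N_def using q
        by (intro power_mono norm_resonator_le[OF hn X _ finP primeP]) auto
      moreover have "0 \<le> w X * (d1 X + d2 X)\<^sup>2 / (4 * V\<^sup>2)" using w0 by simp
      ultimately show ?thesis using True by simp
    next
      case False
      then have "2 * V \<le> d1 X + d2 X" using dist[OF X] X by auto
      then have "(2 * V)\<^sup>2 \<le> (d1 X + d2 X)\<^sup>2" using V0 by (intro power_mono) auto
      then have "1 \<le> (d1 X + d2 X)\<^sup>2 / (4 * V\<^sup>2)" using V0 by (simp add: power_mult_distrib)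
      then have "w X * 1 \<le> w X * ((d1 X + d2 X)\<^sup>2 / (4 * V\<^sup>2))" using w0 by (intro mult_left_mono)
      then show ?thesis unfolding if_not_P[OF False] by simp
    qed
  qed
  also have "\<dots> = (\<Sum>X\<in>?C. if X \<in> ?good then (real N)\<^sup>2 else 0) + (\<Sum>X\<in>?C. w X * (d1 X + d2 X)\<^sup>2) / (4 * V\<^sup>2)"
    by (simp add: sum.distrib sum_divide_distrib)
  also have "(\<Sum>X\<in>?C. if X \<in> ?good then (real N)\<^sup>2 else 0) = (\<Sum>X\<in>{X\<in>?C. X \<in> ?good}. (real N)\<^sup>2)"
    by (rule sum.inter_filter[symmetric, OF finC])
  also have "{X\<in>?C. X \<in> ?good} = ?good" by auto
  also have "(\<Sum>X\<in>?good. (real N)\<^sup>2) = real (card ?good) * (real N)\<^sup>2" by simp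
  also have "(\<Sum>X\<in>?C. w X * (d1 X + d2 X)\<^sup>2) / (4 * V\<^sup>2) \<le> 2 * (real (totient q) * real N) * V\<^sup>2 / (4 * V\<^sup>2)"
    using M by (intro divide_right_mono) auto
  also have "2 * (real (totient q) * real N) * V\<^sup>2 / (4 * V\<^sup>2) = real (totient q) * N / 2" using V0 by simp
  finally have "real (totient q) * N / 2 \<le> real (card ?good) * (real N)\<^sup>2" unfolding tot by simp
  then have "real (totient q) * real N \<le> (2 * real N * real (card ?good)) * real N"
    by (simp add: power2_eq_square algebra_simps)
  then have "real (totient q) \<le> 2 * real N * real (card ?good)"
    by (rule mult_right_le_imp_le) (use N(2) in simp)
  then show ?thesis unfolding V_def N(1) by simp
qed

end

section \<open>Counting the characters\<close>

text \<open>The extreme case is the set 2, ..., k + 1, where the product telescopes to 1 / (k + 1).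
  Adding elements in increasing order shows that the new one is at least k + 2.\<close>

lemma prod_one_minus_inverse_ge:
  assumes "finite A" "\<And>a. a \<in> A \<Longrightarrow> (2::nat) \<le> a"
  shows "1 / (real (card A) + 1) \<le> (\<Prod>a\<in>A. 1 - 1 / real a)"
  using assms
proof (induction A rule: finite_linorder_max_induct)
  case (insert b A)
  have "A \<subseteq> {2..<b}" using insert by auto
  then have "card A \<le> b - 2" using card_mono[of "{2..<b}" A] by simp
  then have b: "real b \<ge> real (card A) + 2" using insert.prems[of b] by simp
  define k where "k = real (card A)"
  have k: "k \<ge> 0" "real b \<ge> k + 2" using b by (auto simp: k_def)
  have "1 / (k + 2) = (1 - 1 / (k + 2)) * (1 / (k + 1))" using k by (simp add: field_simps)
  also have "\<dots> \<le> (1 - 1 / real b) * (\<Prod>a\<in>A. 1 - 1 / real a)"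
  proof (intro mult_mono)
    show "1 - 1 / (k + 2) \<le> 1 - 1 / real b" using k by (intro diff_left_mono frac_le) auto
    show "1 / (k + 1) \<le> (\<Prod>a\<in>A. 1 - 1 / real a)" unfolding k_def using insert by auto
  qed (use k in auto)
  also have "\<dots> = (\<Prod>a\<in>insert b A. 1 - 1 / real a)" using insert by auto
  also have "k + 2 = real (card (insert b A)) + 1" using insert by (auto simp: k_def)
  finally show ?case .
qed simp

lemma card_prime_factors_le:
  fixes q :: nat
  assumes "q > 0" shows "real (card (prime_factors q)) \<le> 2 * ln q"
proof -
  have "real (card (prime_factors q)) = (\<Sum>p\<in>prime_factors q. 1)" by simp
  also have "\<dots> \<le> (\<Sum>p\<in>prime_factors q. real (multiplicity p q))"
  proof (intro sum_mono)
    fix p assume "p \<in> prime_factors q"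
    then have "multiplicity p q \<noteq> 0" by (simp add: prime_factors_multiplicity)
    then show "1 \<le> real (multiplicity p q)" by simp
  qed
  also have "\<dots> \<le> 2 * ln q" using assms by (intro sum_multiplicity_le_ln) auto
  finally show ?thesis .
qed

lemma totient_lower_bound:
  assumes "q > 0" shows "real q / (2 * ln q + 1) \<le> real (totient q)"
proof -
  let ?k = "real (card (prime_factors q))"
  have "real q / (2 * ln q + 1) \<le> real q * (1 / (?k + 1))"
    using card_prime_factors_le[OF assms] assms by (simp add: frac_le)
  also have "\<dots> \<le> real q * (\<Prod>p\<in>prime_factors q. 1 - 1 / real p)"
    using prime_ge_2_nat by (intro mult_left_mono prod_one_minus_inverse_ge) auto
  also have "\<dots> = real (totient q)" by (rule totient_formula2[symmetric])
  finally show ?thesis .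
qed

lemma norm_cis_diff_le: "norm (cis a - cis b) \<le> \<bar>a - b\<bar>"
proof -
  have "(norm (cis a - cis b))\<^sup>2 = (cos a - cos b)\<^sup>2 + (sin a - sin b)\<^sup>2"
    by (simp add: cmod_power2)
  also have "\<dots> = (2 * sin ((a - b) / 2))\<^sup>2"
  proof -
    have "cos (a - b) = 1 - 2 * (sin ((a - b) / 2))\<^sup>2"
      using cos_double_sin[of "(a - b) / 2"] by (simp only: nonzero_mult_div_cancel_left[of 2] times_divide_eq_right)
    moreover have "(cos a - cos b)\<^sup>2 + (sin a - sin b)\<^sup>2 =
        ((sin a)\<^sup>2 + (cos a)\<^sup>2) + ((sin b)\<^sup>2 + (cos b)\<^sup>2) - 2 * cos (a - b)"
      unfolding cos_diff by (simp add: power2_eq_square algebra_simps)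
    ultimately show ?thesis by (simp add: power_mult_distrib)
  qed
  also have "\<dots> \<le> (a - b)\<^sup>2"
    using abs_sin_le_one abs_sin_x_le_abs_x[of "(a - b) / 2"] by (subst abs_le_square_iff[symmetric]) simp
  finally show ?thesis by (simp add: abs_le_square_iff[symmetric])
qed

text \<open>All largeness conditions on q, in the single variable L. The fifth to seventh place z
  above sqrt y and 2, the eighth handles x / sqrt z, the ninth the length of the resonator, and the
  last the number of characters.\<close>

lemma eventually_parameter_bounds:
  fixes C :: real
  shows "\<forall>\<^sub>F L in at_top. ln L \<ge> 32 \<and> ln L \<ge> 4 * C \<and> 1 \<le> L / (ln L)\<^sup>2 \<and> 4 * (L / (ln L)\<^sup>2) + 4 \<le> L \<and>
     12 * ln L \<le> L / 2 \<and> exp (L / 2) \<le> exp L / L ^ 12 \<and> 2 \<le> exp L / L ^ 12 \<and>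
     exp (- L / 8) \<le> 1 / L ^ 2 \<and> 2 * exp L / L ^ 3 + L ^ 2 < exp L \<and>
     2 * exp L / L ^ 4 + ln (4 * exp L + 2) \<le> 2 * exp L * (ln L)\<^sup>2 / L ^ 2"
  by (intro eventually_conj; real_asymp)

lemma many_characters_near_twist_log:
  fixes q :: nat and x \<theta> :: real
  defines "L \<equiv> ln (ln (real q))" and "z \<equiv> ln (real q) / (ln (ln (real q))) ^ 12"
  defines "S \<equiv> {n\<in>smooth_set x z. coprime n q}"
  assumes q: "q > 1" "ln (real q) > 1" and x: "x > 1" "ln x \<le> L\<^sup>2 / (ln L)\<^sup>2"
    and L: "ln L \<ge> 32" "2 \<le> exp L / L ^ 12" "2 * exp L / L ^ 3 + L ^ 2 < exp L"
      "2 * exp L / L ^ 4 + ln (4 * exp L + 2) \<le> 2 * exp L * (ln L)\<^sup>2 / L ^ 2"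
  shows "real q powr (1 - 2 / ln x) \<le> real (card {X. dirichlet_character q X \<and>
      norm ((\<Sum>n=1..nat \<lfloor>x\<rfloor>. X n) - (\<Sum>n\<in>S. cis (\<theta> / ln x * ln n))) \<le>
        2 * (4 * ln x * card S / L ^ 4 + x / sqrt z)})"
proof -
  define y where "y = ln (real q)"
  have y: "y > 1" "y = exp L" using q by (auto simp: y_def L_def)
  have L1: "L > 1"
  proof (rule ccontr)
    assume "\<not> L > 1"
    moreover have "L > 0" using q by (simp add: L_def)
    ultimately have "ln L \<le> 0" by simp
    then show False using L(1) by simp
  qed
  have qy: "real q = exp y" using q by (simp add: y_def)
  have zy: "z = y / L ^ 12" by (simp add: z_def y_def L_def)
  have z2: "z \<ge> 2" using L(2) zy y by simp
  have zley: "z \<le> y" unfolding zy using L1 y by (simp add: divide_le_eq mult_le_cancel_left1 one_le_power)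
  define D where "D = nat \<lceil>L ^ 8\<rceil>"
  have D: "L ^ 8 \<le> real D" "real D \<le> 2 * L ^ 8"
  proof -
    show "L ^ 8 \<le> real D" unfolding D_def by (rule of_nat_ceiling)
    have L8: "1 \<le> L ^ 8" using L1 by (intro one_le_power) auto
    then have "real D = of_int \<lceil>L ^ 8\<rceil>" by (simp add: D_def)
    moreover have "real_of_int \<lceil>L ^ 8\<rceil> \<le> L ^ 8 + 1" by (rule of_int_ceiling_le_add_one)
    ultimately show "real D \<le> 2 * L ^ 8" using L8 by linarith
  qed
  define P where "P = {p. prime p \<and> real p \<le> z \<and> \<not> p dvd q}"
  have Psub: "P \<subseteq> {1..nat \<lfloor>z\<rfloor>}"
    unfolding P_def using le_nat_floor_iff prime_ge_1_nat by fastforce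
  then have finP: "finite P" by (rule finite_subset) simp
  have cardP: "real (card P) \<le> z"
    using card_mono[OF _ Psub] z2 by simp linarith
  \<comment> \<open>L^8 times y / L^12. This quantity bounds log M, and multiplied by L also the
    logarithm of the largest frequency.\<close>
  have DP: "real D * real (card P) \<le> 2 * y / L ^ 4"
  proof -
    have "real D * real (card P) \<le> (2 * L ^ 8) * z" using D cardP L1 by (intro mult_mono) auto
    also have "\<dots> = 2 * y / L ^ 4"
      unfolding zy using L1 by (simp add: field_simps flip: power_add)
    finally show ?thesis .
  qed
  define h where "h n = cis (- (\<theta> / ln x * ln (real n)))" for n :: nat
  have lnx: "ln x > 0" using x by simp
  have lnx2: "ln x \<le> L ^ 2"
  proof -
    have "L\<^sup>2 / (ln L)\<^sup>2 \<le> L\<^sup>2 / 1" using L(1) by (intro divide_left_mono) (auto simp: one_le_power)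
    then show ?thesis using x(2) by simp
  qed
  have small: "real m * x < real q" if m: "m \<in> power_box P D" for m
  proof -
    have "real m \<le> y ^ (D * card P)"
      using finP m y zley by (intro power_box_le) (auto simp: P_def)
    also have "\<dots> = exp (real D * real (card P) * L)"
      unfolding y(2) by (simp flip: exp_of_nat_mult)
    also have "\<dots> \<le> exp (2 * y / L ^ 4 * L)"
      unfolding exp_le_cancel_iff using DP L1 by (intro mult_right_mono) auto
    also have "2 * y / L ^ 4 * L = 2 * y / L ^ 3" using L1 by (simp add: field_simps eval_nat_numeral)
    finally have m1: "real m \<le> exp (2 * y / L ^ 3)" .
    have "x = exp (ln x)" using x by simp
    also have "\<dots> \<le> exp (L ^ 2)" using lnx2 by simp
    finally have "real m * x \<le> exp (2 * y / L ^ 3) * exp (L ^ 2)"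
      using x m1 by (intro mult_mono) auto
    also have "\<dots> = exp (2 * y / L ^ 3 + L ^ 2)" by (simp add: exp_add)
    also have "\<dots> < exp y" using L(3) y by simp
    finally show ?thesis using qy by simp
  qed
  have res: "real (totient q) \<le> 2 * real (Suc D) ^ card P *
    real (card {X. dirichlet_character q X \<and>
      norm ((\<Sum>n=1..nat \<lfloor>x\<rfloor>. X n) - (\<Sum>n\<in>S. cnj (h n))) \<le>
        2 * (4 * ln x * card S / sqrt (Suc D) + x / sqrt z)})" (is "_ \<le> _ * real (card ?G)")
    unfolding S_def
  proof (rule many_characters_near_twist[OF q(1) _ _ P_def])
    show "h (a * b) = h a * h b" if "a > 0" "b > 0" for a b
      using that by (simp add: h_def ln_mult cis_mult algebra_simps)
  qed (use z2 x small in \<open>auto simp: h_def\<close>)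
  let ?H = "{X. dirichlet_character q X \<and>
      norm ((\<Sum>n=1..nat \<lfloor>x\<rfloor>. X n) - (\<Sum>n\<in>S. cis (\<theta> / ln x * ln n))) \<le>
        2 * (4 * ln x * card S / L ^ 4 + x / sqrt z)}"
  have "?G \<subseteq> ?H"
  proof (intro subsetI CollectI conjI)
    fix X assume X: "X \<in> ?G"
    then show "dirichlet_character q X" by simp
    have "cnj (h n) = cis (\<theta> / ln x * ln n)" for n :: nat by (simp add: h_def cis_cnj)
    then have "norm ((\<Sum>n=1..nat \<lfloor>x\<rfloor>. X n) - (\<Sum>n\<in>S. cis (\<theta> / ln x * ln n))) \<le>
        2 * (4 * ln x * card S / sqrt (Suc D) + x / sqrt z)" using X by simp
    also have "\<dots> \<le> 2 * (4 * ln x * card S / L ^ 4 + x / sqrt z)"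
    proof (intro mult_left_mono add_right_mono divide_left_mono)
      \<comment> \<open>The eighth power in \<open>D\<close> serves this: dividing ln x by L^4
        leaves at most 1 / ln x, because ln x \<le> L^2.\<close>
      have "(L ^ 4)\<^sup>2 \<le> real (Suc D)" using D(1) by (simp flip: power_mult)
      then show "L ^ 4 \<le> sqrt (real (Suc D))" by (rule real_le_rsqrt)
    qed (use L1 lnx in auto)
    finally show "norm ((\<Sum>n=1..nat \<lfloor>x\<rfloor>. X n) - (\<Sum>n\<in>S. cis (\<theta> / ln x * ln n))) \<le>
        2 * (4 * ln x * card S / L ^ 4 + x / sqrt z)" .
  qed
  moreover have "finite ?H"
    by (rule finite_subset[OF _ finite_dirichlet_characters[of q]]) (use q in auto)
  ultimately have GH: "real (card ?G) \<le> real (card ?H)" by (simp add: card_mono)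
  \<comment> \<open>Replacing ln(D + 1) by D is wasteful but harmless: y / L^4 is still far below y
    / ln x.\<close>
  have "real (Suc D) ^ card P \<le> exp (real D) ^ card P"
    using exp_ge_add_one_self[of "real D"] by (intro power_mono) (auto simp: add.commute)
  also have "\<dots> = exp (real D * real (card P))" by (rule exp_of_nat2_mult[symmetric])
  also have "\<dots> \<le> exp (2 * y / L ^ 4)" using DP by simp
  finally have SD: "real (Suc D) ^ card P \<le> exp (2 * y / L ^ 4)" .
  have "exp y / (2 * y + 1) \<le> real (totient q)"
    using totient_lower_bound[of q] q by (simp add: qy[symmetric] y_def)
  also have "\<dots> \<le> 2 * real (Suc D) ^ card P * real (card ?H)"
    using order_trans[OF res mult_left_mono[OF GH]] by simp
  also have "\<dots> \<le> 2 * exp (2 * y / L ^ 4) * real (card ?H)"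
    using SD by (intro mult_right_mono) auto
  finally have "exp y \<le> exp (2 * y / L ^ 4) * (4 * y + 2) * real (card ?H)"
    using y by (simp add: field_simps)
  also have "4 * y + 2 = exp (ln (4 * y + 2))" using y(1) by (intro exp_ln[symmetric]) simp
  finally have 1: "exp y \<le> exp (2 * y / L ^ 4 + ln (4 * y + 2)) * real (card ?H)"
    by (simp only: exp_add)
  have "2 * y / L ^ 4 + ln (4 * y + 2) \<le> 2 * y * (ln L)\<^sup>2 / L ^ 2" using L(4) y by simp
  also have "\<dots> \<le> 2 * y / ln x"
  proof -
    have "2 * y * (ln L)\<^sup>2 / L ^ 2 = 2 * y / (L\<^sup>2 / (ln L)\<^sup>2)" by simp
    also have "\<dots> \<le> 2 * y / ln x"
      using x(2) lnx y(1) less_le_trans[OF lnx x(2)] by (intro divide_left_mono mult_pos_pos) auto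
    finally show ?thesis .
  qed
  finally have "exp (2 * y / L ^ 4 + ln (4 * y + 2)) * real (card ?H) \<le> exp (2 * y / ln x) * real (card ?H)"
    by (intro mult_right_mono) auto
  then have "exp y \<le> exp (2 * y / ln x) * real (card ?H)" using 1 by linarith
  then have "exp y * exp (- (2 * y / ln x)) \<le> exp (2 * y / ln x) * real (card ?H) * exp (- (2 * y / ln x))"
    by (intro mult_right_mono) auto
  also have "\<dots> = real (card ?H) * exp (2 * y / ln x + - (2 * y / ln x))"
    by (simp only: exp_add mult_ac)
  also have "\<dots> = real (card ?H)" by simp
  also have "exp y * exp (- (2 * y / ln x)) = real q powr (1 - 2 / ln x)"
    using q by (simp add: powr_def y_def[symmetric] exp_add[symmetric] algebra_simps)
  finally show ?thesis .
qed

section \<open>From twisted smooth sums to the asymptotic formulas\<close>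

lemma smooth_sum_one: "smooth_sum x y (\<lambda>_. 1) = smooth_count x y"
  by (simp add: smooth_sum_def smooth_count_def smooth_set_eq)

lemma smooth_sum_principal:
  "smooth_sum x y (principal_character q) = of_nat (card {n\<in>smooth_set x y. coprime n q})"
proof -
  have "smooth_sum x y (principal_character q) = (\<Sum>n\<in>smooth_set x y. if coprime n q then 1 else 0)"
    by (simp add: smooth_sum_def smooth_set_eq principal_character_def)
  also have "\<dots> = (\<Sum>n\<in>{n\<in>smooth_set x y. coprime n q}. 1)"
    by (rule sum.inter_filter[symmetric]) simp
  finally show ?thesis by simp
qed

text \<open>With t = \<theta> / ln x the twist at n differs from that at x by an angle of at most 4
  ln(x / n) / ln x. The mean of ln(x / n) over smooth integers is bounded, so the relative error is
  O(1 / ln x).\<close>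

lemma sum_twist_near:
  assumes S: "S \<subseteq> smooth_set x y" and x: "x > 1" and \<theta>: "\<bar>\<theta>\<bar> \<le> pi"
  shows "norm ((\<Sum>n\<in>S. cis (\<theta> / ln x * ln (real n))) - of_nat (card S) * cis \<theta>)
    \<le> 4 / ln x * (\<Sum>n\<in>smooth_set x y. ln (x / n))"
proof -
  have lnx: "ln x > 0" using x by simp
  have "(\<Sum>n\<in>S. cis (\<theta> / ln x * ln (real n))) - of_nat (card S) * cis \<theta> =
      (\<Sum>n\<in>S. cis (\<theta> / ln x * ln (real n)) - cis \<theta>)"
    by (simp add: sum_subtractf)
  then have "norm ((\<Sum>n\<in>S. cis (\<theta> / ln x * ln (real n))) - of_nat (card S) * cis \<theta>) \<le>
     (\<Sum>n\<in>S. norm (cis (\<theta> / ln x * ln (real n)) - cis \<theta>))"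
    by (simp only: norm_sum)
  also have "\<dots> \<le> (\<Sum>n\<in>S. 4 / ln x * ln (x / n))"
  proof (intro sum_mono)
    fix n assume "n \<in> S"
    then have n: "1 \<le> real n" "real n \<le> x" using S by (auto simp: smooth_set_def)
    have "norm (cis (\<theta> / ln x * ln (real n)) - cis \<theta>) \<le> \<bar>\<theta> / ln x * ln (real n) - \<theta>\<bar>"
      by (rule norm_cis_diff_le)
    also have "\<theta> / ln x * ln (real n) - \<theta> = - (\<theta> / ln x * ln (x / n))"
      using lnx n by (simp add: ln_div field_simps)
    also have "\<bar>- (\<theta> / ln x * ln (x / n))\<bar> = \<bar>\<theta>\<bar> / ln x * ln (x / n)"
      using lnx n by (simp add: abs_mult)
    also have "\<dots> \<le> 4 / ln x * ln (x / n)"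
      using \<theta> pi_less_4 lnx n by (intro mult_right_mono divide_right_mono) auto
    finally show "norm (cis (\<theta> / ln x * ln (real n)) - cis \<theta>) \<le> 4 / ln x * ln (x / n)" .
  qed
  also have "\<dots> \<le> (\<Sum>n\<in>smooth_set x y. 4 / ln x * ln (x / n))"
  proof (intro sum_mono2 S)
    fix n assume "n \<in> smooth_set x y - S"
    then have n: "1 \<le> real n" "real n \<le> x" by (auto simp: smooth_set_def)
    then show "0 \<le> 4 / ln x * ln (x / n)" using lnx by simp
  qed simp
  finally show ?thesis by (simp add: sum_distrib_left)
qed

lemma card_coprime_diff_le:
  assumes "z \<le> y"
  shows "real (card {n\<in>smooth_set x z. coprime n q}) \<le> real (card {n\<in>smooth_set x y. coprime n q})"
    and "real (card {n\<in>smooth_set x y. coprime n q}) - real (card {n\<in>smooth_set x z. coprime n q})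
      \<le> smooth_count x y - smooth_count x z"
proof -
  let ?A = "\<lambda>y. {n\<in>smooth_set x y. coprime n q}" and ?B = "\<lambda>y. {n\<in>smooth_set x y. \<not> coprime n q}"
  have sub: "smooth_set x z \<subseteq> smooth_set x y" using assms by (intro smooth_set_mono) auto
  have "smooth_count x w = real (card (?A w)) + real (card (?B w))" for w
  proof -
    have "smooth_set x w = ?A w \<union> ?B w" by auto
    then have "card (smooth_set x w) = card (?A w) + card (?B w)"
      by (metis (no_types, lifting) card_Un_disjoint disjoint_iff finite_Un finite_smooth_set mem_Collect_eq)
    then show ?thesis by (simp add: smooth_count_def)
  qed
  moreover have "card (?B z) \<le> card (?B y)" using sub by (intro card_mono) auto
  ultimately show "real (card (?A y)) - real (card (?A z)) \<le> smooth_count x y - smooth_count x z" by simp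
  show "real (card (?A z)) \<le> real (card (?A y))" using sub by (intro of_nat_mono card_mono) auto
qed

text \<open>The bound on ln x says precisely u \<le> U with U = L / lam^2. As 4 U + 4 \<le> L, the
  decay rate of rho up to U is at most 4 lam, and all error terms become multiples of
  \<open>error_term\<close>.\<close>

lemma smooth_estimates_at_log:
  fixes q :: nat and x C :: real
  defines "y \<equiv> ln (real q)" and "L \<equiv> ln (ln (real q))"
  defines "lam \<equiv> ln L" and "z \<equiv> y / L ^ 12" and "W \<equiv> x * dickman (ln x / L)"
    and "U \<equiv> L / (ln L)\<^sup>2"
  assumes C: "C > 0" and y: "y > 1"
    and F: "lam \<ge> 32" "lam \<ge> 4 * C" "1 \<le> U" "4 * U + 4 \<le> L" "12 * lam \<le> L / 2"
      "exp (L / 2) \<le> exp L / L ^ 12" "2 \<le> exp L / L ^ 12" "exp (- L / 8) \<le> 1 / L ^ 2"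
    and x: "x > 1" "ln x \<le> L\<^sup>2 / lam\<^sup>2"
    and E: "C * U * dickman_rate U \<le> ln y \<Longrightarrow> ln x \<le> U * ln y \<Longrightarrow> smooth_estimates C y U x"
  shows "W \<ge> 1" "smooth_count x y \<le> 3 * W"
    and "\<bar>smooth_count x y - W\<bar> \<le> (4 * C + 2) * (W * error_term q x)"
    and "(\<Sum>n\<in>smooth_set x y. ln (x / n)) \<le> 25 * smooth_count x y"
    and "smooth_count x y - smooth_count x z \<le> 104 * C * (smooth_count x y * error_term q x)"
    and "x / sqrt z \<le> 4 * (smooth_count x y / ln x)"
    and "z < y" "ln x \<le> L ^ 2" "1 / ln x \<le> error_term q x"
proof -
  define Psi where "Psi = smooth_count x y"
  define u where "u = ln x / L"
  define err where "err = error_term q x"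
  have Psi0: "Psi \<ge> 0" by (simp add: Psi_def smooth_count_nonneg)
  have yL: "ln y = L" "y = exp L" using y by (auto simp: y_def L_def)
  have L1: "L > 1"
  proof (rule ccontr)
    assume "\<not> L > 1"
    moreover have "L > 0" using y by (simp add: L_def y_def)
    ultimately have "ln L \<le> 0" by simp
    then show False using F(1) by (simp add: lam_def)
  qed
  have lnx: "ln x > 0" using x by simp
  have u0: "u > 0" using lnx L1 by (simp add: u_def)
  have U: "U = L / lam\<^sup>2" by (simp add: U_def lam_def)
  have err: "err = 1 / ln x + ln x * lam\<^sup>2 / L\<^sup>2"
    by (simp add: err_def error_term_def lam_def L_def)
  have err1: "1 / ln x \<le> err" and err2: "ln x * lam\<^sup>2 / L\<^sup>2 \<le> err" and err0: "err > 0"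
    unfolding err using lnx by (auto intro!: add_pos_nonneg)
  then show "1 / ln x \<le> error_term q x" by (simp add: err_def)
  show lnx2: "ln x \<le> L ^ 2"
  proof -
    have "L\<^sup>2 / lam\<^sup>2 \<le> L\<^sup>2 / 1" using F(1) by (intro divide_left_mono) (auto simp: one_le_power)
    then show ?thesis using x(2) by simp
  qed
  have rate: "dickman_rate U \<le> 4 * lam"
  proof -
    have "ln (4 * U + 4) \<le> ln L" using F(3,4) by (intro ln_mono) auto
    then show ?thesis by (simp add: dickman_rate_def lam_def)
  qed
  have rate0: "dickman_rate U \<ge> 0" using F(3) by (intro dickman_rate_nonneg) auto
  have Urate: "U * dickman_rate U \<le> 4 * L / lam"
  proof -
    have "U * dickman_rate U \<le> U * (4 * lam)" using rate F(3) by (intro mult_left_mono) auto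
    also have "U * (4 * lam) = 4 * L / lam" using F(1) by (simp add: U power2_eq_square)
    finally show ?thesis .
  qed
  have CU: "C * U * dickman_rate U \<le> L"
  proof -
    have "C * (U * dickman_rate U) \<le> C * (4 * L / lam)" using C Urate by (intro mult_left_mono) auto
    also have "\<dots> = (4 * C / lam) * L" by simp
    also have "\<dots> \<le> 1 * L" using F(1,2) L1 by (intro mult_right_mono) (auto simp: divide_le_eq)
    finally show ?thesis by (simp add: mult.assoc)
  qed
  have xU: "ln x \<le> U * L" using x(2) by (simp add: U power2_eq_square)
  have uU: "u \<le> U" using xU L1 by (simp add: u_def divide_le_eq)
  have E1: "\<bar>Psi - W\<bar> \<le> C * (u * dickman_rate U / L) * W + 1"
    and E2: "x powr (3/4) \<le> W" and E3: "W \<le> 4 * Psi"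
    and E4: "(\<Sum>n\<in>smooth_set x y. ln (x / n)) \<le> 25 * Psi"
    and E5: "\<And>z. 2 \<le> z \<Longrightarrow> sqrt y \<le> z \<Longrightarrow> z \<le> y \<Longrightarrow>
      Psi - smooth_count x z \<le> C * (u * dickman_rate U) * ((L - ln z + 10) / ln z) * Psi"
    using E CU xU unfolding smooth_estimates_def yL(1) Psi_def W_def u_def by blast+
  show "(\<Sum>n\<in>smooth_set x y. ln (x / n)) \<le> 25 * smooth_count x y" using E4 by (simp add: Psi_def)
  have "x powr (3/4) \<ge> 1" using x by (intro ge_one_powr_ge_zero) auto
  then show W1: "W \<ge> 1" using E2 by linarith
  \<comment> \<open>Makes the additive 1 a relative error: ln x \<le> 2 W, so 1 \<le> 2 W / ln
    x.\<close>
  have "ln x = (4/3) * ln (x powr (3/4))" using x by (simp add: ln_powr)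
  also have "\<dots> \<le> (4/3) * (x powr (3/4))"
    using ln_le_minus_one[of "x powr (3/4)"] x by (intro mult_left_mono) auto
  also have "\<dots> \<le> 2 * W" using E2 W1 by linarith
  finally have "1 \<le> 2 * W * (1 / ln x)" using lnx by simp
  also have "\<dots> \<le> 2 * W * err" using err1 W1 by (intro mult_left_mono) auto
  finally have one: "1 \<le> 2 * W * err" .
  have urate: "u * dickman_rate U / L \<le> 4 * err"
  proof -
    have "u * dickman_rate U / L \<le> u * (4 * lam) / L"
      using rate u0 L1 by (intro divide_right_mono mult_left_mono) auto
    also have "\<dots> \<le> u * (4 * lam\<^sup>2) / L"
      using u0 L1 F(1) by (intro divide_right_mono mult_left_mono) (auto simp: power2_eq_square)
    also have "\<dots> = 4 * (ln x * lam\<^sup>2 / L\<^sup>2)" by (simp add: u_def power2_eq_square)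
    finally show ?thesis using err2 by linarith
  qed
  have "C * (u * dickman_rate U / L) * W \<le> C * (4 * err) * W"
    using urate C W1 by (intro mult_right_mono mult_left_mono) auto
  then show "\<bar>smooth_count x y - W\<bar> \<le> (4 * C + 2) * (W * error_term q x)"
    using E1 one unfolding Psi_def err_def by (simp add: algebra_simps)
  have "C * (u * dickman_rate U / L) * W \<le> 1 * W"
  proof (intro mult_right_mono)
    have "C * (u * dickman_rate U) \<le> C * (U * dickman_rate U)"
      using C uU rate0 by (intro mult_left_mono mult_right_mono) auto
    then have "C * (u * dickman_rate U) \<le> L" using CU by (simp add: mult.assoc)
    then show "C * (u * dickman_rate U / L) \<le> 1" using L1 by simp
  qed (use W1 in auto)
  then show "smooth_count x y \<le> 3 * W" using E1 W1 unfolding Psi_def by linarith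
  have L12: "L ^ 12 > 1" using L1 by (intro one_less_power) auto
  show zy: "z < y" unfolding z_def using y L12 by (simp add: divide_less_eq)
  have z2: "2 \<le> z" using F(7) by (simp add: z_def yL(2))
  have sqy: "sqrt y = exp (L / 2)"
    unfolding yL(2) by (rule real_sqrt_unique) (simp_all add: power2_eq_square flip: exp_add)
  have zsq: "sqrt y \<le> z" unfolding sqy z_def using F(6) by (simp add: yL(2))
  have lnz: "ln z = L - 12 * lam"
    unfolding z_def lam_def using y L1 by (simp add: ln_div ln_realpow yL(1))
  \<comment> \<open>L - ln z is 12 lam, 10 is at most lam, and ln z is at least L / 2. Together with
    the rate 4 lam this yields the constant 104.\<close>
  have "(L - ln z + 10) / ln z \<le> 13 * lam / (L / 2)"
    unfolding lnz using F(1,5) L1 by (intro frac_le) auto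
  moreover have "u * dickman_rate U \<le> u * (4 * lam)" using rate u0 by (intro mult_left_mono) auto
  moreover have "0 \<le> (L - ln z + 10) / ln z" unfolding lnz using F(1,5) L1 by (intro divide_nonneg_pos) auto
  ultimately have "(u * dickman_rate U) * ((L - ln z + 10) / ln z) \<le> (u * (4 * lam)) * (13 * lam / (L / 2))"
    using u0 F(1) rate0 by (intro mult_mono) auto
  also have "\<dots> = 104 * (ln x * lam\<^sup>2 / L\<^sup>2)" by (simp add: u_def power2_eq_square)
  also have "\<dots> \<le> 104 * err" using err2 by linarith
  finally have "C * ((u * dickman_rate U) * ((L - ln z + 10) / ln z)) * Psi \<le> C * (104 * err) * Psi"
    using C Psi0 by (intro mult_right_mono mult_left_mono) auto
  then have "Psi - smooth_count x z \<le> C * (104 * err) * Psi"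
    using E5[OF z2 zsq] zy by (simp add: mult.assoc)
  then show "smooth_count x y - smooth_count x z \<le> 104 * C * (smooth_count x y * error_term q x)"
    by (simp add: Psi_def err_def mult_ac)
  \<comment> \<open>Decay over [0, u] costs at most exp(4 L / lam), which is at most exp(L / 8) by
    lam \<ge> 32. The factor sqrt z \<ge> exp(L / 4) outweighs it.\<close>
  have "dickman 0 \<le> dickman u * exp (dickman_rate U * (u - 0))"
    using u0 uU by (intro dickman_exp_le) auto
  also have "dickman_rate U * (u - 0) \<le> L / 8"
  proof -
    have "dickman_rate U * u \<le> dickman_rate U * U" using rate0 uU by (intro mult_left_mono) auto
    also have "\<dots> \<le> 4 * L / lam" using Urate by (simp add: mult.commute)
    also have "\<dots> \<le> 4 * L / 32" using F(1) L1 by (intro divide_left_mono) auto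
    finally show ?thesis by simp
  qed
  finally have d1: "1 \<le> dickman u * exp (L / 8)"
    using dickman_01[of 0] by (simp add: mult_left_mono dickman_nonneg)
  have xW: "x \<le> W * exp (L / 8)"
    using mult_left_mono[OF d1, of x] x by (simp add: W_def u_def mult.assoc)
  have "exp (L / 4) \<le> sqrt z"
  proof (rule real_le_rsqrt)
    have "(exp (L / 4))\<^sup>2 = exp (L / 2)" by (simp add: power2_eq_square flip: exp_add)
    then show "(exp (L / 4))\<^sup>2 \<le> z" using zsq sqy by simp
  qed
  then have "x / sqrt z \<le> (W * exp (L / 8)) / exp (L / 4)"
    using xW x by (intro frac_le) auto
  also have "\<dots> = W * exp (- L / 8)" by (simp add: exp_diff[symmetric] flip: times_divide_eq_right)
  also have "\<dots> \<le> W * (1 / L ^ 2)" using F(8) W1 by (intro mult_left_mono) auto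
  also have "\<dots> \<le> W * (1 / ln x)" using W1 lnx lnx2 less_le_trans[OF lnx lnx2]
    by (intro mult_left_mono divide_left_mono mult_pos_pos) auto
  also have "\<dots> \<le> 4 * Psi * (1 / ln x)" using E3 lnx by (intro mult_right_mono) auto
  finally show "x / sqrt z \<le> 4 * (smooth_count x y / ln x)" by (simp add: Psi_def)
qed

theorem theorem3:
  "\<exists>C>0. \<forall>\<^sub>F q :: nat in at_top. \<forall>x \<theta> :: real.
     x > 1 \<longrightarrow> ln x \<le> (ln (ln q))\<^sup>2 / (ln (ln (ln q)))\<^sup>2 \<longrightarrow> \<bar>\<theta>\<bar> \<le> pi \<longrightarrow>
     real (card {X. dirichlet_character q X \<and>
        norm ((\<Sum>n = 1..nat \<lfloor>x\<rfloor>. X n) - cis \<theta> * smooth_sum x (ln q) (principal_character q))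
          \<le> C * (smooth_sum x (ln q) (\<lambda>_. 1) * error_term q x) \<and>
        ((\<forall>p. prime p \<and> real p < ln q \<longrightarrow> \<not> p dvd q) \<longrightarrow>
          (\<exists>\<epsilon>. norm \<epsilon> \<le> C * error_term q x \<and>
            (\<Sum>n = 1..nat \<lfloor>x\<rfloor>. X n) =
              of_real x * cis \<theta> * of_real (dickman (ln x / ln (ln q))) * (1 + \<epsilon>)))})
      \<ge> q powr (1 - 2 / ln x)"
proof -
  let ?H = "\<lambda>C (q::nat) (x::real) \<theta>. {X. dirichlet_character q X \<and>
        norm ((\<Sum>n = 1..nat \<lfloor>x\<rfloor>. X n) - cis \<theta> * smooth_sum x (ln q) (principal_character q))
          \<le> C * (smooth_sum x (ln q) (\<lambda>_. 1) * error_term q x) \<and>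
        ((\<forall>p. prime p \<and> real p < ln q \<longrightarrow> \<not> p dvd q) \<longrightarrow>
          (\<exists>\<epsilon>. norm \<epsilon> \<le> C * error_term q x \<and>
            (\<Sum>n = 1..nat \<lfloor>x\<rfloor>. X n) =
              of_real x * cis \<theta> * of_real (dickman (ln x / ln (ln q))) * (1 + \<epsilon>)))}"
  let ?P = "\<lambda>C (q::nat) x \<theta>. x > 1 \<longrightarrow> ln x \<le> (ln (ln q))\<^sup>2 / (ln (ln (ln q)))\<^sup>2 \<longrightarrow> \<bar>\<theta>\<bar> \<le> pi \<longrightarrow>
     real q powr (1 - 2 / ln x) \<le> real (card (?H C q x \<theta>))"
  obtain C where C: "C > 0" and E: "\<And>y U x. y > 1 \<Longrightarrow> U \<ge> 1 \<Longrightarrow> C * U * dickman_rate U \<le> ln y \<Longrightarrow>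
    1 \<le> x \<Longrightarrow> ln x \<le> U * ln y \<Longrightarrow> smooth_estimates C y U x"
    using smooth_count_estimates by blast
  \<comment> \<open>Large enough for both formulas, which need 116 + 104 C and 350 + 628 C.\<close>
  define K where "K = 400 + 1200 * C"
  show ?thesis
  proof (intro exI[of _ K] conjI)
    show "K > 0" using C by (simp add: K_def)
    have lim: "filterlim (\<lambda>q::nat. ln (ln (real q))) at_top at_top" by real_asymp
    have big: "\<forall>\<^sub>F q::nat in at_top. real q > 1 \<and> ln (real q) > 1" by (intro eventually_conj; real_asymp)
    show "\<forall>\<^sub>F q :: nat in at_top. \<forall>x \<theta> :: real. ?P K q x \<theta>"
      using eventually_compose_filterlim[OF eventually_parameter_bounds[of C] lim] big
    proof eventually_elim
      case (elim q)
      define y L lam where "y = ln (real q)" and "L = ln (ln (real q))" and "lam = ln (ln (ln (real q)))"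
      have q: "q > 1" "y > 1" using elim by (auto simp: y_def)
      have yL: "ln y = L" "y = exp L" using q by (auto simp: y_def L_def)
      have lamL: "ln L = lam" by (simp add: lam_def L_def)
      have F: "lam \<ge> 32" "lam \<ge> 4 * C" "1 \<le> L / lam\<^sup>2" "4 * (L / lam\<^sup>2) + 4 \<le> L" "12 * lam \<le> L / 2"
        "exp (L / 2) \<le> exp L / L ^ 12" "2 \<le> exp L / L ^ 12" "exp (- L / 8) \<le> 1 / L ^ 2"
        "2 * exp L / L ^ 3 + L ^ 2 < exp L"
        "2 * exp L / L ^ 4 + ln (4 * exp L + 2) \<le> 2 * exp L * lam\<^sup>2 / L ^ 2"
        using elim unfolding L_def[symmetric] lamL[symmetric] by (auto simp: L_def)
      show ?case
      proof (intro allI impI)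
        fix x \<theta> :: real
        assume x: "x > 1" and xL0: "ln x \<le> (ln (ln q))\<^sup>2 / (ln (ln (ln q)))\<^sup>2" and \<theta>: "\<bar>\<theta>\<bar> \<le> pi"
        show "real q powr (1 - 2 / ln x) \<le> real (card (?H K q x \<theta>))"
        proof -
          define z where "z = y / L ^ 12"
          define W Psi err where "W = x * dickman (ln x / L)" and "Psi = smooth_count x y" and "err = error_term q x"
          define S where "S = {n\<in>smooth_set x z. coprime n q}"
          define cy where "cy = real (card {n\<in>smooth_set x y. coprime n q})"
          have xL: "ln x \<le> L\<^sup>2 / lam\<^sup>2" using xL0 by (simp add: L_def lam_def)
          have lnx: "ln x > 0" using x by simp
          have est: "W \<ge> 1" "Psi \<le> 3 * W" "\<bar>Psi - W\<bar> \<le> (4 * C + 2) * (W * err)"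
            "(\<Sum>n\<in>smooth_set x y. ln (x / n)) \<le> 25 * Psi"
            "Psi - smooth_count x z \<le> 104 * C * (Psi * err)" "x / sqrt z \<le> 4 * (Psi / ln x)"
            "z < y"
            unfolding W_def Psi_def err_def z_def y_def L_def
            by (rule smooth_estimates_at_log[OF C]; use F q x xL E[of y "L / lam\<^sup>2" x] in
              \<open>simp add: y_def[symmetric] L_def[symmetric] lamL yL\<close>)+
          have lnx2: "ln x \<le> L ^ 2"
            unfolding L_def
            by (rule smooth_estimates_at_log(8)[OF C, of q x]; use F q x xL E[of y "L / lam\<^sup>2" x] in
              \<open>simp add: y_def[symmetric] L_def[symmetric] lamL yL\<close>)
          have lnx3: "1 / ln x \<le> err"
            unfolding err_def
            by (rule smooth_estimates_at_log(9)[OF C, of q x]; use F q x xL E[of y "L / lam\<^sup>2" x] in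
              \<open>simp add: y_def[symmetric] L_def[symmetric] lamL yL\<close>)
          have Psi0: "Psi \<ge> 0" by (simp add: Psi_def smooth_count_nonneg)
          have err0: "err > 0" using lnx3 lnx by (meson less_le_trans zero_less_divide_1_iff)
          have L1: "L > 0" using q yL by simp
          have cz: "real (card S) \<le> cy" "cy - real (card S) \<le> Psi - smooth_count x z"
            using card_coprime_diff_le[of z y x q] est(7) by (auto simp: S_def cy_def Psi_def)
          have SPsi: "real (card S) \<le> Psi"
          proof -
            have "S \<subseteq> smooth_set x y" using smooth_set_mono[of x x z y] est(7) by (auto simp: S_def)
            then show ?thesis unfolding Psi_def smooth_count_def by (intro of_nat_mono card_mono) auto
          qed
          have tw: "norm ((\<Sum>n\<in>S. cis (\<theta> / ln x * ln (real n))) - of_nat (card S) * cis \<theta>) \<le> 100 * (Psi / ln x)"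
          proof -
            have "S \<subseteq> smooth_set x y" using smooth_set_mono[of x x z y] est(7) by (auto simp: S_def)
            then have "norm ((\<Sum>n\<in>S. cis (\<theta> / ln x * ln (real n))) - of_nat (card S) * cis \<theta>)
                \<le> 4 / ln x * (\<Sum>n\<in>smooth_set x y. ln (x / n))"
              by (rule sum_twist_near[OF _ x \<theta>])
            also have "\<dots> \<le> 4 / ln x * (25 * Psi)" using est(4) lnx by (intro mult_left_mono) auto
            finally show ?thesis by simp
          qed
          have v1: "4 * ln x * real (card S) / L ^ 4 \<le> 4 * (Psi / ln x)"
          proof -
            have "ln x * ln x \<le> L ^ 2 * L ^ 2" using lnx2 lnx by (intro mult_mono) auto
            then have "ln x / L ^ 4 \<le> 1 / ln x"
              using lnx L1 by (simp add: divide_simps flip: power_add)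
            then have "4 * (ln x / L ^ 4) * real (card S) \<le> 4 * (1 / ln x) * Psi"
              using SPsi lnx by (intro mult_mono) auto
            then show ?thesis by simp
          qed
          let ?G = "{X. dirichlet_character q X \<and>
            norm ((\<Sum>n=1..nat \<lfloor>x\<rfloor>. X n) - (\<Sum>n\<in>S. cis (\<theta> / ln x * ln n))) \<le>
              2 * (4 * ln x * card S / L ^ 4 + x / sqrt z)}"
          have cnt: "real q powr (1 - 2 / ln x) \<le> real (card ?G)"
            unfolding S_def z_def y_def L_def
            by (rule many_characters_near_twist_log)
              (use F q x xL in \<open>simp_all add: y_def[symmetric] L_def[symmetric] lamL yL\<close>)
          \<comment> \<open>116 is 16 from the weighted second moment and 100 from replacing the
            twist by the constant \<open>cis \<theta>\<close>; 104 C is the passage from z to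
            y.\<close>
          have first: "norm ((\<Sum>n=1..nat \<lfloor>x\<rfloor>. X n) - cis \<theta> * of_real cy) \<le> (116 + 104 * C) * (Psi * err)"
            if "X \<in> ?G" for X
          proof -
            let ?s = "\<Sum>n=1..nat \<lfloor>x\<rfloor>. X n" and ?t = "\<Sum>n\<in>S. cis (\<theta> / ln x * ln (real n))"
            have "norm (?s - ?t) \<le> 16 * (Psi / ln x)" using that v1 est(6) by simp
            moreover have "norm (of_nat (card S) * cis \<theta> - cis \<theta> * of_real cy) \<le> 104 * C * (Psi * err)"
            proof -
              have "of_nat (card S) * cis \<theta> - cis \<theta> * of_real cy = of_real (real (card S) - cy) * cis \<theta>"
                by (simp add: algebra_simps)
              then have "norm (of_nat (card S) * cis \<theta> - cis \<theta> * of_real cy) = \<bar>real (card S) - cy\<bar>"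
                by (simp only: norm_mult norm_of_real norm_cis mult_1_right)
              then show ?thesis using cz est(5) by simp
            qed
            moreover have "?s - cis \<theta> * of_real cy = (?s - ?t) + (?t - of_nat (card S) * cis \<theta>) +
                (of_nat (card S) * cis \<theta> - cis \<theta> * of_real cy)" by simp
            then have "norm (?s - cis \<theta> * of_real cy) \<le> norm (?s - ?t) +
              norm (?t - of_nat (card S) * cis \<theta>) + norm (of_nat (card S) * cis \<theta> - cis \<theta> * of_real cy)"
              by (metis (no_types, lifting) add_right_mono norm_triangle_ineq order_trans)
            ultimately have "norm (?s - cis \<theta> * of_real cy) \<le> 116 * (Psi * (1 / ln x)) + 104 * C * (Psi * err)"
              using tw by simp
            also have "\<dots> \<le> 116 * (Psi * err) + 104 * C * (Psi * err)"
              using lnx3 Psi0 by (intro add_right_mono mult_left_mono) auto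
            finally show ?thesis by (simp add: algebra_simps)
          qed
          have second: "norm ((\<Sum>n=1..nat \<lfloor>x\<rfloor>. X n) - cis \<theta> * of_real W) \<le> K * err * W"
            if X: "X \<in> ?G" and np: "\<forall>p. prime p \<and> real p < ln (real q) \<longrightarrow> \<not> p dvd q" for X
          proof -
            \<comment> \<open>Coprimality is proved only up to z < ln q, since the hypothesis speaks
              of primes strictly below ln q. The coprime count \<open>cy\<close> is then squeezed
              between the count for z and \<open>Psi\<close>, which nearly agree.\<close>
            have "S = smooth_set x z"
            proof -
              have "coprime n q" if n: "n \<in> smooth_set x z" for n
              proof (rule ccontr)
                assume "\<not> coprime n q"
                then have "gcd n q \<noteq> 1" by (metis coprime_iff_gcd_eq_1)
                then obtain p where "prime p" "p dvd gcd n q" using prime_factor_nat by blast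
                then have "prime p" "p dvd n" "p dvd q" by auto
                moreover from this have "real p \<le> z" using n by (auto simp: smooth_set_def)
                ultimately show False using np est(7) by (auto simp: y_def)
              qed
              then show ?thesis by (auto simp: S_def)
            qed
            then have "Psi - real (card S) \<le> 104 * C * (Psi * err)"
              using est(5) by (simp add: smooth_count_def)
            moreover have "cy \<le> Psi"
              unfolding cy_def Psi_def smooth_count_def by (intro of_nat_mono card_mono) auto
            ultimately have "\<bar>cy - W\<bar> \<le> 104 * C * (Psi * err) + (4 * C + 2) * (W * err)"
              using est(3) cz(1) by argo
            moreover have "norm (cis \<theta> * of_real cy - cis \<theta> * of_real W) = \<bar>cy - W\<bar>"
              by (simp only: right_diff_distrib[symmetric] norm_mult norm_cis mult_1 of_real_diff[symmetric] norm_of_real)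
            moreover have "norm ((\<Sum>n=1..nat \<lfloor>x\<rfloor>. X n) - cis \<theta> * of_real W) \<le>
              norm ((\<Sum>n=1..nat \<lfloor>x\<rfloor>. X n) - cis \<theta> * of_real cy) + norm (cis \<theta> * of_real cy - cis \<theta> * of_real W)"
              unfolding dist_norm[symmetric] by (rule dist_triangle)
            ultimately have "norm ((\<Sum>n=1..nat \<lfloor>x\<rfloor>. X n) - cis \<theta> * of_real W) \<le>
               (116 + 208 * C) * (Psi * err) + (4 * C + 2) * (W * err)"
              using first[OF X] by (simp add: algebra_simps)
            also have "\<dots> \<le> (116 + 208 * C) * (3 * W * err) + (4 * C + 2) * (W * err)"
              using est(2) err0 C by (intro add_right_mono mult_left_mono mult_right_mono) auto
            also have "\<dots> = (350 + 628 * C) * (W * err)" by (simp add: algebra_simps)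
            also have "\<dots> \<le> K * (W * err)"
              unfolding K_def using C est(1) err0 by (intro mult_right_mono) auto
            finally show ?thesis by (simp add: mult_ac)
          qed
          have "?G \<subseteq> ?H K q x \<theta>"
          proof (intro subsetI CollectI conjI impI)
            fix X assume X: "X \<in> ?G"
            then show "dirichlet_character q X" by simp
            let ?s = "\<Sum>n=1..nat \<lfloor>x\<rfloor>. X n"
            have "smooth_sum x (ln q) (principal_character q) = complex_of_real cy"
              by (simp add: smooth_sum_principal cy_def y_def)
            moreover have "(116 + 104 * C) * (Psi * err) \<le> K * (Psi * err)"
              unfolding K_def using C Psi0 err0 by (intro mult_right_mono) auto
            ultimately show "norm (?s - cis \<theta> * smooth_sum x (ln q) (principal_character q))
              \<le> K * (smooth_sum x (ln q) (\<lambda>_. 1) * error_term q x)"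
              using first[OF X] by (simp add: smooth_sum_one Psi_def err_def y_def)
            assume np: "\<forall>p. prime p \<and> real p < ln q \<longrightarrow> \<not> p dvd q"
            \<comment> \<open>The relative error with respect to the main term; it is well defined
              because \<open>W\<close> is at least 1.\<close>
            define \<epsilon> where "\<epsilon> = (?s - cis \<theta> * of_real W) / (cis \<theta> * of_real W)"
            have nz: "cis \<theta> * complex_of_real W \<noteq> 0" using est(1) by simp
            have "norm \<epsilon> = norm (?s - cis \<theta> * of_real W) / W"
              using est(1) by (simp add: \<epsilon>_def norm_divide norm_mult)
            also have "\<dots> \<le> K * err * W / W" using second[OF X np] est(1) by (intro divide_right_mono) auto
            also have "\<dots> = K * error_term q x" using est(1) by (simp add: err_def)
            finally have "norm \<epsilon> \<le> K * error_term q x" .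
            moreover have "?s = cis \<theta> * of_real W * (1 + \<epsilon>)"
              using nz by (simp add: \<epsilon>_def field_simps)
            then have "?s = of_real x * cis \<theta> * of_real (dickman (ln x / ln (ln q))) * (1 + \<epsilon>)"
              by (simp add: W_def L_def mult_ac)
            ultimately show "\<exists>\<epsilon>. norm \<epsilon> \<le> K * error_term q x \<and>
                ?s = of_real x * cis \<theta> * of_real (dickman (ln x / ln (ln q))) * (1 + \<epsilon>)" by blast
          qed
          moreover have "finite (?H K q x \<theta>)"
            by (rule finite_subset[OF _ finite_dirichlet_characters[of q]]) (use q in auto)
          ultimately have "real (card ?G) \<le> real (card (?H K q x \<theta>))" by (intro of_nat_mono card_mono)
          then show ?thesis using cnt by linarith
        qed
      qed
    qed
  qed
qed

end
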